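(* Let $M_0$ be a closed connected manifold with fundamental group $G=\pi_1(M_0,x_0)$, where $x_0\in M_0$ is a basepoint, and let $f\colon\mathcal{S}\to M_0$ be a weak solenoid with Cantor fiber $X=f^{-1}(x_0)$ and basepoint $x\in X$. Suppose the minimal equicontinuous monodromy action $(X,G,\Phi)$ on the fiber is not weakly normal, but has a non-trivial finite discriminant group $\mathcal{D}_x$. Then there exists a finite-to-one covering map $p_0\colon M_0'\to M_0$ such that the pullback solenoid $\mathcal{S}'$ is a covering of $\mathcal{S}$ which is not homeomorphic to $\mathcal{S}$.
   Context: A weak solenoid $\mathcal{S}$ is the inverse limit of an increasing sequence of non-trivial finite-to-one coverings $M_\ell\to M_0$ of a closed connected manifold $M_0$, i.e. of a tower $\cdots\to M_2\to M_1\to M_0$ of connected non-trivial finite coverings. The projection $f\colon\mathcal{S}\to M_0$ is a fiber bundle whose fiber $X=f^{-1}(x_0)$ is a Cantor set. Path lifting in the coverings $M_\ell\to M_0$ induces the monodromy action $\Phi\colon G\times X\to X$ of $G=\pi_1(M_0,x_0)$, which is minimal and equicontinuous. A point $x=(x_i)\in X$ determines the group chain $\{G_i\}_{i\ge0}$ (a properly descending chain of finite-index subgroups with $G_0=G$) where $G_i\subset G$ is the image of $\pi_1(M_i,x_i)$. With $C_i=\bigcap_{g\in G}gG_ig^{-1}$, the discriminant group at $x$ is the profinite group $\mathcal{D}_x=\varprojlim\{G_{i+1}/C_{i+1}\to G_i/C_i\}$, with bonding maps induced by inclusion of cosets; up to isomorphism it does not depend on the choice of group chain presenting the action $(X,G,\Phi)$.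 Two group chains $\{G_i\}$, $\{H_i\}$ in the same group $G$ are equivalent if there are infinite subsequences with $G_{i_0}\supset H_{j_0}\supset G_{i_1}\supset H_{j_1}\supset\cdots$ forming a group chain in $G$. They are conjugate equivalent if there is a sequence $(g_i)$ in $G$ with $g_iG_i=g_jG_i$ for all $i\ge0$ and all $j\ge i$ such that $\{g_iG_ig_i^{-1}\}$ and $\{H_i\}$ are equivalent. A group chain $\{G_i\}_{i\ge0}$ is weakly normal if there is $i_0\ge0$ such that, for the truncated chain $\{G_i\}_{i\ge i_0}$ viewed as a group chain in the group $G_{i_0}$, every group chain in $G_{i_0}$ which is conjugate equivalent to it (in $G_{i_0}$) is equivalent to it. The action $(X,G,\Phi)$ is weakly normal if its group chain $\{G_i\}$ is. Given a finite covering $p_0\colon M_0'\to M_0$ with $M_0'$ connected, corresponding to a finite-index subgroup $G_0'\subset G$, the pullback solenoid $\mathcal{S}'\to M_0'$ is the inverse limit $\mathcal{S}'=\varprojlim\{M_i'\to M_{i-1}'\}$, where $M_i'$ is the covering of $M_0'$ (pulled back from $M_i\to M_0$) with fundamental group $G_i\cap G_0'$. *)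

theory Defs
  imports "HOL-Analysis.Analysis" "HOL-Algebra.Product_Groups"
begin

section \<open>Manifolds and covering maps of abstract topologies\<close>

definition locally_Euclidean_dim :: "nat \<Rightarrow> 'a topology \<Rightarrow> bool" where
  "locally_Euclidean_dim n X \<longleftrightarrow>
     (\<forall>x \<in> topspace X. \<exists>U V. openin X U \<and> x \<in> U \<and> openin (Euclidean_space n) V \<and>
        subtopology X U homeomorphic_space subtopology (Euclidean_space n) V)"

definition closed_manifold :: "'a topology \<Rightarrow> bool" where
  "closed_manifold X \<longleftrightarrow>
     compact_space X \<and> Hausdorff_space X \<and> second_countable X \<and> (\<exists>n. locally_Euclidean_dim n X)"

text \<open>The library's \<^const>\<open>covering_space\<close> is restricted to subspaces of a type-class space;
  the following is its literal counterpart for abstract topologies.\<close>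

definition covering_map :: "'a topology \<Rightarrow> 'b topology \<Rightarrow> ('a \<Rightarrow> 'b) \<Rightarrow> bool" where
  "covering_map X Y p \<longleftrightarrow>
     continuous_map X Y p \<and> p ` topspace X = topspace Y \<and>
     (\<forall>y \<in> topspace Y. \<exists>V. y \<in> V \<and> openin Y V \<and>
        (\<exists>\<U>. \<Union>\<U> = {x \<in> topspace X. p x \<in> V} \<and> (\<forall>U \<in> \<U>. openin X U) \<and> pairwise disjnt \<U> \<and>
             (\<forall>U \<in> \<U>. homeomorphic_map (subtopology X U) (subtopology Y V) p)))"

definition finite_covering_map :: "'a topology \<Rightarrow> 'b topology \<Rightarrow> ('a \<Rightarrow> 'b) \<Rightarrow> bool" where
  "finite_covering_map X Y p \<longleftrightarrow>
     covering_map X Y p \<and> (\<forall>y \<in> topspace Y. finite {x \<in> topspace X. p x = y})"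


section \<open>The fundamental group\<close>

definition loop_at :: "'a topology \<Rightarrow> 'a \<Rightarrow> (real \<Rightarrow> 'a) \<Rightarrow> bool" where
  "loop_at X a g \<longleftrightarrow> pathin X g \<and> g 0 = a \<and> g 1 = a"

definition loop_homotopic :: "'a topology \<Rightarrow> 'a \<Rightarrow> (real \<Rightarrow> 'a) \<Rightarrow> (real \<Rightarrow> 'a) \<Rightarrow> bool" where
  "loop_homotopic X a = homotopic_with (\<lambda>r. r 0 = a \<and> r 1 = a) (top_of_set {0..1}) X"

definition loop_class :: "'a topology \<Rightarrow> 'a \<Rightarrow> (real \<Rightarrow> 'a) \<Rightarrow> (real \<Rightarrow> 'a) set" where
  "loop_class X a g = {h. loop_homotopic X a g h}"

definition path_concat :: "(real \<Rightarrow> 'a) \<Rightarrow> (real \<Rightarrow> 'a) \<Rightarrow> real \<Rightarrow> 'a" where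
  "path_concat g h = (\<lambda>t. if t \<le> 1/2 then g (2 * t) else h (2 * t - 1))"

definition fundamental_group :: "'a topology \<Rightarrow> 'a \<Rightarrow> (real \<Rightarrow> 'a) set monoid" where
  "fundamental_group X a =
     \<lparr>carrier = loop_class X a ` Collect (loop_at X a),
      monoid.mult = (\<lambda>A B. \<Union>g \<in> A. \<Union>h \<in> B. loop_class X a (path_concat g h)),
      one = loop_class X a (\<lambda>t. a)\<rparr>"

text \<open>The image of \<open>\<pi>\<^sub>1(Y, b)\<close> in \<open>\<pi>\<^sub>1(X, q b)\<close> under the homomorphism induced by \<open>q\<close>.\<close>

definition fundamental_group_image ::
  "'b topology \<Rightarrow> 'b \<Rightarrow> 'a topology \<Rightarrow> ('b \<Rightarrow> 'a) \<Rightarrow> (real \<Rightarrow> 'a) set set" where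
  "fundamental_group_image Y b X q = {loop_class X (q b) (q \<circ> g) |g. loop_at Y b g}"


section \<open>Group chains\<close>

definition group_chain :: "('a, 'b) monoid_scheme \<Rightarrow> (nat \<Rightarrow> 'a set) \<Rightarrow> bool" where
  "group_chain G Gs \<longleftrightarrow>
     Gs 0 = carrier G \<and>
     (\<forall>i. subgroup (Gs i) G \<and> finite (rcosets\<^bsub>G\<^esub> (Gs i)) \<and> Gs (Suc i) \<subset> Gs i)"

definition chain_equivalent ::
  "('a, 'b) monoid_scheme \<Rightarrow> (nat \<Rightarrow> 'a set) \<Rightarrow> (nat \<Rightarrow> 'a set) \<Rightarrow> bool" where
  "chain_equivalent G Gs Hs \<longleftrightarrow>
     (\<exists>Ks i j. group_chain G Ks \<and> strict_mono i \<and> strict_mono j \<and>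
        (\<forall>k::nat. Ks (2 * k) = Gs (i k) \<and> Ks (2 * k + 1) = Hs (j k)))"

definition conjugate_subgroup :: "('a, 'b) monoid_scheme \<Rightarrow> 'a \<Rightarrow> 'a set \<Rightarrow> 'a set" where
  "conjugate_subgroup G g H = (g <#\<^bsub>G\<^esub> H) #>\<^bsub>G\<^esub> inv\<^bsub>G\<^esub> g"

definition chain_conjugate_equivalent ::
  "('a, 'b) monoid_scheme \<Rightarrow> (nat \<Rightarrow> 'a set) \<Rightarrow> (nat \<Rightarrow> 'a set) \<Rightarrow> bool" where
  "chain_conjugate_equivalent G Gs Hs \<longleftrightarrow>
     (\<exists>g::nat \<Rightarrow> 'a. (\<forall>i. g i \<in> carrier G) \<and>
        (\<forall>i. \<forall>j\<ge>i. g i <#\<^bsub>G\<^esub> Gs i = g j <#\<^bsub>G\<^esub> Gs i) \<and>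
        chain_equivalent G (\<lambda>i. conjugate_subgroup G (g i) (Gs i)) Hs)"

definition weakly_normal_chain :: "('a, 'b) monoid_scheme \<Rightarrow> (nat \<Rightarrow> 'a set) \<Rightarrow> bool" where
  "weakly_normal_chain G Gs \<longleftrightarrow>
     (\<exists>i0. let G0 = G\<lparr>carrier := Gs i0\<rparr>; Gt = (\<lambda>i. Gs (i0 + i)) in
        \<forall>Hs. group_chain G0 Hs \<and> chain_conjugate_equivalent G0 Gt Hs \<longrightarrow>
             chain_equivalent G0 Gt Hs)"

definition normal_core :: "('a, 'b) monoid_scheme \<Rightarrow> 'a set \<Rightarrow> 'a set" where
  "normal_core G H = (\<Inter>g \<in> carrier G. conjugate_subgroup G g H)"

definition inverse_limit_group ::
  "(nat \<Rightarrow> ('a, 'b) monoid_scheme) \<Rightarrow> (nat \<Rightarrow> 'a \<Rightarrow> 'a) \<Rightarrow> (nat \<Rightarrow> 'a) monoid" where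
  "inverse_limit_group Q \<phi> =
     (product_group UNIV Q)
       \<lparr>carrier := {f \<in> carrier (product_group UNIV Q). \<forall>i. \<phi> i (f (Suc i)) = f i}\<rparr>"

text \<open>With \<open>C i\<close> the core of \<open>Gs i\<close> in \<open>G\<close>, the bonding map sends a coset \<open>A\<close> of \<open>C (Suc i)\<close> to
  \<open>C i <#> A\<close>, which is the unique coset of \<open>C i\<close> containing \<open>A\<close>.
  Only the underlying abstract group of this profinite group is represented.\<close>

definition discriminant_group ::
  "('a, 'b) monoid_scheme \<Rightarrow> (nat \<Rightarrow> 'a set) \<Rightarrow> (nat \<Rightarrow> 'a set) monoid" where
  "discriminant_group G Gs =
     inverse_limit_group
       (\<lambda>i. G\<lparr>carrier := Gs i\<rparr> Mod normal_core G (Gs i))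
       (\<lambda>i A. normal_core G (Gs i) <#>\<^bsub>G\<^esub> A)"


section \<open>Weak solenoids\<close>

definition inverse_limit_space ::
  "(nat \<Rightarrow> 'a topology) \<Rightarrow> (nat \<Rightarrow> 'a \<Rightarrow> 'a) \<Rightarrow> (nat \<Rightarrow> 'a) topology" where
  "inverse_limit_space M p =
     subtopology (product_topology M UNIV) {u. \<forall>i. p i (u (Suc i)) = u i}"

text \<open>A presentation of a weak solenoid: \<open>p i\<close> maps \<open>M (Suc i)\<close> to \<open>M i\<close>. As the spaces are
  connected, a covering is non-trivial iff it is not injective.\<close>

definition weak_solenoid_tower :: "(nat \<Rightarrow> 'a topology) \<Rightarrow> (nat \<Rightarrow> 'a \<Rightarrow> 'a) \<Rightarrow> bool" where
  "weak_solenoid_tower M p \<longleftrightarrow>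
     closed_manifold (M 0) \<and>
     (\<forall>i. connected_space (M i) \<and> finite_covering_map (M (Suc i)) (M i) (p i) \<and>
          \<not> inj_on (p i) (topspace (M (Suc i))))"

definition solenoid_fiber ::
  "(nat \<Rightarrow> 'a topology) \<Rightarrow> (nat \<Rightarrow> 'a \<Rightarrow> 'a) \<Rightarrow> 'a \<Rightarrow> (nat \<Rightarrow> 'a) set" where
  "solenoid_fiber M p x0 = {u \<in> topspace (inverse_limit_space M p). u 0 = x0}"

primrec tower_proj :: "(nat \<Rightarrow> 'a \<Rightarrow> 'a) \<Rightarrow> nat \<Rightarrow> 'a \<Rightarrow> 'a" where
  "tower_proj p 0 = id"
| "tower_proj p (Suc i) = tower_proj p i \<circ> p i"

text \<open>The group chain in \<open>\<pi>\<^sub>1(M 0, x 0)\<close> of the monodromy action at the point \<open>x\<close> of the fiber.\<close>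

definition monodromy_chain ::
  "(nat \<Rightarrow> 'a topology) \<Rightarrow> (nat \<Rightarrow> 'a \<Rightarrow> 'a) \<Rightarrow> (nat \<Rightarrow> 'a) \<Rightarrow> nat \<Rightarrow> (real \<Rightarrow> 'a) set set" where
  "monodromy_chain M p x = (\<lambda>i. fundamental_group_image (M i) (x i) (M 0) (tower_proj p i))"


section \<open>Pullback solenoids\<close>

definition fiber_product ::
  "'a topology \<Rightarrow> 'b topology \<Rightarrow> ('a \<Rightarrow> 'c) \<Rightarrow> ('b \<Rightarrow> 'c) \<Rightarrow> ('a \<times> 'b) topology" where
  "fiber_product X Y f g = subtopology (prod_topology X Y) {(y, z). f y = g z}"

text \<open>The fiber product of \<open>M i\<close> and \<open>N\<close> over \<open>M 0\<close> need not be connected. Its component at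
  \<open>(x i, b)\<close> is the connected covering of \<open>N\<close> whose fundamental group has as image in
  \<open>\<pi>\<^sub>1(M 0, x 0)\<close> the intersection of the images of \<open>\<pi>\<^sub>1(M i, x i)\<close> and \<open>\<pi>\<^sub>1(N, b)\<close>: a loop of
  \<open>M 0\<close> lifts to a loop at \<open>(x i, b)\<close> iff its lifts at \<open>x i\<close> and at \<open>b\<close> are both closed.\<close>

definition pullback_tower ::
  "(nat \<Rightarrow> 'a topology) \<Rightarrow> (nat \<Rightarrow> 'a \<Rightarrow> 'a) \<Rightarrow> (nat \<Rightarrow> 'a) \<Rightarrow>
   'b topology \<Rightarrow> ('b \<Rightarrow> 'a) \<Rightarrow> 'b \<Rightarrow> nat \<Rightarrow> ('a \<times> 'b) topology" where
  "pullback_tower M p x N q b =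
     (\<lambda>i. let F = fiber_product (M i) N (tower_proj p i) q in
          subtopology F (connected_component_of_set F (x i, b)))"

definition pullback_solenoid ::
  "(nat \<Rightarrow> 'a topology) \<Rightarrow> (nat \<Rightarrow> 'a \<Rightarrow> 'a) \<Rightarrow> (nat \<Rightarrow> 'a) \<Rightarrow>
   'b topology \<Rightarrow> ('b \<Rightarrow> 'a) \<Rightarrow> 'b \<Rightarrow> (nat \<Rightarrow> 'a \<times> 'b) topology" where
  "pullback_solenoid M p x N q b =
     inverse_limit_space (pullback_tower M p x N q b) (\<lambda>i (y, z). (p i y, z))"

text \<open>The map of inverse limits induced by the projections of the pullbacks to the \<open>M i\<close>.\<close>

definition pullback_solenoid_proj :: "(nat \<Rightarrow> 'a \<times> 'b) \<Rightarrow> nat \<Rightarrow> 'a" where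
  "pullback_solenoid_proj u = (\<lambda>i. fst (u i))"

end

(* A homeomorphism cannot see the tower, but it preserves paths and closeness. Call a space of stable
   return if, of two paths staying close to each other, the second almost closes up (after a short
   correction) as soon as the first one closes up sufficiently well. In a solenoid close paths are
   lifts of nearby paths of the base, so stable return says: for a loop of some M n, being closed up
   to level i at one point of the fiber forces it to be closed up to level m at all of them. If the
   chain is not weakly normal, this fails at the base point for every n. If the discriminant is
   finite, it embeds into some G_n / C_n, and by compactness there is, for every m, an i such that
   the intersection of G_i and C_n is contained in C_m; so the pullback along a covering whose group
   lies in C_n is of stable return. *)
theory Submission
  imports Defs
begin

section \<open>Entourages of compact Hausdorff spaces\<close>

text \<open>The order of quantifiers in \<open>stable_return\<close> shapes the proof:
  \<open>N1\<close>, the closeness of the two paths, is fixed before the precision \<open>N\<close>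
  asked of the second path. Precision means a level m of the tower, so nearby paths must have
  comparable lifts at all levels with one threshold in the base. Evenly covered sets may shrink with
  the level; small boxes in charts of the manifold do not, since loops in them are null-homotopic
  and so lift to loops in every covering (\<open>good_over\<close>). Points of a solenoid can be
  close along a leaf or transversally, and only transversal closeness reflects the chain; the
  correcting path, bounded by \<open>N2\<close>, absorbs the leafwise part. Closeness is expressed
  by open neighbourhoods of the diagonal, hence by the topology alone, which makes the homeomorphism
  invariance immediate. The core matters for the pullback because the points of return are
  arbitrary: a loop must be conjugated to the base point and back, and only membership in a normal
  subgroup survives this.\<close>

definition entourage :: "'a topology \<Rightarrow> ('a \<times> 'a) set \<Rightarrow> bool" where
  "entourage X N \<longleftrightarrow> openin (prod_topology X X) N \<and> (\<forall>x \<in> topspace X. (x, x) \<in> N)"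

lemma entourage_subset: "entourage X N \<Longrightarrow> N \<subseteq> topspace X \<times> topspace X"
  unfolding entourage_def by (metis openin_subset topspace_prod_topology)

lemma entourage_refl: "entourage X N \<Longrightarrow> x \<in> topspace X \<Longrightarrow> (x, x) \<in> N"
  by (simp add: entourage_def)

lemma entourage_openin: "entourage X N \<Longrightarrow> openin (prod_topology X X) N"
  by (simp add: entourage_def)

lemma entourage_Int: "entourage X N \<Longrightarrow> entourage X N' \<Longrightarrow> entourage X (N \<inter> N')"
  by (simp add: entourage_def openin_Int)

lemma entourage_vimage:
  assumes f: "continuous_map X Y f" and N: "entourage Y N"
  shows "entourage X {(x, y). x \<in> topspace X \<and> y \<in> topspace X \<and> (f x, f y) \<in> N}"
proof -
  have "continuous_map (prod_topology X X) (prod_topology Y Y) (\<lambda>z. (f (fst z), f (snd z)))"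
    by (intro continuous_map_paired[THEN iffD2] conjI continuous_map_of_fst continuous_map_of_snd f
        continuous_map_compose[OF continuous_map_fst f, unfolded o_def]
        continuous_map_compose[OF continuous_map_snd f, unfolded o_def])
  from openin_continuous_map_preimage[OF this entourage_openin[OF N]]
  have "openin (prod_topology X X) {z \<in> topspace (prod_topology X X). (f (fst z), f (snd z)) \<in> N}" .
  moreover have "{z \<in> topspace (prod_topology X X). (f (fst z), f (snd z)) \<in> N}
      = {(x, y). x \<in> topspace X \<and> y \<in> topspace X \<and> (f x, f y) \<in> N}"
    by auto
  ultimately show ?thesis
    using f N unfolding entourage_def continuous_map_def by auto
qed

lemma entourage_Union_squares:
  assumes "\<And>x. x \<in> topspace X \<Longrightarrow> \<exists>U. openin X U \<and> x \<in> U \<and> Q U"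
  shows "entourage X (\<Union>{U \<times> U |U. openin X U \<and> Q U})"
  unfolding entourage_def
proof (intro conjI ballI openin_Union)
  fix x assume "x \<in> topspace X"
  then obtain U where "openin X U" "x \<in> U" "Q U" using assms by blast
  then show "(x, x) \<in> \<Union>{U \<times> U |U. openin X U \<and> Q U}" by blast
qed (auto simp: openin_prod_Times_iff)

lemma entourage_square:
  assumes N: "entourage X N" and x: "x \<in> topspace X"
  obtains U where "openin X U" "x \<in> U" "U \<times> U \<subseteq> N"
proof -
  from N x have "(x, x) \<in> N" "openin (prod_topology X X) N" by (auto simp: entourage_def)
  then obtain U V where "openin X U" "openin X V" "x \<in> U" "x \<in> V" "U \<times> V \<subseteq> N"
    unfolding openin_prod_topology_alt by metis
  then show thesis by (intro that[of "U \<inter> V"]) auto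
qed

text \<open>The Lebesgue number lemma without a metric. Regularity puts a closed set
  \<open>C a\<close> between a smaller open set \<open>V a\<close> and a member \<open>W a\<close>
  of the cover, and finitely many of the \<open>V a\<close> already cover the space.\<close>

lemma Lebesgue_entourage:
  assumes comp: "compact_space X" and "Hausdorff_space X"
    and cover: "\<And>x. x \<in> topspace X \<Longrightarrow> \<exists>W \<in> \<W>. openin X W \<and> x \<in> W"
  obtains N where "entourage X N"
    "\<forall>x \<in> topspace X. \<exists>W \<in> \<W>. x \<in> W \<and> openin X W \<and> N `` {x} \<subseteq> W"
proof -
  have reg: "neighbourhood_base_of (closedin X) X"
    using assms compact_Hausdorff_imp_regular_space neighbourhood_base_of_closedin by blast
  have "\<exists>V C W. W \<in> \<W> \<and> openin X V \<and> closedin X C \<and> openin X W \<and> x \<in> V \<and> V \<subseteq> C \<and> C \<subseteq> W"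
    if "x \<in> topspace X" for x
    using cover[OF that] reg unfolding neighbourhood_base_of by metis
  then obtain V C W where VCW: "\<And>x. x \<in> topspace X \<Longrightarrow>
      W x \<in> \<W> \<and> openin X (V x) \<and> closedin X (C x) \<and> openin X (W x) \<and> x \<in> V x \<and> V x \<subseteq> C x \<and> C x \<subseteq> W x"
    by metis
  have "\<exists>\<F>. finite \<F> \<and> \<F> \<subseteq> V ` topspace X \<and> topspace X \<subseteq> \<Union>\<F>"
    using comp VCW unfolding compact_space_alt
    by (elim allE[of _ "V ` topspace X"]) auto
  then obtain F where F: "finite F" "F \<subseteq> topspace X" "topspace X \<subseteq> (\<Union>a\<in>F. V a)"
    by (metis finite_subset_image)
  \<comment> \<open>The condition for \<open>a\<close> says that a first component in
    \<open>C a\<close> forces the second into \<open>W a\<close>. As \<open>C a\<close> is closed,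
    this is open in the pair, and only finitely many such conditions are intersected.\<close>
  define N where "N = (topspace X \<times> topspace X) \<inter>
     (\<Inter>a\<in>F. (topspace X - C a) \<times> topspace X \<union> topspace X \<times> W a)"
  have "openin (prod_topology X X) N"
  proof (cases "F = {}")
    case True
    then show ?thesis by (simp add: N_def openin_prod_Times_iff)
  next
    case False
    then show ?thesis unfolding N_def using F VCW
    proof (intro openin_Int openin_Inter)
      fix O' assume "O' \<in> (\<lambda>a. (topspace X - C a) \<times> topspace X \<union> topspace X \<times> W a) ` F"
      then obtain a where a: "a \<in> F" "O' = (topspace X - C a) \<times> topspace X \<union> topspace X \<times> W a" by auto
      then have "openin X (topspace X - C a)" "openin X (W a)" using VCW F by auto
      then show "openin (prod_topology X X) O'"
        unfolding a(2) by (intro openin_Un) (simp_all add: openin_prod_Times_iff)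
    qed (auto simp: openin_prod_Times_iff)
  qed
  moreover have "(x, x) \<in> N" if "x \<in> topspace X" for x
    using that VCW F by (auto simp: N_def)
  moreover have "\<exists>W \<in> \<W>. x \<in> W \<and> openin X W \<and> N `` {x} \<subseteq> W" if x: "x \<in> topspace X" for x
  proof -
    obtain a where a: "a \<in> F" "x \<in> V a" using F x by auto
    then have "a \<in> topspace X" using F by auto
    then show ?thesis using VCW[of a] a by (intro bexI[of _ "W a"]) (auto simp: N_def)
  qed
  ultimately show thesis using that[of N] unfolding entourage_def by blast
qed

text \<open>Apply the Lebesgue entourage to the open sets \<open>W\<close> with
  \<open>W \<times> W \<subseteq> N\<close>: points \<open>a\<close> and \<open>c\<close> that are
  both close to \<open>b\<close> lie in one such \<open>W\<close>. Intersecting with the converse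
  lets \<open>a\<close> be reached from \<open>b\<close>.\<close>

lemma entourage_symmetric_square_root:
  assumes comp: "compact_space X" "Hausdorff_space X" and N: "entourage X N"
  obtains N' where "entourage X N'" "sym N'" "N' O N' \<subseteq> N" "N' \<subseteq> N"
proof -
  have "\<exists>W \<in> {W. W \<times> W \<subseteq> N}. openin X W \<and> x \<in> W" if "x \<in> topspace X" for x
    using entourage_square[OF N that] by auto
  then obtain N1 where N1: "entourage X N1"
    "\<forall>x \<in> topspace X. \<exists>W \<in> {W. W \<times> W \<subseteq> N}. x \<in> W \<and> openin X W \<and> N1 `` {x} \<subseteq> W"
    by (rule Lebesgue_entourage[OF comp, of "{W. W \<times> W \<subseteq> N}"]) blast
  define N' where "N' = N1 \<inter> N1\<inverse>"
  have "openin (prod_topology X X) (N1\<inverse>)"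
  proof -
    have "openin (prod_topology X X) {z \<in> topspace (prod_topology X X). prod.swap z \<in> N1}"
      by (rule openin_continuous_map_preimage[OF _ entourage_openin[OF N1(1)]])
        (use homeomorphic_map_swap[of X X] in \<open>auto simp: prod.swap_def homeomorphic_imp_continuous_map case_prod_unfold\<close>)
    moreover have "{z \<in> topspace (prod_topology X X). prod.swap z \<in> N1} = N1\<inverse>"
      using entourage_subset[OF N1(1)] by auto
    ultimately show ?thesis by simp
  qed
  then have ent: "entourage X N'" using N1(1) by (auto simp: entourage_def N'_def)
  have sym: "sym N'" by (auto simp: sym_def N'_def)
  have comp': "N' O N' \<subseteq> N"
  proof clarify
    fix a b c assume abc: "(a, b) \<in> N'" "(b, c) \<in> N'"
    then have b: "b \<in> topspace X" using entourage_subset[OF ent] by auto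
    from N1(2) b obtain W where "W \<times> W \<subseteq> N" "N1 `` {b} \<subseteq> W" by auto
    with abc show "(a, c) \<in> N" by (auto simp: N'_def)
  qed
  have "N' \<subseteq> N"
  proof clarify
    fix a b assume ab: "(a, b) \<in> N'"
    then have "(b, b) \<in> N'" using entourage_subset[OF ent] entourage_refl[OF ent] by auto
    with ab comp' show "(a, b) \<in> N" by auto
  qed
  with ent sym comp' show thesis using that by blast
qed


section \<open>Paths in abstract topologies\<close>

lemma pathin_continuous_image: "pathin X g \<Longrightarrow> continuous_map X Y f \<Longrightarrow> pathin Y (\<lambda>t. f (g t))"
  using pathin_compose[of X g Y f] by (simp add: o_def)

lemma pathin_reparam:
  assumes g: "pathin X g" and f: "continuous_on {0..1} f" "f ` {0..1} \<subseteq> {0..1::real}"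
  shows "pathin X (\<lambda>t. g (f t))"
proof -
  have "continuous_map (top_of_set {0..1}) (top_of_set {0..1}) f"
    using f by (auto simp: continuous_map_in_subtopology)
  from continuous_map_compose[OF this] g show ?thesis
    by (auto simp: pathin_def o_def)
qed

lemma pathin_in_topspace: "pathin X g \<Longrightarrow> t \<in> {0..1} \<Longrightarrow> g t \<in> topspace X"
  using path_image_subset_topspace by fastforce

lemma pathin_reverse: "pathin X g \<Longrightarrow> pathin X (\<lambda>t. g (1 - t))"
  by (rule pathin_reparam) (auto intro!: continuous_intros)

text \<open>The unordered \<open>closed_segment\<close> allows the path to be run in either
  direction, as is needed when a parameter is approached from both sides.\<close>

lemma path_component_of_segment:
  assumes g: "pathin X g" and ab: "a \<in> {0..1}" "b \<in> {0..1}"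
    and W: "\<And>t. t \<in> closed_segment a b \<Longrightarrow> g t \<in> W"
  shows "path_component_of (subtopology X W) (g a) (g b)"
proof -
  let ?f = "\<lambda>t. (1 - t) * a + t * b"
  have seg: "?f t \<in> closed_segment a b" if "t \<in> {0..1}" for t
    using that by (auto simp: closed_segment_def)
  have sub: "closed_segment a b \<subseteq> {0..1}"
    using ab by (auto simp: closed_segment_eq_real_ivl split: if_splits)
  have "pathin X (\<lambda>t. g (?f t))"
  proof (rule pathin_reparam[OF g])
    show "?f ` {0..1} \<subseteq> {0..1}" using seg sub by blast
  qed (intro continuous_intros)
  then have "pathin (subtopology X W) (\<lambda>t. g (?f t))"
    using seg W by (simp add: pathin_subtopology)
  then show ?thesis unfolding path_component_of_def
    by (intro exI[of _ "\<lambda>t. g (?f t)"]) auto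
qed

lemma pathin_locally_in_open:
  assumes g: "pathin X g" and W: "openin X W" and x: "x \<in> {0..1}" "g x \<in> W"
  obtains d where "d > 0" "\<And>t. t \<in> {0..1} \<Longrightarrow> \<bar>t - x\<bar> < d \<Longrightarrow> g t \<in> W"
proof -
  have "openin (top_of_set {0..1}) {t \<in> {0..1}. g t \<in> W}"
    using openin_continuous_map_preimage[OF g[unfolded pathin_def] W] by simp
  then obtain d where "d > 0" "\<And>t. t \<in> {0..1} \<Longrightarrow> dist t x < d \<Longrightarrow> t \<in> {t \<in> {0..1}. g t \<in> W}"
    unfolding openin_euclidean_subtopology_iff using x by blast
  then show thesis using that[of d] by (simp add: dist_real_def)
qed

lemma path_concat_0 [simp]: "path_concat g h 0 = g 0"
  and path_concat_1 [simp]: "path_concat g h 1 = h 1"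
  by (auto simp: path_concat_def)

lemma pathin_concat:
  assumes g: "pathin X g" and h: "pathin X h" and gh: "g 1 = h 0"
  shows "pathin X (path_concat g h)"
proof -
  let ?T = "top_of_set {0..1::real}"
  have 1: "continuous_map (top_of_set {0..1/2}) ?T (\<lambda>t. 2 * t)"
    and 2: "continuous_map (top_of_set {1/2..1}) ?T (\<lambda>t. 2 * t - 1)"
    by (auto simp: continuous_map_in_subtopology intro!: continuous_intros)
  have "continuous_map ?T X (\<lambda>t. if t \<le> 1/2 then (g \<circ> (\<lambda>t. 2 * t)) t else (h \<circ> (\<lambda>t. 2 * t - 1)) t)"
  proof (rule continuous_map_cases_le)
    have eq: "{0..1} \<inter> {t. t \<in> topspace ?T \<and> t \<le> 1/2} = {0..1/2}"
       "{0..1} \<inter> {t. t \<in> topspace ?T \<and> 1/2 \<le> t} = {1/2..1}" by auto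
    show "continuous_map (subtopology ?T {t \<in> topspace ?T. t \<le> 1/2}) X (g \<circ> (\<lambda>t. 2 * t))"
      unfolding subtopology_subtopology eq using continuous_map_compose[OF 1] g by (auto simp: pathin_def)
    show "continuous_map (subtopology ?T {t \<in> topspace ?T. 1/2 \<le> t}) X (h \<circ> (\<lambda>t. 2 * t - 1))"
      unfolding subtopology_subtopology eq using continuous_map_compose[OF 2] h by (auto simp: pathin_def)
    show "(g \<circ> (\<lambda>t. 2 * t)) t = (h \<circ> (\<lambda>t. 2 * t - 1)) t" if "t \<in> topspace ?T" "t = 1/2" for t
    proof -
      have "2 * t = 1" "2 * t - 1 = 0" using that by auto
      then show ?thesis by (simp only: o_apply gh)
    qed
  qed auto
  then show ?thesis by (simp only: pathin_def path_concat_def o_def)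
qed


section \<open>Evenly covered sets and path lifting\<close>

definition evenly_covered :: "'a topology \<Rightarrow> 'b topology \<Rightarrow> ('a \<Rightarrow> 'b) \<Rightarrow> 'b set \<Rightarrow> bool" where
  "evenly_covered X Y p V \<longleftrightarrow> openin Y V \<and>
     (\<exists>\<U>. \<Union>\<U> = {x \<in> topspace X. p x \<in> V} \<and> (\<forall>U \<in> \<U>. openin X U) \<and> pairwise disjnt \<U> \<and>
          (\<forall>U \<in> \<U>. homeomorphic_map (subtopology X U) (subtopology Y V) p))"

lemma covering_map_evenly_covered:
  "covering_map X Y p \<longleftrightarrow> continuous_map X Y p \<and> p ` topspace X = topspace Y \<and>
     (\<forall>y \<in> topspace Y. \<exists>V. y \<in> V \<and> evenly_covered X Y p V)"
  unfolding covering_map_def evenly_covered_def by blast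

lemma covering_map_continuous: "covering_map X Y p \<Longrightarrow> continuous_map X Y p"
  by (simp add: covering_map_def)

lemma covering_map_surj: "covering_map X Y p \<Longrightarrow> p ` topspace X = topspace Y"
  by (simp add: covering_map_def)

lemma covering_map_in: "covering_map X Y p \<Longrightarrow> x \<in> topspace X \<Longrightarrow> p x \<in> topspace Y"
  by (auto simp: covering_map_def)

lemma covering_map_nbhd:
  assumes "covering_map X Y p" "y \<in> topspace Y"
  obtains V where "y \<in> V" "evenly_covered X Y p V"
  using assms by (auto simp: covering_map_evenly_covered)

text \<open>The rest of the preimage is recorded as open too, so the slice is clopen in the preimage
  of \<open>V\<close> and no path over \<open>V\<close> can leave it.\<close>

lemma evenly_covered_slice:
  assumes V: "evenly_covered X Y p V" and e: "e \<in> topspace X" "p e \<in> V"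
  obtains U s where "openin X U" "e \<in> U" "U \<subseteq> {x \<in> topspace X. p x \<in> V}"
    "openin X ({x \<in> topspace X. p x \<in> V} - U)"
    "homeomorphic_maps (subtopology X U) (subtopology Y V) p s"
proof -
  obtain \<U> where \<U>: "\<Union>\<U> = {x \<in> topspace X. p x \<in> V}" "\<forall>U \<in> \<U>. openin X U" "pairwise disjnt \<U>"
    "\<forall>U \<in> \<U>. homeomorphic_map (subtopology X U) (subtopology Y V) p"
    using V by (auto simp: evenly_covered_def)
  from e \<U>(1) obtain U where U: "U \<in> \<U>" "e \<in> U" by blast
  have "{x \<in> topspace X. p x \<in> V} - U = \<Union>(\<U> - {U})"
    using \<U>(1,3) U(1) by (fastforce simp: pairwise_def disjnt_iff)
  moreover have "openin X (\<Union>(\<U> - {U}))" using \<U>(2) by (intro openin_Union) auto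
  moreover obtain s where "homeomorphic_maps (subtopology X U) (subtopology Y V) p s"
    using \<U>(4) U(1) by (auto simp: homeomorphic_map_maps)
  ultimately show thesis using that[of U s] U \<U>(1,2) by auto
qed

lemma evenly_covered_open: "evenly_covered X Y p V \<Longrightarrow> openin Y V"
  by (simp add: evenly_covered_def)

lemma evenly_covered_subset:
  assumes V: "evenly_covered X Y p V" and V': "openin Y V'" "V' \<subseteq> V" and p: "continuous_map X Y p"
  shows "evenly_covered X Y p V'"
proof -
  obtain \<U> where \<U>: "\<Union>\<U> = {x \<in> topspace X. p x \<in> V}" "\<forall>U \<in> \<U>. openin X U" "pairwise disjnt \<U>"
    "\<forall>U \<in> \<U>. homeomorphic_map (subtopology X U) (subtopology Y V) p"
    using V by (auto simp: evenly_covered_def)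
  let ?P = "{x \<in> topspace X. p x \<in> V'}"
  have P: "openin X ?P" by (rule openin_continuous_map_preimage[OF p V'(1)])
  let ?\<U> = "(\<lambda>U. U \<inter> ?P) ` \<U>"
  show ?thesis unfolding evenly_covered_def
  proof (intro conjI exI[of _ ?\<U>] ballI)
    show "\<Union>?\<U> = ?P" using \<U>(1) V'(2) by blast
    show "pairwise disjnt ?\<U>"
      using \<U>(3) unfolding pairwise_def disjnt_iff by (smt (verit) IntE imageE)
    fix U' assume "U' \<in> ?\<U>"
    then obtain U where U: "U \<in> \<U>" "U' = U \<inter> ?P" by auto
    then show "openin X U'" using \<U>(2) P by auto
    have "homeomorphic_map (subtopology (subtopology X U) ?P) (subtopology (subtopology Y V) V') p"
      by (rule homeomorphic_map_subtopologies_alt) (use \<U>(4) U(1) in auto)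
    moreover have "V \<inter> V' = V'" using V'(2) by blast
    ultimately show "homeomorphic_map (subtopology X U') (subtopology Y V') p"
      by (simp add: U(2) subtopology_subtopology)
  qed (rule V'(1))
qed

text \<open>Evenly covered sets have this property for one covering, small simply connected sets for all
  coverings at once.\<close>

definition good_over :: "'a topology \<Rightarrow> ('a \<Rightarrow> 'b) \<Rightarrow> 'b set \<Rightarrow> bool" where
  "good_over X p B \<longleftrightarrow>
     (\<forall>e e'. path_component_of (subtopology X {z. p z \<in> B}) e e' \<longrightarrow> p e = p e' \<longrightarrow> e = e')"

lemma good_over_subset: "good_over X p B \<Longrightarrow> B' \<subseteq> B \<Longrightarrow> good_over X p B'"
  unfolding good_over_def
  by (metis (mono_tags, lifting) Collect_mono path_component_of_mono subsetD)

text \<open>The image of a path is connected, and \<open>U\<close> is clopen in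
  \<open>P\<close>.\<close>

lemma path_in_slice:
  assumes U: "openin X U" "openin X (P - U)" "U \<subseteq> P"
    and path: "path_component_of (subtopology X P) e e'" and e: "e \<in> U"
  shows "e' \<in> U"
proof -
  obtain C where C: "connectedin (subtopology X P) C" "e \<in> C" "e' \<in> C"
    using path path_component_of path_connectedin_imp_connectedin by metis
  then have "connectedin X C" "C \<subseteq> P" by (auto simp: connectedin_subtopology)
  then have "\<not> (openin X U \<and> openin X (P - U) \<and> C \<subseteq> U \<union> (P - U) \<and> U \<inter> (P - U) \<inter> C = {} \<and>
      U \<inter> C \<noteq> {} \<and> (P - U) \<inter> C \<noteq> {})"
    unfolding connectedin by blast
  moreover have "C \<subseteq> U \<union> (P - U)" "U \<inter> (P - U) \<inter> C = {}" using \<open>C \<subseteq> P\<close> U(3) by auto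
  ultimately have "U \<inter> C = {} \<or> (P - U) \<inter> C = {}" using U by blast
  with C e \<open>C \<subseteq> P\<close> show ?thesis by blast
qed

text \<open>A path over \<open>V\<close> stays in one slice, and on a slice \<open>p\<close> has the
  left inverse \<open>s\<close>.\<close>

lemma evenly_covered_good_over:
  assumes V: "evenly_covered X Y p V"
  shows "good_over X p V"
  unfolding good_over_def
proof (intro allI impI)
  fix e e' assume path: "path_component_of (subtopology X {z. p z \<in> V}) e e'" and eq: "p e = p e'"
  then have e: "e \<in> topspace X" "p e \<in> V" "e' \<in> topspace X"
    using path_component_in_topspace[OF path] by auto
  obtain U s where U: "openin X U" "e \<in> U" "U \<subseteq> {x \<in> topspace X. p x \<in> V}"
    "openin X ({x \<in> topspace X. p x \<in> V} - U)"
    "homeomorphic_maps (subtopology X U) (subtopology Y V) p s"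
    by (rule evenly_covered_slice[OF V e(1,2)])
  have "subtopology X {z. p z \<in> V} = subtopology X {x \<in> topspace X. p x \<in> V}"
    using subtopology_restrict[of X "{z. p z \<in> V}"] by (simp add: Collect_conj_eq)
  then have "e' \<in> U" using path_in_slice[OF U(1,4,3) _ U(2)] path by simp
  have "s (p x) = x" if "x \<in> U" for x using U(5) that e U(1) openin_subset[OF U(1)] by (auto simp: homeomorphic_maps_def)
  with eq \<open>e' \<in> U\<close> U(2) show "e = e'" by metis
qed

text \<open>Only the end points of the lift are recorded: for a path \<open>g\<close> and a covering
  \<open>p\<close> the relation is the graph of the monodromy from the fiber over \<open>g 0\<close>
  to the fiber over \<open>g 1\<close>.\<close>

definition lifts_to :: "'a topology \<Rightarrow> ('a \<Rightarrow> 'b) \<Rightarrow> (real \<Rightarrow> 'b) \<Rightarrow> 'a \<Rightarrow> 'a \<Rightarrow> bool" where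
  "lifts_to X p g e e' \<longleftrightarrow> (\<exists>d. pathin X d \<and> d 0 = e \<and> d 1 = e' \<and> (\<forall>t \<in> {0..1}. p (d t) = g t))"

text \<open>Lifts exist over short parameter intervals, where \<open>g\<close> stays in an evenly
  covered set and the section of a slice can be composed with it; the Bolzano bisection principle
  glues them.\<close>

lemma path_lift_exists:
  assumes cov: "covering_map X Y p" and g: "pathin Y g" and e: "e \<in> topspace X" "p e = g 0"
  obtains d where "pathin X d" "d 0 = e" "\<And>t. t \<in> {0..1} \<Longrightarrow> p (d t) = g t"
proof -
  define P where "P = (\<lambda>a b. 0 \<le> a \<longrightarrow> a \<le> b \<longrightarrow> b \<le> 1 \<longrightarrow>
     (\<forall>e \<in> topspace X. p e = g a \<longrightarrow> (\<exists>d. continuous_map (top_of_set {a..b}) X d \<and> d a = e \<and>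
        (\<forall>t \<in> {a..b}. p (d t) = g t))))"
  have "P 0 1"
  proof (rule Bolzano)
    fix a b c :: real assume Pab: "P a b" and Pbc: "P b c" and abc: "a \<le> b" "b \<le> c"
    show "P a c" unfolding P_def
    proof (intro impI ballI)
      fix e assume ac: "0 \<le> a" "a \<le> c" "c \<le> 1" and e: "e \<in> topspace X" "p e = g a"
      obtain d1 where d1: "continuous_map (top_of_set {a..b}) X d1" "d1 a = e" "\<forall>t \<in> {a..b}. p (d1 t) = g t"
        using Pab ac abc e unfolding P_def by force
      then have "d1 b \<in> topspace X" "p (d1 b) = g b"
        using abc by (auto simp: continuous_map_def)
      then obtain d2 where d2: "continuous_map (top_of_set {b..c}) X d2" "d2 b = d1 b" "\<forall>t \<in> {b..c}. p (d2 t) = g t"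
        using Pbc ac abc unfolding P_def by force
      have eq: "{a..c} \<inter> {t \<in> topspace (top_of_set {a..c}). t \<le> b} = {a..b}"
        "{a..c} \<inter> {t \<in> topspace (top_of_set {a..c}). b \<le> t} = {b..c}" using abc by auto
      have "continuous_map (top_of_set {a..c}) X (\<lambda>t. if t \<le> b then d1 t else d2 t)"
      proof (rule continuous_map_cases_le)
        show "continuous_map (subtopology (top_of_set {a..c}) {x \<in> topspace (top_of_set {a..c}). x \<le> b}) X d1"
          unfolding subtopology_subtopology eq by (rule d1(1))
        show "continuous_map (subtopology (top_of_set {a..c}) {x \<in> topspace (top_of_set {a..c}). b \<le> x}) X d2"
          unfolding subtopology_subtopology eq by (rule d2(1))
      qed (use d2 in auto)
      moreover have "(\<lambda>t. if t \<le> b then d1 t else d2 t) a = e" using abc d1 by simp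
      moreover have "\<forall>t\<in>{a..c}. p (if t \<le> b then d1 t else d2 t) = g t" using d1 d2 by simp
      ultimately show "\<exists>d. continuous_map (top_of_set {a..c}) X d \<and> d a = e \<and> (\<forall>t\<in>{a..c}. p (d t) = g t)"
        by blast
    qed
  next
    fix x :: real assume x: "0 \<le> x" "x \<le> 1"
    then have "g x \<in> topspace Y" using pathin_in_topspace[OF g] by auto
    then obtain V where V: "g x \<in> V" "evenly_covered X Y p V" by (rule covering_map_nbhd[OF cov])
    obtain d where d: "d > 0" "\<And>t. t \<in> {0..1} \<Longrightarrow> \<bar>t - x\<bar> < d \<Longrightarrow> g t \<in> V"
      using pathin_locally_in_open[OF g evenly_covered_open[OF V(2)] _ V(1)] x by auto
    have "P a b" if ab: "a \<le> x" "x \<le> b" "b - a < d" for a b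
      unfolding P_def
    proof (intro impI ballI)
      fix e assume ab': "0 \<le> a" "a \<le> b" "b \<le> 1" and e: "e \<in> topspace X" "p e = g a"
      have gV: "g t \<in> V" if "t \<in> {a..b}" for t using that ab ab' by (intro d(2)) auto
      then have "p e \<in> V" using e ab' by simp
      then obtain U s where U: "openin X U" "e \<in> U" "U \<subseteq> {x \<in> topspace X. p x \<in> V}"
        "openin X ({x \<in> topspace X. p x \<in> V} - U)"
        "homeomorphic_maps (subtopology X U) (subtopology Y V) p s"
        by (rule evenly_covered_slice[OF V(2) e(1)])
      have "continuous_map (top_of_set {a..b}) (subtopology Y V) g"
      proof -
        have "continuous_map (subtopology (top_of_set {0..1}) {a..b}) Y g"
          using g continuous_map_from_subtopology unfolding pathin_def by blast
        moreover have "{0..1} \<inter> {a..b} = {a..b}" using ab' by auto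
        ultimately show ?thesis using gV by (auto simp: continuous_map_in_subtopology subtopology_subtopology)
      qed
      then have "continuous_map (top_of_set {a..b}) (subtopology X U) (s \<circ> g)"
        using U(5) continuous_map_compose unfolding homeomorphic_maps_def by blast
      then have "continuous_map (top_of_set {a..b}) X (s \<circ> g)"
        by (simp add: continuous_map_in_subtopology)
      moreover have "(s \<circ> g) a = e"
      proof -
        have "s (p e) = e" using U(2,5) e(1) by (auto simp: homeomorphic_maps_def)
        then show ?thesis using e(2) by simp
      qed
      moreover have "\<forall>t \<in> {a..b}. p ((s \<circ> g) t) = g t"
      proof
        fix t assume "t \<in> {a..b}"
        then have "g t \<in> topspace Y \<inter> V" using gV openin_subset[OF evenly_covered_open[OF V(2)]] by blast
        then show "p ((s \<circ> g) t) = g t" using U(5) by (simp add: homeomorphic_maps_def)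
      qed
      ultimately show "\<exists>d. continuous_map (top_of_set {a..b}) X d \<and> d a = e \<and> (\<forall>t\<in>{a..b}. p (d t) = g t)"
        by blast
    qed
    with d show "\<exists>d>0. \<forall>a b. a \<le> x \<and> x \<le> b \<and> b - a < d \<longrightarrow> P a b" by blast
  qed auto
  with e that show thesis unfolding P_def pathin_def by auto
qed

text \<open>On a short interval both lifts stay over one evenly covered set. If they agree at its
  start, their values at its end are joined over that set through the common point, so goodness
  makes them equal.\<close>

lemma path_lift_unique:
  assumes cov: "covering_map X Y p" and d: "pathin X d" "pathin X d'"
    and eq: "\<And>t. t \<in> {0..1} \<Longrightarrow> p (d t) = p (d' t)" and start: "d 0 = d' 0" and t: "t \<in> {0..1}"
  shows "d t = d' t"
proof -
  define P where "P = (\<lambda>a b. 0 \<le> a \<longrightarrow> a \<le> b \<longrightarrow> b \<le> 1 \<longrightarrow> d a = d' a \<longrightarrow> d b = d' b)"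
  have pd: "pathin Y (\<lambda>t. p (d t))"
    by (rule pathin_continuous_image[OF d(1) covering_map_continuous[OF cov]])
  have "0 \<le> t" using t by simp
  then have "P 0 t"
  proof (induction rule: Bolzano)
    case (trans a b c)
    then show ?case unfolding P_def by auto
  next
    case (local x)
    then have x: "x \<in> {0..1}" using t by auto
    then have "p (d x) \<in> topspace Y" using pathin_in_topspace[OF pd] by auto
    then obtain V where V: "p (d x) \<in> V" "evenly_covered X Y p V" by (rule covering_map_nbhd[OF cov])
    obtain r where r: "r > 0" "\<And>t. t \<in> {0..1} \<Longrightarrow> \<bar>t - x\<bar> < r \<Longrightarrow> p (d t) \<in> V"
      using pathin_locally_in_open[OF pd evenly_covered_open[OF V(2)] x V(1)] by auto
    have "P a b" if ab: "a \<le> x" "x \<le> b" "b - a < r" for a b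
      unfolding P_def
    proof (intro impI)
      assume ab': "0 \<le> a" "a \<le> b" "b \<le> 1" "d a = d' a"
      have ab01: "a \<in> {0..1}" "b \<in> {0..1}" using ab' by auto
      have "p (d u) \<in> V" if "u \<in> closed_segment a b" for u
        using that ab ab' by (intro r(2)) (auto simp: closed_segment_eq_real_ivl)
      moreover have "u \<in> {0..1}" if "u \<in> closed_segment a b" for u
        using that ab' by (auto simp: closed_segment_eq_real_ivl)
      ultimately have "path_component_of (subtopology X {z. p z \<in> V}) (d a) (d b)"
        "path_component_of (subtopology X {z. p z \<in> V}) (d' a) (d' b)"
        using eq by (auto intro!: path_component_of_segment d ab01 simp flip: eq)
      then have "path_component_of (subtopology X {z. p z \<in> V}) (d b) (d' b)"
        using ab'(4) path_component_of_sym path_component_of_trans by metis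
      then show "d b = d' b" using evenly_covered_good_over[OF V(2)] eq[OF ab01(2)]
        unfolding good_over_def by blast
    qed
    with r(1) show ?case by blast
  qed
  then show ?thesis using t start by (simp add: P_def)
qed

lemma lifts_to_exists:
  assumes "covering_map X Y p" "pathin Y g" "e \<in> topspace X" "p e = g 0"
  shows "\<exists>e'. lifts_to X p g e e'"
  using path_lift_exists[OF assms] unfolding lifts_to_def by metis

lemma lifts_to_unique:
  assumes "covering_map X Y p" "lifts_to X p g e e'" "lifts_to X p g e e''"
  shows "e' = e''"
  using assms path_lift_unique[OF assms(1), where t = 1] unfolding lifts_to_def by fastforce

lemma lifts_to_in_topspace: "lifts_to X p g e e' \<Longrightarrow> e \<in> topspace X \<and> e' \<in> topspace X"
  unfolding lifts_to_def using path_start_in_topspace path_finish_in_topspace by metis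

lemma lifts_to_ends: "lifts_to X p g e e' \<Longrightarrow> p e = g 0 \<and> p e' = g 1"
  unfolding lifts_to_def by force

lemma lifts_to_concat:
  assumes "lifts_to X p g e e'" "lifts_to X p h e' e''"
  shows "lifts_to X p (path_concat g h) e e''"
proof -
  obtain d d' where d: "pathin X d" "d 0 = e" "d 1 = e'" "\<forall>t \<in> {0..1}. p (d t) = g t"
    and d': "pathin X d'" "d' 0 = e'" "d' 1 = e''" "\<forall>t \<in> {0..1}. p (d' t) = h t"
    using assms unfolding lifts_to_def by auto
  show ?thesis unfolding lifts_to_def
  proof (intro exI[of _ "path_concat d d'"] conjI ballI)
    show "pathin X (path_concat d d')" using d d' by (intro pathin_concat) auto
    fix t :: real assume "t \<in> {0..1}"
    then show "p (path_concat d d' t) = path_concat g h t"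
      using d d' by (auto simp: path_concat_def)
  qed (use d d' in auto)
qed

lemma lifts_to_reverse: "lifts_to X p g e e' \<Longrightarrow> lifts_to X p (\<lambda>t. g (1 - t)) e' e"
  unfolding lifts_to_def by (elim exE, rule_tac x = "\<lambda>t. d (1 - t)" in exI) (auto simp: pathin_reverse)

lemma lifts_to_const: "e \<in> topspace X \<Longrightarrow> p e = a \<Longrightarrow> lifts_to X p (\<lambda>t. a) e e"
  unfolding lifts_to_def by (intro exI[of _ "\<lambda>t. e"]) auto

section \<open>Comparison of nearby paths and homotopy invariance of lifting\<close>

lemma path_component_of_lift:
  assumes cov: "covering_map X Y p" and path: "path_component_of (subtopology Y W) y y'"
    and e: "e \<in> topspace X" "p e = y"
  obtains e' where "path_component_of (subtopology X {z. p z \<in> W}) e e'" "p e' = y'"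
proof -
  obtain g where g: "pathin (subtopology Y W) g" "g 0 = y" "g 1 = y'"
    using path unfolding path_component_of_def by auto
  then have "pathin Y g" "\<forall>t \<in> {0..1}. g t \<in> W" by (auto simp: pathin_subtopology)
  moreover from e(2) g(2) have "p e = g 0" by simp
  then obtain d where d: "pathin X d" "d 0 = e" "\<And>t. t \<in> {0..1} \<Longrightarrow> p (d t) = g t"
    by (rule path_lift_exists[OF cov \<open>pathin Y g\<close> e(1)]) blast
  ultimately have "pathin (subtopology X {z. p z \<in> W}) d" by (simp add: pathin_subtopology)
  then show thesis using that[of "d 1"] g d unfolding path_component_of_def by auto
qed

text \<open>Serves to replace a jump between \<open>A\<close>-close points by a path that stays
  \<open>N\<close>-small: a Lebesgue entourage for the cover by small path connected open
  sets.\<close>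

lemma entourage_small_path_connected:
  assumes comp: "compact_space Y" "Hausdorff_space Y" and lpc: "locally_path_connected_space Y"
    and N: "entourage Y N"
  obtains A where "entourage Y A" "A \<subseteq> N"
    "\<forall>y \<in> topspace Y. \<exists>W. path_connectedin Y W \<and> y \<in> W \<and> A `` {y} \<subseteq> W \<and> W \<times> W \<subseteq> N"
proof -
  have "\<exists>W \<in> {W. path_connectedin Y W \<and> W \<times> W \<subseteq> N}. openin Y W \<and> y \<in> W" if y: "y \<in> topspace Y" for y
  proof -
    obtain U where U: "openin Y U" "y \<in> U" "U \<times> U \<subseteq> N" by (rule entourage_square[OF N y])
    then obtain W where "openin Y W" "path_connectedin Y W" "y \<in> W" "W \<subseteq> U"
      using lpc unfolding locally_path_connected_space by blast
    with U show ?thesis by blast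
  qed
  then obtain A where A: "entourage Y A"
    "\<forall>y \<in> topspace Y. \<exists>W \<in> {W. path_connectedin Y W \<and> W \<times> W \<subseteq> N}. y \<in> W \<and> openin Y W \<and> A `` {y} \<subseteq> W"
    by (rule Lebesgue_entourage[OF comp]) blast
  have sub: "A \<subseteq> N"
  proof clarify
    fix a b assume ab: "(a, b) \<in> A"
    then have "a \<in> topspace Y" using entourage_subset[OF A(1)] by auto
    with A(2) obtain W where "W \<times> W \<subseteq> N" "a \<in> W" "A `` {a} \<subseteq> W" by auto
    with ab show "(a, b) \<in> N" by auto
  qed
  have "\<exists>W. path_connectedin Y W \<and> y \<in> W \<and> A `` {y} \<subseteq> W \<and> W \<times> W \<subseteq> N"
    if "y \<in> topspace Y" for y using A(2) that by auto
  then show thesis using that[OF A(1) sub] by blast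
qed

text \<open>Closeness along the sheets: the connecting path, projected to the base, stays within
  \<open>R\<close> of the projection of \<open>e\<close>. Points on different sheets over nearby
  base points need not be near.\<close>

definition near :: "'a topology \<Rightarrow> ('a \<Rightarrow> 'b) \<Rightarrow> ('b \<times> 'b) set \<Rightarrow> 'a \<Rightarrow> 'a \<Rightarrow> bool" where
  "near X p R e e' \<longleftrightarrow> path_component_of (subtopology X {z. (p e, p z) \<in> R}) e e'"

text \<open>Applied to one covering and a fine entourage, this yields the homotopy invariance of lifts;
  applied to a whole tower, it compares nearby leafwise paths in a solenoid.\<close>

lemma near_transport:
  assumes cov: "covering_map X Y p"
    and good: "\<And>y. y \<in> topspace Y \<Longrightarrow> good_over X p (R0 `` {y})"
    and R1: "entourage Y R1" "R1 O R1 \<subseteq> R0"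
    and R: "\<And>y y'. (y, y') \<in> R \<Longrightarrow> path_component_of (subtopology Y (R1 `` {y})) y y'"
    and d: "pathin X d" "pathin X d'"
    and close: "\<And>t. t \<in> {0..1} \<Longrightarrow> (p (d t), p (d' t)) \<in> R"
    and start: "near X p R1 (d 0) (d' 0)"
  shows "near X p R1 (d 1) (d' 1)"
proof -
  \<comment> \<open>An equivalence rather than an implication, so that both ends of a short interval
    can be compared with a point between them.\<close>
  define P where "P = (\<lambda>a b. a \<in> {0..1} \<longrightarrow> b \<in> {0..1} \<longrightarrow>
     near X p R1 (d a) (d' a) = near X p R1 (d b) (d' b))"
  let ?C = "\<lambda>B. path_component_of (subtopology X {z. p z \<in> B})"
  have near_C: "near X p R1 e e' \<longleftrightarrow> ?C (R1 `` {p e}) e e'" for e e' by (simp add: near_def)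
  have pd: "pathin Y (\<lambda>t. p (d t))" "pathin Y (\<lambda>t. p (d' t))"
    by (rule pathin_continuous_image[OF _ covering_map_continuous[OF cov]], rule d)+
  have R1open: "openin Y (R1 `` {y})" if "y \<in> topspace Y" for y
  proof -
    have "continuous_map Y (prod_topology Y Y) (\<lambda>z. (y, z))"
      using that by (simp add: continuous_map_pairedI)
    from openin_continuous_map_preimage[OF this entourage_openin[OF R1(1)]]
    have "openin Y {z \<in> topspace Y. (y, z) \<in> R1}" .
    moreover have "{z \<in> topspace Y. (y, z) \<in> R1} = R1 `` {y}" using entourage_subset[OF R1(1)] by auto
    ultimately show ?thesis by simp
  qed
  have mono: "?C B e e' \<Longrightarrow> B \<subseteq> B' \<Longrightarrow> ?C B' e e'" for B B' e e'
    by (erule path_component_of_mono) auto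
  have sym: "?C B e e' \<Longrightarrow> ?C B e' e" for B e e' by (rule path_component_of_sym)
  have trans: "?C B e e' \<Longrightarrow> ?C B e' e'' \<Longrightarrow> ?C B e e''" for B e e' e''
    by (rule path_component_of_trans)
  have RR1: "(y, y') \<in> R1" if "(y, y') \<in> R" for y y'
    using path_component_in_topspace[OF R[OF that]] by simp
  have "P 0 1"
  proof (rule Bolzano)
    fix x :: real assume "0 \<le> x" "x \<le> 1"
    then have x: "x \<in> {0..1}" by simp
    have px: "p (d x) \<in> topspace Y" "p (d' x) \<in> topspace Y"
      using pathin_in_topspace[OF pd(1) x] pathin_in_topspace[OF pd(2) x] by auto
    obtain r1 where r1: "r1 > 0" "\<And>t. t \<in> {0..1} \<Longrightarrow> \<bar>t - x\<bar> < r1 \<Longrightarrow> p (d t) \<in> R1 `` {p (d x)}"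
      by (rule pathin_locally_in_open[OF pd(1) R1open[OF px(1)] x])
        (use entourage_refl[OF R1(1) px(1)] in auto)
    obtain r2 where r2: "r2 > 0" "\<And>t. t \<in> {0..1} \<Longrightarrow> \<bar>t - x\<bar> < r2 \<Longrightarrow> p (d' t) \<in> R1 `` {p (d' x)}"
      by (rule pathin_locally_in_open[OF pd(2) R1open[OF px(2)] x])
        (use entourage_refl[OF R1(1) px(2)] in auto)
    have local: "near X p R1 (d x) (d' x) = near X p R1 (d t) (d' t)"
      if t: "t \<in> {0..1}" "\<bar>t - x\<bar> < min r1 r2" for t
    proof -
      \<comment> \<open>One good set over which everything near time \<open>x\<close> happens: an
        \<open>R1\<close>-ball about a point that is \<open>R1\<close>-close to
        \<open>p (d x)\<close> lies in it by \<open>R1 O R1 \<subseteq> R0\<close>.\<close>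
      define B where "B = R0 `` {p (d x)}"
      have sub: "R1 `` {z} \<subseteq> B" if "(p (d x), z) \<in> R1" for z
        using that R1(2) by (auto simp: B_def)
      have seg: "u \<in> {0..1} \<and> \<bar>u - x\<bar> < min r1 r2" if "u \<in> closed_segment x t" for u
        using that t x by (auto simp: closed_segment_eq_real_ivl split: if_splits)
      have xx: "(p (d x), p (d x)) \<in> R1" "(p (d x), p (d t)) \<in> R1"
        using entourage_refl[OF R1(1) px(1)] r1(2)[OF t(1)] t(2) by auto
      have 1: "?C B (d x) (d t)"
        by (rule mono[OF path_component_of_segment[OF d(1) x t(1)] sub[OF xx(1)]])
          (use seg r1 in simp)
      have 2: "?C B (d' x) (d' t)"
        by (rule mono[OF path_component_of_segment[OF d(2) x t(1)] sub[OF RR1[OF close[OF x]]]])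
          (use seg r2 in simp)
      have uni: "e = e'" if "?C B e e'" "p e = p e'" for e e'
        using good[OF px(1), unfolded good_over_def, rule_format, OF that[unfolded B_def]] .
      have nearB: "?C B e e'" if "near X p R1 e e'" "(p (d x), p e) \<in> R1" for e e'
        using mono[OF that(1)[unfolded near_C] sub[OF that(2)]] .
      show ?thesis
      proof
        assume n: "near X p R1 (d x) (d' x)"
        \<comment> \<open>The point that ought to be \<open>d' t\<close>: it lies over
          \<open>p (d' t)\<close> and is near \<open>d t\<close> by construction. The detour through
          time \<open>x\<close> joins it to \<open>d' t\<close> over \<open>B\<close>, so the two
          coincide.\<close>
        obtain e where e: "?C (R1 `` {p (d t)}) (d t) e" "p e = p (d' t)"
          by (rule path_component_of_lift[OF cov R[OF close[OF t(1)]] pathin_in_topspace[OF d(1) t(1)] refl])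
        then have ne: "near X p R1 (d t) e" by (simp add: near_def)
        have "?C B e (d' t)"
          using trans[OF trans[OF sym[OF nearB[OF ne xx(2)]] sym[OF 1]] trans[OF nearB[OF n xx(1)] 2]] .
        then have "e = d' t" using uni e(2) by simp
        with ne show "near X p R1 (d t) (d' t)" by simp
      next
        assume n: "near X p R1 (d t) (d' t)"
        obtain e where e: "?C (R1 `` {p (d x)}) (d x) e" "p e = p (d' x)"
          by (rule path_component_of_lift[OF cov R[OF close[OF x]] pathin_in_topspace[OF d(1) x] refl])
        then have ne: "near X p R1 (d x) e" by (simp add: near_def)
        have "?C B e (d' x)"
          using trans[OF trans[OF sym[OF nearB[OF ne xx(1)]] 1] trans[OF nearB[OF n xx(2)] sym[OF 2]]] .
        then have "e = d' x" using uni e(2) by simp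
        with ne show "near X p R1 (d x) (d' x)" by simp
      qed
    qed
    show "\<exists>r>0. \<forall>a b. a \<le> x \<and> x \<le> b \<and> b - a < r \<longrightarrow> P a b"
    proof (intro exI[of _ "min r1 r2"] conjI allI impI)
      show "0 < min r1 r2" using r1 r2 by simp
      fix a b assume ab: "a \<le> x \<and> x \<le> b \<and> b - a < min r1 r2"
      have "near X p R1 (d a) (d' a) = near X p R1 (d b) (d' b)" if "a \<in> {0..1}" "b \<in> {0..1}"
        using local[OF that(1)] local[OF that(2)] ab by argo
      then show "P a b" unfolding P_def by simp
    qed
  next
    show "P a c" if "P a b" "P b c" "a \<le> b" "b \<le> c" for a b c
    proof -
      have "b \<in> {0..1}" if "a \<in> {0..1}" "c \<in> {0..1}"
        using that \<open>a \<le> b\<close> \<open>b \<le> c\<close> by simp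
      then show ?thesis using that(1,2) unfolding P_def by blast
    qed
  qed simp
  with start show ?thesis by (simp add: P_def)
qed

text \<open>Two stages of the homotopy that are \<open>R\<close>-close at all times have lifts from
  \<open>e\<close> whose end points are near by \<open>near_transport\<close>. Both end over
  \<open>a\<close>, where goodness turns near into equal; bisection in the homotopy parameter does
  the rest.\<close>

lemma loop_homotopic_lifts_to:
  assumes cov: "covering_map X Y p" and Y: "compact_space Y" "Hausdorff_space Y" "locally_path_connected_space Y"
    and hom: "loop_homotopic Y a g g'" and lift: "lifts_to X p g e e'"
  shows "lifts_to X p g' e e'"
proof -
  obtain h where h: "continuous_map (prod_topology (top_of_set {0..1::real}) (top_of_set {0..1})) Y h"
    "\<forall>t. h (0, t) = g t" "\<forall>t. h (1, t) = g' t" "\<forall>s \<in> {0..1}. h (s, 0) = a \<and> h (s, 1) = a"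
    using hom unfolding loop_homotopic_def homotopic_with_def by (elim exE conjE) (rule that; assumption)
  note h' = h(4)[rule_format]
  have hs: "pathin Y (\<lambda>t. h (s, t))" if "s \<in> {0..1}" for s
    unfolding pathin_def using continuous_map_o_Pair[OF h(1), of s] that by (simp add: o_def)
  obtain R0 where R0: "entourage Y R0"
    "\<forall>y \<in> topspace Y. \<exists>W \<in> {V. evenly_covered X Y p V}. y \<in> W \<and> openin Y W \<and> R0 `` {y} \<subseteq> W"
    by (rule Lebesgue_entourage[OF Y(1,2), of "{V. evenly_covered X Y p V}"])
      (use cov evenly_covered_open in \<open>fastforce simp: covering_map_evenly_covered\<close>)+
  have good: "good_over X p (R0 `` {y})" if "y \<in> topspace Y" for y
    using R0(2) that evenly_covered_good_over good_over_subset by fastforce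
  obtain R1 where R1: "entourage Y R1" "sym R1" "R1 O R1 \<subseteq> R0" "R1 \<subseteq> R0"
    by (rule entourage_symmetric_square_root[OF Y(1,2) R0(1)])
  obtain R where R: "entourage Y R" "R \<subseteq> R1"
    "\<forall>y \<in> topspace Y. \<exists>W. path_connectedin Y W \<and> y \<in> W \<and> R `` {y} \<subseteq> W \<and> W \<times> W \<subseteq> R1"
    by (rule entourage_small_path_connected[OF Y R1(1)])
  have Rpath: "path_component_of (subtopology Y (R1 `` {y})) y y'" if yy': "(y, y') \<in> R" for y y'
  proof -
    from yy' have "y \<in> topspace Y" using entourage_subset[OF R(1)] by blast
    then obtain W where W: "path_connectedin Y W" "y \<in> W" "y' \<in> W" "W \<subseteq> R1 `` {y}"
      using R(3) yy' by blast
    then show ?thesis using path_component_of path_connectedin_subtopology by metis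
  qed
  define Q where "Q = (\<lambda>s s'. s \<in> {0..1} \<longrightarrow> s' \<in> {0..1} \<longrightarrow>
     (\<forall>e'. lifts_to X p (\<lambda>t. h (s, t)) e e' \<longleftrightarrow> lifts_to X p (\<lambda>t. h (s', t)) e e'))"
  have step: "lifts_to X p (\<lambda>t. h (s, t)) e e' \<longleftrightarrow> lifts_to X p (\<lambda>t. h (s', t)) e e'"
    if s: "s \<in> {0..1}" "s' \<in> {0..1}" and close: "\<And>t. t \<in> {0..1} \<Longrightarrow> (h (s, t), h (s', t)) \<in> R" for s s' e'
  proof -
    \<comment> \<open>Once the two lifts are known to have the same end point, uniqueness gives the
      equivalence; from a point that is not over \<open>a\<close> neither stage has a lift.\<close>
    have *: "lifts_to X p (\<lambda>t. h (s', t)) e e' \<longleftrightarrow> lifts_to X p (\<lambda>t. h (s, t)) e e'"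
      if e: "e \<in> topspace X" "p e = a"
    proof -
      obtain d where d: "pathin X d" "d 0 = e" "\<And>t. t \<in> {0..1} \<Longrightarrow> p (d t) = h (s, t)"
        using path_lift_exists[OF cov hs[OF s(1)] e(1)] e(2) h'[OF s(1)] by metis
      obtain d' where d': "pathin X d'" "d' 0 = e" "\<And>t. t \<in> {0..1} \<Longrightarrow> p (d' t) = h (s', t)"
        using path_lift_exists[OF cov hs[OF s(2)] e(1)] e(2) h'[OF s(2)] by metis
      have "near X p R1 (d 1) (d' 1)"
      proof (rule near_transport[OF cov good R1(1,3) Rpath d(1) d'(1)])
        show "(p (d t), p (d' t)) \<in> R" if "t \<in> {0..1}" for t using close[OF that] d d' that by simp
        have "(p e, p e) \<in> R1" using entourage_refl[OF R1(1)] covering_map_in[OF cov e(1)] by blast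
        then show "near X p R1 (d 0) (d' 0)" using d d' e by (simp add: near_def path_component_of_refl)
      qed auto
      moreover have "p (d 1) = a" "p (d' 1) = a" using d d' h(4) s by auto
      moreover have "a \<in> topspace Y" using covering_map_in[OF cov] e by blast
      moreover have "good_over X p (R1 `` {a})"
        using good[OF \<open>a \<in> topspace Y\<close>] by (rule good_over_subset) (use R1 in auto)
      ultimately have "d 1 = d' 1" unfolding near_def good_over_def by auto
      have "lifts_to X p (\<lambda>t. h (s, t)) e (d 1)" "lifts_to X p (\<lambda>t. h (s', t)) e (d 1)"
        using d d' \<open>d 1 = d' 1\<close> unfolding lifts_to_def by metis+
      then show ?thesis using lifts_to_unique[OF cov] by metis
    qed
    moreover have "e \<in> topspace X \<and> p e = a" if "lifts_to X p (\<lambda>t. h (s, t)) e e' \<or> lifts_to X p (\<lambda>t. h (s', t)) e e'"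
      using that s h(4) by (auto dest: lifts_to_in_topspace lifts_to_ends)
    ultimately show ?thesis by blast
  qed
  have "Q 0 1"
  proof (rule Bolzano)
    fix x :: real assume "0 \<le> x" "x \<le> 1"
    then have x: "x \<in> {0..1}" by simp
    let ?I = "top_of_set {0..1::real}"
    have c1: "continuous_map (prod_topology ?I ?I) Y (\<lambda>z. h (x, snd z))"
      using continuous_map_compose[OF continuous_map_snd hs[OF x, unfolded pathin_def], of ?I] by (simp add: o_def)
    have "continuous_map (prod_topology ?I ?I) (prod_topology Y Y) (\<lambda>z. (h (x, snd z), h z))"
      using c1 h(1) by (simp add: continuous_map_pairedI)
    from openin_continuous_map_preimage[OF this entourage_openin[OF R(1)]]
    have op: "openin (prod_topology ?I ?I) {z \<in> topspace (prod_topology ?I ?I). (h (x, snd z), h z) \<in> R}" .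
    have "{x} \<times> {0..1} \<subseteq> {z \<in> topspace (prod_topology ?I ?I). (h (x, snd z), h z) \<in> R}"
    proof -
      have "(h (x, t), h (x, t)) \<in> R" if "t \<in> {0..1}" for t
        using entourage_refl[OF R(1) pathin_in_topspace[OF hs[OF x] that]] .
      then show ?thesis using x by auto
    qed
    moreover have "compactin ?I {0..1}" by (simp add: compactin_subtopology)
    \<comment> \<open>The tube lemma makes the closeness of stage \<open>s\<close> to stage
      \<open>x\<close> uniform in the path parameter.\<close>
    ultimately obtain U V where UV: "openin ?I U" "x \<in> U" "{0..1} \<subseteq> V"
      "U \<times> V \<subseteq> {z \<in> topspace (prod_topology ?I ?I). (h (x, snd z), h z) \<in> R}"
      using tube_lemma_right[OF op, of "{0..1}" x] x by auto
    obtain r where r: "r > 0" "\<And>s. s \<in> {0..1} \<Longrightarrow> dist s x < r \<Longrightarrow> s \<in> U"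
      using UV(1,2) unfolding openin_euclidean_subtopology_iff by blast
    have *: "lifts_to X p (\<lambda>t. h (x, t)) e e' \<longleftrightarrow> lifts_to X p (\<lambda>t. h (s, t)) e e'"
      if s: "s \<in> {0..1}" "\<bar>s - x\<bar> < r" for s e'
    proof (rule step[OF x s(1)])
      fix t :: real assume t: "t \<in> {0..1}"
      have "s \<in> U" using r s by (simp add: dist_real_def)
      then have "(s, t) \<in> U \<times> V" using t UV(3) by blast
      then show "(h (x, t), h (s, t)) \<in> R" using UV(4) by auto
    qed
    show "\<exists>r>0. \<forall>a b. a \<le> x \<and> x \<le> b \<and> b - a < r \<longrightarrow> Q a b"
    proof (intro exI[of _ r] conjI allI impI r(1))
      fix a b assume ab: "a \<le> x \<and> x \<le> b \<and> b - a < r"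
      have "lifts_to X p (\<lambda>t. h (a, t)) e e' = lifts_to X p (\<lambda>t. h (b, t)) e e'"
        if "a \<in> {0..1}" "b \<in> {0..1}" for e'
        using *[OF that(1), of e'] *[OF that(2), of e'] ab by argo
      then show "Q a b" unfolding Q_def by simp
    qed
  next
    show "Q a c" if "Q a b" "Q b c" "a \<le> b" "b \<le> c" for a b c
    proof -
      have "b \<in> {0..1}" if "a \<in> {0..1}" "c \<in> {0..1}"
        using that \<open>a \<le> b\<close> \<open>b \<le> c\<close> by simp
      then show ?thesis using that(1,2) unfolding Q_def by blast
    qed
  qed simp
  then have "lifts_to X p (\<lambda>t. h (0, t)) e e' \<longleftrightarrow> lifts_to X p (\<lambda>t. h (1, t)) e e'"
    unfolding Q_def by simp
  moreover have "(\<lambda>t. h (0, t)) = g" "(\<lambda>t. h (1, t)) = g'" using h(2,3) by auto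
  ultimately show ?thesis using lift by metis
qed


section \<open>Finite coverings\<close>

lemma finite_covering_map_imp_covering_map: "finite_covering_map X Y p \<Longrightarrow> covering_map X Y p"
  by (simp add: finite_covering_map_def)

lemma evenly_coveredI:
  assumes "openin Y V" "\<Union>\<U> = {x \<in> topspace X. p x \<in> V}" "\<And>U. U \<in> \<U> \<Longrightarrow> openin X U"
    "\<And>U U'. U \<in> \<U> \<Longrightarrow> U' \<in> \<U> \<Longrightarrow> U \<noteq> U' \<Longrightarrow> U \<inter> U' = {}"
    "\<And>U. U \<in> \<U> \<Longrightarrow> homeomorphic_map (subtopology X U) (subtopology Y V) p"
  shows "evenly_covered X Y p V"
  unfolding evenly_covered_def pairwise_def disjnt_def
  by (intro conjI exI[of _ \<U>] ballI impI) (rule assms; assumption)+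

lemma evenly_coveredE:
  assumes "evenly_covered X Y p V"
  obtains \<U> where "openin Y V" "\<Union>\<U> = {x \<in> topspace X. p x \<in> V}" "\<And>U. U \<in> \<U> \<Longrightarrow> openin X U"
    "\<And>U U'. U \<in> \<U> \<Longrightarrow> U' \<in> \<U> \<Longrightarrow> U \<noteq> U' \<Longrightarrow> U \<inter> U' = {}"
    "\<And>U. U \<in> \<U> \<Longrightarrow> homeomorphic_map (subtopology X U) (subtopology Y V) p"
proof -
  from assms obtain \<U> where "openin Y V" "\<Union>\<U> = {x \<in> topspace X. p x \<in> V}" "\<forall>U \<in> \<U>. openin X U"
    "pairwise disjnt \<U>" "\<forall>U \<in> \<U>. homeomorphic_map (subtopology X U) (subtopology Y V) p"
    unfolding evenly_covered_def by (elim conjE exE)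
  then show thesis by (intro that[of \<U>]) (simp_all add: pairwise_def disjnt_def)
qed

lemma homeomorphic_map_slice_openin:
  assumes hom: "homeomorphic_map (subtopology X U) (subtopology Y V) p"
    and U: "openin X U" and V: "openin Y V" and W: "openin X W"
  shows "openin Y (p ` (U \<inter> W))"
proof -
  have "openin (subtopology X U) (U \<inter> W)" using W openin_subtopology_Int2 by blast
  then have "openin (subtopology Y V) (p ` (U \<inter> W))"
    using homeomorphic_imp_open_map[OF hom] by (simp add: open_map_def)
  then show ?thesis using V openin_trans_full by blast
qed

lemma slice_image:
  assumes hom: "homeomorphic_map (subtopology X U) (subtopology Y V) p"
    and U: "openin X U" and V: "openin Y V"
  shows "p ` U = V" "inj_on p U"
  using homeomorphic_imp_surjective_map[OF hom] homeomorphic_imp_injective_map[OF hom]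
    openin_subset[OF U] openin_subset[OF V]
  by (auto simp: Int_absorb1)

text \<open>The slice through \<open>e\<close> is cut down to \<open>W\<close> and \<open>V\<close>
  is its image. The section is open, being the inverse of a homeomorphism onto an open
  slice.\<close>

lemma covering_local_section:
  assumes cov: "covering_map X Y p" and W: "openin X W" "e \<in> W"
  obtains V s where "openin Y V" "p e \<in> V" "evenly_covered X Y p V"
    "continuous_map (subtopology Y V) X s" "s (p e) = e" "\<And>v. v \<in> V \<Longrightarrow> s v \<in> W \<and> p (s v) = v"
    "\<And>V'. openin Y V' \<Longrightarrow> V' \<subseteq> V \<Longrightarrow> openin X (s ` V')"
proof -
  have e: "e \<in> topspace X" using W openin_subset by blast
  then obtain V0 where V0: "p e \<in> V0" "evenly_covered X Y p V0"
    by (rule covering_map_nbhd[OF cov covering_map_in[OF cov]])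
  obtain U s where U: "openin X U" "e \<in> U" "U \<subseteq> {x \<in> topspace X. p x \<in> V0}"
    "openin X ({x \<in> topspace X. p x \<in> V0} - U)"
    "homeomorphic_maps (subtopology X U) (subtopology Y V0) p s"
    by (rule evenly_covered_slice[OF V0(2) e V0(1)])
  have hom: "homeomorphic_map (subtopology X U) (subtopology Y V0) p"
    and hom': "homeomorphic_map (subtopology Y V0) (subtopology X U) s"
    using U(5) homeomorphic_maps_map by blast+
  have V0o: "openin Y V0" by (rule evenly_covered_open[OF V0(2)])
  have sp: "s (p x) = x" if "x \<in> U" for x
    using U(3,5) that by (auto simp: homeomorphic_maps_def)
  define V where "V = p ` (U \<inter> W)"
  have V: "openin Y V" unfolding V_def by (rule homeomorphic_map_slice_openin[OF hom U(1) V0o W(1)])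
  have VV0: "V \<subseteq> V0" using U(3) by (auto simp: V_def)
  show thesis
  proof
    show "openin Y V" by (rule V)
    show "p e \<in> V" using U W by (auto simp: V_def)
    show "evenly_covered X Y p V"
      by (rule evenly_covered_subset[OF V0(2) V VV0 covering_map_continuous[OF cov]])
    show "continuous_map (subtopology Y V) X s"
      using homeomorphic_imp_continuous_map[OF hom'] VV0
      by (meson continuous_map_from_subtopology_mono continuous_map_into_fulltopology)
    show "s (p e) = e" by (rule sp[OF U(2)])
    show "s v \<in> W \<and> p (s v) = v" if "v \<in> V" for v using that sp by (auto simp: V_def)
    show "openin X (s ` V')" if "openin Y V'" "V' \<subseteq> V" for V'
      using homeomorphic_map_slice_openin[OF hom' V0o U(1) that(1)] that(2) VV0
      by (simp add: Int_absorb1 order_trans)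
  qed
qed

lemma covering_locally_path_connected:
  assumes cov: "covering_map X Y p" and Y: "locally_path_connected_space Y"
  shows "locally_path_connected_space X"
  unfolding locally_path_connected_space
proof (intro allI impI)
  fix W e assume "openin X W \<and> e \<in> W"
  then obtain V s where V: "openin Y V" "p e \<in> V"
    "continuous_map (subtopology Y V) X s" "s (p e) = e" "\<And>v. v \<in> V \<Longrightarrow> s v \<in> W \<and> p (s v) = v"
    "\<And>V'. openin Y V' \<Longrightarrow> V' \<subseteq> V \<Longrightarrow> openin X (s ` V')"
    using covering_local_section[OF cov, of W e] by metis
  obtain B where B: "openin Y B" "path_connectedin Y B" "p e \<in> B" "B \<subseteq> V"
    using Y V(1,2) unfolding locally_path_connected_space by blast
  have "path_connectedin (subtopology Y V) B"
    using B by (simp add: path_connectedin_subtopology)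
  then have "path_connectedin X (s ` B)"
    by (rule path_connectedin_continuous_map_image[OF V(3)])
  moreover have "e \<in> s ` B" using V(4) B(3) by force
  ultimately show "\<exists>U. openin X U \<and> path_connectedin X U \<and> e \<in> U \<and> U \<subseteq> W"
    using V(5) V(6)[OF B(1,4)] B(4) by blast
qed

text \<open>Points over different base points are separated in the base; points of one fiber are
  separated by a slice and the rest of the preimage.\<close>

lemma covering_Hausdorff:
  assumes cov: "covering_map X Y p" and Y: "Hausdorff_space Y"
  shows "Hausdorff_space X"
  unfolding Hausdorff_space_def
proof (intro allI impI)
  fix e e' assume e: "e \<in> topspace X \<and> e' \<in> topspace X \<and> e \<noteq> e'"
  show "\<exists>U V. openin X U \<and> openin X V \<and> e \<in> U \<and> e' \<in> V \<and> disjnt U V"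
  proof (cases "p e = p e'")
    case False
    then obtain V V' where V: "openin Y V" "openin Y V'" "p e \<in> V" "p e' \<in> V'" "disjnt V V'"
      using Y e covering_map_in[OF cov] unfolding Hausdorff_space_def by metis
    show ?thesis
      using e V openin_continuous_map_preimage[OF covering_map_continuous[OF cov] V(1)]
        openin_continuous_map_preimage[OF covering_map_continuous[OF cov] V(2)]
      by (intro exI[of _ "{x \<in> topspace X. p x \<in> V}"] exI[of _ "{x \<in> topspace X. p x \<in> V'}"])
        (auto simp: disjnt_iff)
  next
    case True
    obtain V where V: "p e \<in> V" "evenly_covered X Y p V"
      by (rule covering_map_nbhd[OF cov covering_map_in[OF cov conjunct1[OF e]]])
    obtain U s where U: "openin X U" "e \<in> U" "U \<subseteq> {x \<in> topspace X. p x \<in> V}"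
      "openin X ({x \<in> topspace X. p x \<in> V} - U)"
      "homeomorphic_maps (subtopology X U) (subtopology Y V) p s"
      by (rule evenly_covered_slice[OF V(2) conjunct1[OF e] V(1)])
    have "s (p x) = x" if "x \<in> U" for x
      using U(3,5) that by (auto simp: homeomorphic_maps_def)
    then have "e' \<notin> U" using True U(2) e by metis
    then show ?thesis using U V True e
      by (intro exI[of _ U] exI[of _ "{x \<in> topspace X. p x \<in> V} - U"]) (auto simp: disjnt_iff)
  qed
qed

text \<open>Every slice meets the fiber over \<open>y\<close>, and disjoint slices meet it in
  different points.\<close>

lemma finite_slices:
  assumes fin: "finite {x \<in> topspace X. p x = y}" and y: "y \<in> V" and V: "openin Y V"
    and \<U>: "\<Union>\<U> = {x \<in> topspace X. p x \<in> V}" "\<And>U. U \<in> \<U> \<Longrightarrow> openin X U"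
    "\<And>U U'. U \<in> \<U> \<Longrightarrow> U' \<in> \<U> \<Longrightarrow> U \<noteq> U' \<Longrightarrow> U \<inter> U' = {}"
    "\<And>U. U \<in> \<U> \<Longrightarrow> homeomorphic_map (subtopology X U) (subtopology Y V) p"
  shows "finite \<U>"
proof -
  have "\<exists>x \<in> U. p x = y" if "U \<in> \<U>" for U
    using slice_image(1)[OF \<U>(4) \<U>(2) V, OF that that] y by blast
  then obtain c where c: "\<And>U. U \<in> \<U> \<Longrightarrow> c U \<in> U \<and> p (c U) = y" by metis
  have "inj_on c \<U>" using c \<U>(3) by (fastforce simp: inj_on_def)
  moreover have "c ` \<U> \<subseteq> {x \<in> topspace X. p x = y}" using c \<U>(1) by blast
  ultimately show ?thesis using fin inj_on_finite by blast
qed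

text \<open>Over a point \<open>y\<close> outside the image of \<open>C\<close>, each of the
  finitely many slices contains a point over \<open>y\<close> that avoids \<open>C\<close>, and so
  do the slices over all nearby points.\<close>

lemma finite_covering_closed_map:
  assumes "finite_covering_map X Y p"
  shows "closed_map X Y p"
proof -
  from assms have cov: "covering_map X Y p" and fin: "\<And>y. y \<in> topspace Y \<Longrightarrow> finite {x \<in> topspace X. p x = y}"
    by (auto simp: finite_covering_map_def)
  show ?thesis unfolding closed_map_def
  proof (intro allI impI)
    fix C assume C: "closedin X C"
    have "\<exists>O'. openin Y O' \<and> y \<in> O' \<and> O' \<subseteq> topspace Y - p ` C" if y: "y \<in> topspace Y - p ` C" for y
    proof -
      obtain V where V: "y \<in> V" "evenly_covered X Y p V" by (rule covering_map_nbhd[OF cov DiffD1[OF y]])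
      obtain \<U> where \<U>: "openin Y V" "\<Union>\<U> = {x \<in> topspace X. p x \<in> V}" "\<And>U. U \<in> \<U> \<Longrightarrow> openin X U"
        "\<And>U U'. U \<in> \<U> \<Longrightarrow> U' \<in> \<U> \<Longrightarrow> U \<noteq> U' \<Longrightarrow> U \<inter> U' = {}"
        "\<And>U. U \<in> \<U> \<Longrightarrow> homeomorphic_map (subtopology X U) (subtopology Y V) p"
        by (rule evenly_coveredE[OF V(2)], rule that; simp)
      have "finite \<U>" using finite_slices[OF fin V(1) \<U>] y by blast
      \<comment> \<open>Over a point of this set every slice contains a point outside
        \<open>C\<close>, which by injectivity on the slice is its only point there.\<close>
      define O' where "O' = V \<inter> (\<Inter>U\<in>\<U>. p ` (U \<inter> (topspace X - C)))"
      have op: "openin Y (p ` (U \<inter> (topspace X - C)))" if "U \<in> \<U>" for U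
        by (rule homeomorphic_map_slice_openin[OF \<U>(5)[OF that] \<U>(3)[OF that] \<U>(1)]) (use C in auto)
      have "openin Y O'"
      proof (cases "\<U> = {}")
        case True then show ?thesis using \<U>(1) by (simp add: O'_def)
      next
        case False then show ?thesis unfolding O'_def using \<open>finite \<U>\<close> op \<U>(1)
          by (intro openin_Int openin_Inter) auto
      qed
      moreover have "y \<in> O'"
      proof -
        have "y \<in> p ` (U \<inter> (topspace X - C))" if U: "U \<in> \<U>" for U
        proof -
          obtain x where "x \<in> U" "p x = y" using slice_image(1)[OF \<U>(5) \<U>(3) \<U>(1), OF U U] V(1) by blast
          moreover have "x \<in> topspace X" using openin_subset[OF \<U>(3)[OF U]] \<open>x \<in> U\<close> by blast
          moreover have "x \<notin> C" using y \<open>p x = y\<close> by blast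
          ultimately show ?thesis by blast
        qed
        then show ?thesis using V(1) by (simp add: O'_def)
      qed
      moreover have "O' \<inter> p ` C = {}"
      proof (rule ccontr)
        assume "O' \<inter> p ` C \<noteq> {}"
        then obtain x where x: "x \<in> C" "p x \<in> O'" by blast
        then have "x \<in> topspace X" "p x \<in> V" using closedin_subset[OF C] by (auto simp: O'_def)
        then have "x \<in> \<Union>\<U>" using \<U>(2) by simp
        then obtain U where U: "U \<in> \<U>" "x \<in> U" by blast
        then obtain x' where "x' \<in> U" "x' \<notin> C" "p x' = p x" using x(2) unfolding O'_def by fastforce
        then show False using slice_image(2)[OF \<U>(5) \<U>(3) \<U>(1), OF U(1) U(1)] U(2) x(1) by (auto dest: inj_onD)
      qed
      moreover have "O' \<subseteq> topspace Y" using openin_subset[OF \<open>openin Y O'\<close>] .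
      ultimately show ?thesis by blast
    qed
    then have "openin Y (topspace Y - p ` C)" using openin_subopen by blast
    moreover have "p ` C \<subseteq> topspace Y" using closedin_subset[OF C] covering_map_in[OF cov] by blast
    ultimately show "closedin Y (p ` C)" by (simp add: closedin_def)
  qed
qed

text \<open>A closed map with finite fibers is proper, and preimages of compact spaces under proper
  maps are compact.\<close>

lemma finite_covering_compact:
  assumes fc: "finite_covering_map X Y p" and Y: "compact_space Y"
  shows "compact_space X"
proof -
  have "proper_map X Y p"
    unfolding proper_map_def using finite_covering_closed_map[OF fc] fc
    by (auto simp: finite_covering_map_def intro!: finite_imp_compactin)
  moreover have "p \<in> topspace X \<rightarrow> topspace Y"
    using covering_map_in[OF finite_covering_map_imp_covering_map[OF fc]] by blast
  ultimately show ?thesis using Y compact_space_proper_map_preimage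
    by (metis covering_map_surj fc finite_covering_map_imp_covering_map)
qed

lemma evenly_covered_compose:
  assumes V: "openin Z V" and q: "continuous_map Y Z q" and p: "continuous_map X Y p"
    and \<U>: "\<Union>\<U> = {y \<in> topspace Y. q y \<in> V}" "\<And>U. U \<in> \<U> \<Longrightarrow> openin Y U"
    "\<And>U U'. U \<in> \<U> \<Longrightarrow> U' \<in> \<U> \<Longrightarrow> U \<noteq> U' \<Longrightarrow> U \<inter> U' = {}"
    "\<And>U. U \<in> \<U> \<Longrightarrow> homeomorphic_map (subtopology Y U) (subtopology Z V) q"
    and ev: "\<And>U. U \<in> \<U> \<Longrightarrow> evenly_covered X Y p U"
  shows "evenly_covered X Z (q \<circ> p) V"
proof -
  have "\<forall>U \<in> \<U>. \<exists>\<T>. \<Union>\<T> = {x \<in> topspace X. p x \<in> U} \<and> (\<forall>T \<in> \<T>. openin X T) \<and> pairwise disjnt \<T> \<and>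
      (\<forall>T \<in> \<T>. homeomorphic_map (subtopology X T) (subtopology Y U) p)"
    using ev unfolding evenly_covered_def by blast
  from bchoice[OF this] obtain \<T> where "\<forall>U \<in> \<U>. \<Union>(\<T> U) = {x \<in> topspace X. p x \<in> U} \<and> (\<forall>T \<in> \<T> U. openin X T) \<and>
      pairwise disjnt (\<T> U) \<and> (\<forall>T \<in> \<T> U. homeomorphic_map (subtopology X T) (subtopology Y U) p)"
    by (elim exE)
  note \<T> = this[rule_format]
  show ?thesis
  proof (rule evenly_coveredI)
    show "openin Z V" by (rule V)
    show "\<Union>(\<Union>(\<T> ` \<U>)) = {x \<in> topspace X. (q \<circ> p) x \<in> V}"
    proof -
      have "\<Union>(\<Union>(\<T> ` \<U>)) = (\<Union>U\<in>\<U>. {x \<in> topspace X. p x \<in> U})" using \<T> by fastforce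
      also have "\<dots> = {x \<in> topspace X. p x \<in> \<Union>\<U>}" by blast
      finally show ?thesis using \<U>(1) p by (auto simp: continuous_map_def)
    qed
    fix T assume "T \<in> \<Union>(\<T> ` \<U>)"
    then obtain U where U: "U \<in> \<U>" "T \<in> \<T> U" by blast
    then show "openin X T" using \<T> by blast
    have "homeomorphic_map (subtopology X T) (subtopology Y U) p" using \<T> U by blast
    from homeomorphic_map_compose[OF this \<U>(4)[OF U(1)]]
    show "homeomorphic_map (subtopology X T) (subtopology Z V) (q \<circ> p)" .
    fix T' assume "T' \<in> \<Union>(\<T> ` \<U>)" and ne: "T \<noteq> T'"
    then obtain U' where U': "U' \<in> \<U>" "T' \<in> \<T> U'" by blast
    show "T \<inter> T' = {}"
    proof (cases "U = U'")
      case True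
      then have "disjnt T T'" using \<T>[OF U(1)] U(2) U'(2) ne by (auto simp: pairwise_def)
      then show ?thesis by (simp add: disjnt_def)
    next
      case False
      have "T \<subseteq> {x \<in> topspace X. p x \<in> U}" "T' \<subseteq> {x \<in> topspace X. p x \<in> U'}"
        using \<T> U U' by blast+
      with \<U>(3)[OF U(1) U'(1) False] show ?thesis by blast
    qed
  qed
qed

text \<open>Finiteness of \<open>q\<close> is essential: the base neighbourhood must be shrunk once
  for every slice of \<open>q\<close>, so that each shrunken slice is evenly covered by
  \<open>p\<close>.\<close>

lemma finite_covering_compose:
  assumes p: "finite_covering_map X Y p" and q: "finite_covering_map Y Z q"
  shows "finite_covering_map X Z (q \<circ> p)"
proof -
  note cp = finite_covering_map_imp_covering_map[OF p] and cq = finite_covering_map_imp_covering_map[OF q]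
  have "\<exists>V. z \<in> V \<and> evenly_covered X Z (q \<circ> p) V" if z: "z \<in> topspace Z" for z
  proof -
    obtain V0 where V0: "z \<in> V0" "evenly_covered Y Z q V0" by (rule covering_map_nbhd[OF cq z])
    obtain \<U> where \<U>: "openin Z V0" "\<Union>\<U> = {x \<in> topspace Y. q x \<in> V0}" "\<And>U. U \<in> \<U> \<Longrightarrow> openin Y U"
      "\<And>U U'. U \<in> \<U> \<Longrightarrow> U' \<in> \<U> \<Longrightarrow> U \<noteq> U' \<Longrightarrow> U \<inter> U' = {}"
      "\<And>U. U \<in> \<U> \<Longrightarrow> homeomorphic_map (subtopology Y U) (subtopology Z V0) q"
      by (rule evenly_coveredE[OF V0(2)], rule that; simp)
    have fin: "finite \<U>"
      by (rule finite_slices[OF _ V0(1) \<U>]) (use q z in \<open>auto simp: finite_covering_map_def\<close>)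
    have "\<exists>W y. y \<in> U \<and> q y = z \<and> y \<in> W \<and> evenly_covered X Y p W" if U: "U \<in> \<U>" for U
    proof -
      obtain y where y: "y \<in> U" "q y = z" using slice_image(1)[OF \<U>(5) \<U>(3) \<U>(1), OF U U] V0(1) by blast
      then have "y \<in> topspace Y" using openin_subset[OF \<U>(3)[OF U]] by blast
      then obtain W where "y \<in> W" "evenly_covered X Y p W" by (rule covering_map_nbhd[OF cp])
      with y show ?thesis by blast
    qed
    then obtain W where W: "\<And>U. U \<in> \<U> \<Longrightarrow> evenly_covered X Y p (W U) \<and> (\<exists>y \<in> U. q y = z \<and> y \<in> W U)"
      by metis
    \<comment> \<open>\<open>W U\<close> is evenly covered by \<open>p\<close> and contains the
      point of the slice \<open>U\<close> over \<open>z\<close>; over \<open>V\<close> the slice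
      \<open>U\<close> lies inside \<open>W U\<close> because \<open>q\<close> is injective on
      \<open>U\<close>.\<close>
    define V where "V = V0 \<inter> (\<Inter>U\<in>\<U>. q ` (U \<inter> W U))"
    have "openin Z V"
    proof (cases "\<U> = {}")
      case True then show ?thesis using \<U>(1) by (simp add: V_def)
    next
      case False
      have "openin Z (q ` (U \<inter> W U))" if "U \<in> \<U>" for U
        by (rule homeomorphic_map_slice_openin[OF \<U>(5)[OF that] \<U>(3)[OF that] \<U>(1)
              evenly_covered_open[OF conjunct1[OF W[OF that]]]])
      then show ?thesis unfolding V_def using False fin \<U>(1)
        by (intro openin_Int openin_Inter) auto
    qed
    have "z \<in> V" using W V0(1) by (auto simp: V_def)
    let ?P = "{y \<in> topspace Y. q y \<in> V}"
    have P: "openin Y ?P" by (rule openin_continuous_map_preimage[OF covering_map_continuous[OF cq] \<open>openin Z V\<close>])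
    have "evenly_covered X Z (q \<circ> p) V"
    proof (rule evenly_covered_compose[OF \<open>openin Z V\<close> covering_map_continuous[OF cq] covering_map_continuous[OF cp],
          of "(\<lambda>U. U \<inter> ?P) ` \<U>"])
      show "\<Union>((\<lambda>U. U \<inter> ?P) ` \<U>) = ?P" using \<U>(2) by (auto simp: V_def)
      fix U' assume "U' \<in> (\<lambda>U. U \<inter> ?P) ` \<U>"
      then obtain U where U: "U \<in> \<U>" "U' = U \<inter> ?P" by blast
      show op: "openin Y U'" using U \<U>(3) P by auto
      have "homeomorphic_map (subtopology (subtopology Y U) ?P) (subtopology (subtopology Z V0) V) q"
        by (rule homeomorphic_map_subtopologies_alt[OF \<U>(5)[OF U(1)]]) auto
      moreover have "V0 \<inter> V = V" by (auto simp: V_def)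
      ultimately show "homeomorphic_map (subtopology Y U') (subtopology Z V) q"
        by (simp add: U(2) subtopology_subtopology)
      have "U' \<subseteq> W U"
      proof
        fix y assume y: "y \<in> U'"
        then have "q y \<in> q ` (U \<inter> W U)" using U by (auto simp: V_def)
        then obtain y' where "y' \<in> U" "y' \<in> W U" "q y' = q y" by force
        then show "y \<in> W U" using slice_image(2)[OF \<U>(5) \<U>(3) \<U>(1), OF U(1) U(1)] y U(2)
          by (metis IntD1 inj_onD)
      qed
      then show "evenly_covered X Y p U'"
        by (rule evenly_covered_subset[OF conjunct1[OF W[OF U(1)]] op _ covering_map_continuous[OF cp]])
      fix U'' assume "U'' \<in> (\<lambda>U. U \<inter> ?P) ` \<U>" "U' \<noteq> U''"
      then show "U' \<inter> U'' = {}" using U \<U>(4) by blast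
    qed
    with \<open>z \<in> V\<close> show ?thesis by blast
  qed
  moreover have "finite {x \<in> topspace X. (q \<circ> p) x = z}" if z: "z \<in> topspace Z" for z
  proof -
    have "{x \<in> topspace X. (q \<circ> p) x = z} \<subseteq> (\<Union>y\<in>{y \<in> topspace Y. q y = z}. {x \<in> topspace X. p x = y})"
      using covering_map_in[OF cp] by auto
    moreover have "finite \<dots>" using p q z by (intro finite_UN_I) (auto simp: finite_covering_map_def)
    ultimately show ?thesis by (rule finite_subset)
  qed
  moreover have "continuous_map X Z (q \<circ> p)"
    using continuous_map_compose[OF covering_map_continuous[OF cp] covering_map_continuous[OF cq]] .
  moreover have "(q \<circ> p) ` topspace X = topspace Z"
    using covering_map_surj[OF cp] covering_map_surj[OF cq] by (metis image_comp)
  ultimately show ?thesis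
    unfolding finite_covering_map_def covering_map_evenly_covered by blast
qed

lemma homeomorphic_map_finite_covering:
  assumes "homeomorphic_map X Y f"
  shows "finite_covering_map X Y f"
proof -
  have "f ` topspace X = topspace Y" by (rule homeomorphic_imp_surjective_map[OF assms])
  have "evenly_covered X Y f (topspace Y)"
    by (rule evenly_coveredI[where \<U> = "{topspace X}"]) (use assms homeomorphic_imp_surjective_map[OF assms] in auto)
  moreover have "finite {x \<in> topspace X. f x = y}" for y
  proof (rule finite_subset)
    show "{x \<in> topspace X. f x = y} \<subseteq> {inv_into (topspace X) f y}"
      using homeomorphic_imp_injective_map[OF assms] by (auto simp: inv_into_f_f)
  qed simp
  ultimately show ?thesis unfolding finite_covering_map_def covering_map_evenly_covered
    using assms \<open>f ` topspace X = topspace Y\<close> homeomorphic_imp_continuous_map by blast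
qed

section \<open>Fiber products, components of coverings, and change of the underlying type\<close>

lemma topspace_fiber_product:
  "topspace (fiber_product X Y f g) = {(x, y). x \<in> topspace X \<and> y \<in> topspace Y \<and> f x = g y}"
  by (auto simp: fiber_product_def)

lemma fiber_product_continuous_fst: "continuous_map (fiber_product X Y f g) X fst"
  and fiber_product_continuous_snd: "continuous_map (fiber_product X Y f g) Y snd"
  unfolding fiber_product_def by (auto intro: continuous_map_from_subtopology continuous_map_fst continuous_map_snd)

text \<open>A slice \<open>U\<close> of \<open>q\<close> gives the slice of all points with first
  coordinate in \<open>U\<close>, with inverse \<open>\<lambda>z. (s (f z), z)\<close> for the
  inverse \<open>s\<close> of \<open>q\<close> on \<open>U\<close>.\<close>

lemma finite_covering_pullback:
  assumes q: "finite_covering_map X Y q" and f: "continuous_map Z Y f"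
  shows "finite_covering_map (fiber_product X Z q f) Z snd"
proof -
  let ?F = "fiber_product X Z q f"
  note cq = finite_covering_map_imp_covering_map[OF q]
  have fin: "finite {x \<in> topspace ?F. snd x = z}" if "z \<in> topspace Z" for z
  proof -
    have "f z \<in> topspace Y" using that f by (auto simp: continuous_map_def)
    then have "finite ({x \<in> topspace X. q x = f z} \<times> {z})" using q by (auto simp: finite_covering_map_def)
    moreover have "{x \<in> topspace ?F. snd x = z} \<subseteq> {x \<in> topspace X. q x = f z} \<times> {z}"
      by (auto simp: topspace_fiber_product)
    ultimately show ?thesis using finite_subset by blast
  qed
  have surj: "snd ` topspace ?F = topspace Z"
  proof
    show "topspace Z \<subseteq> snd ` topspace ?F"
    proof
      fix z assume z: "z \<in> topspace Z"
      then have "f z \<in> q ` topspace X" using covering_map_surj[OF cq] f by (auto simp: continuous_map_def)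
      then obtain x where "x \<in> topspace X" "q x = f z" by force
      then have "(x, z) \<in> topspace ?F" using z by (simp add: topspace_fiber_product)
      then show "z \<in> snd ` topspace ?F" by force
    qed
  qed (auto simp: topspace_fiber_product)
  have "\<exists>V. z \<in> V \<and> evenly_covered ?F Z snd V" if z: "z \<in> topspace Z" for z
  proof -
    have "f z \<in> topspace Y" using z f by (auto simp: continuous_map_def)
    then obtain W where W: "f z \<in> W" "evenly_covered X Y q W" by (rule covering_map_nbhd[OF cq])
    obtain \<U> where \<U>: "openin Y W" "\<Union>\<U> = {x \<in> topspace X. q x \<in> W}" "\<And>U. U \<in> \<U> \<Longrightarrow> openin X U"
      "\<And>U U'. U \<in> \<U> \<Longrightarrow> U' \<in> \<U> \<Longrightarrow> U \<noteq> U' \<Longrightarrow> U \<inter> U' = {}"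
      "\<And>U. U \<in> \<U> \<Longrightarrow> homeomorphic_map (subtopology X U) (subtopology Y W) q"
      by (rule evenly_coveredE[OF W(2)], rule that; simp)
    define V where "V = {z \<in> topspace Z. f z \<in> W}"
    have V: "openin Z V" unfolding V_def by (rule openin_continuous_map_preimage[OF f \<U>(1)])
    define S where "S = (\<lambda>U. {x \<in> topspace ?F. fst x \<in> U})"
    have "evenly_covered ?F Z snd V"
    proof (rule evenly_coveredI[OF V, of "S ` \<U>"])
      show "\<Union>(S ` \<U>) = {x \<in> topspace ?F. snd x \<in> V}"
      proof -
        have "\<Union>(S ` \<U>) = {x \<in> topspace ?F. fst x \<in> \<Union>\<U>}" by (auto simp: S_def)
        then show ?thesis unfolding \<U>(2) by (auto simp: V_def topspace_fiber_product)
      qed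
      fix T assume "T \<in> S ` \<U>"
      then obtain U where U: "U \<in> \<U>" "T = S U" by blast
      show "openin ?F T" unfolding U(2) S_def
        by (rule openin_continuous_map_preimage[OF fiber_product_continuous_fst \<U>(3)[OF U(1)]])
      obtain s where s: "homeomorphic_maps (subtopology X U) (subtopology Y W) q s"
        using \<U>(5)[OF U(1)] homeomorphic_map_maps by blast
      have Usub: "U \<subseteq> topspace X" by (rule openin_subset[OF \<U>(3)[OF U(1)]])
      have UW: "U \<subseteq> {x \<in> topspace X. q x \<in> W}" using U(1) \<U>(2) by blast
      have fVW: "continuous_map (subtopology Z V) (subtopology Y W) f"
        using f by (auto simp: continuous_map_in_subtopology V_def intro: continuous_map_from_subtopology)
      have sf: "continuous_map (subtopology Z V) X (\<lambda>z. s (f z))"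
        using continuous_map_compose[OF fVW, of "subtopology X U" s] s
        by (auto simp: homeomorphic_maps_def o_def continuous_map_in_subtopology)
      have sU: "s w \<in> U \<and> q (s w) = w" if "w \<in> W" for w
        using s that openin_subset[OF \<U>(1)] by (auto simp: homeomorphic_maps_def continuous_map_def)
      have sq: "s (q x) = x" if "x \<in> U" for x
        using s that Usub by (auto simp: homeomorphic_maps_def)
      have "homeomorphic_maps (subtopology ?F T) (subtopology Z V) snd (\<lambda>z. (s (f z), z))"
        unfolding homeomorphic_maps_def
      proof (intro conjI ballI)
        show "continuous_map (subtopology ?F T) (subtopology Z V) snd"
          using UW fiber_product_continuous_snd[of X Z q f]
          by (auto simp: continuous_map_in_subtopology U(2) S_def V_def topspace_fiber_product
              intro: continuous_map_from_subtopology)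
        have "continuous_map (subtopology Z V) (prod_topology X Z) (\<lambda>z. (s (f z), z))"
          using sf by (simp add: continuous_map_pairedI continuous_map_from_subtopology)
        then show "continuous_map (subtopology Z V) (subtopology ?F T) (\<lambda>z. (s (f z), z))"
          using sU Usub unfolding fiber_product_def
          by (auto simp: continuous_map_in_subtopology U(2) S_def V_def topspace_fiber_product fiber_product_def)
        fix x assume "x \<in> topspace (subtopology ?F T)"
        then have "x \<in> topspace ?F" "fst x \<in> U" by (auto simp: U(2) S_def)
        then have "s (q (fst x)) = fst x" "q (fst x) = f (snd x)" using sq by (auto simp: topspace_fiber_product)
        then show "(s (f (snd x)), snd x) = x" by (simp add: prod_eq_iff)
      qed simp
      then show "homeomorphic_map (subtopology ?F T) (subtopology Z V) snd"
        using homeomorphic_map_maps by blast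
      fix T' assume "T' \<in> S ` \<U>" "T \<noteq> T'"
      then obtain U' where "U' \<in> \<U>" "T' = S U'" "U \<noteq> U'" using U by blast
      then show "T \<inter> T' = {}" using \<U>(4)[OF U(1)] unfolding U(2) S_def by blast
    qed
    moreover have "z \<in> V" using W z by (simp add: V_def)
    ultimately show ?thesis by blast
  qed
  then show ?thesis
    unfolding finite_covering_map_def covering_map_evenly_covered
    using fin surj fiber_product_continuous_snd by blast
qed

text \<open>Over a path connected evenly covered set the slices are path connected, so each lies in
  the component or misses it. Surjectivity comes from lifting a path from \<open>p e\<close> to any
  given point of \<open>Y\<close>.\<close>

lemma finite_covering_component:
  assumes p: "finite_covering_map X Y p" and Y: "connected_space Y" "locally_path_connected_space Y"
    and e: "e \<in> topspace X"
  shows "finite_covering_map (subtopology X (connected_component_of_set X e)) Y p"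
proof -
  note cp = finite_covering_map_imp_covering_map[OF p]
  define K where "K = connected_component_of_set X e"
  have lpc: "locally_path_connected_space X" by (rule covering_locally_path_connected[OF cp Y(2)])
  have Kpath: "K = path_component_of_set X e"
    unfolding K_def using path_component_eq_connected_component_of[OF lpc] by simp
  have Ksub: "K \<subseteq> topspace X" unfolding K_def by (rule connected_component_of_subset_topspace)
  have eK: "e \<in> K" using e by (simp add: Kpath path_component_of_refl)
  have pc: "path_connected_space Y"
    using Y locally_path_connected_space_def path_connected_eq_connected_space by blast
  have surj: "p ` topspace (subtopology X K) = topspace Y"
  proof
    show "topspace Y \<subseteq> p ` topspace (subtopology X K)"
    proof
      fix y assume "y \<in> topspace Y"
      then obtain g where g: "pathin Y g" "g 0 = p e" "g 1 = y"
        using pc covering_map_in[OF cp e] unfolding path_connected_space_def by blast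
      obtain d where "pathin X d" "d 0 = e" "\<And>t. t \<in> {0..1} \<Longrightarrow> p (d t) = g t"
        by (rule path_lift_exists[OF cp g(1) e sym[OF g(2)]]) blast
      then have "d 1 \<in> K" "p (d 1) = y" using g by (auto simp: Kpath path_component_of_def)
      then show "y \<in> p ` topspace (subtopology X K)" using Ksub by auto
    qed
  qed (use covering_map_in[OF cp] in auto)
  have "\<exists>V. y \<in> V \<and> evenly_covered (subtopology X K) Y p V" if y: "y \<in> topspace Y" for y
  proof -
    obtain V0 where V0: "y \<in> V0" "evenly_covered X Y p V0" by (rule covering_map_nbhd[OF cp y])
    obtain V where V: "openin Y V" "path_connectedin Y V" "y \<in> V" "V \<subseteq> V0"
      using Y(2) V0(1) evenly_covered_open[OF V0(2)] unfolding locally_path_connected_space by blast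
    have "evenly_covered X Y p V"
      by (rule evenly_covered_subset[OF V0(2) V(1,4) covering_map_continuous[OF cp]])
    then obtain \<U> where \<U>: "openin Y V" "\<Union>\<U> = {x \<in> topspace X. p x \<in> V}" "\<And>U. U \<in> \<U> \<Longrightarrow> openin X U"
      "\<And>U U'. U \<in> \<U> \<Longrightarrow> U' \<in> \<U> \<Longrightarrow> U \<noteq> U' \<Longrightarrow> U \<inter> U' = {}"
      "\<And>U. U \<in> \<U> \<Longrightarrow> homeomorphic_map (subtopology X U) (subtopology Y V) p"
      by (rule evenly_coveredE, rule_tac that; simp)
    have UK: "U \<subseteq> K" if U: "U \<in> \<U>" "x \<in> U" "x \<in> K" for U x
    proof -
      have "path_connected_space (subtopology X U)"
        using V(2) homeomorphic_path_connected_space[OF homeomorphic_map_imp_homeomorphic_space[OF \<U>(5)[OF U(1)]]]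
        unfolding path_connectedin_def by simp
      then have "path_connectedin X U" using openin_subset[OF \<U>(3)[OF U(1)]] by (simp add: path_connectedin_def)
      then have xy: "path_component_of X x y" if "y \<in> U" for y
        unfolding path_component_of using that U(2) by (intro exI[of _ U]) simp
      have ex: "path_component_of X e x" using U(3) by (simp add: Kpath)
      show ?thesis
        using path_component_of_trans[OF ex xy] by (auto simp: Kpath)
    qed
    have "evenly_covered (subtopology X K) Y p V"
    proof (rule evenly_coveredI[OF V(1), of "{U \<in> \<U>. U \<subseteq> K}"])
      show "\<Union>{U \<in> \<U>. U \<subseteq> K} = {x \<in> topspace (subtopology X K). p x \<in> V}"
      proof -
        have "{x \<in> topspace (subtopology X K). p x \<in> V} = \<Union>\<U> \<inter> K" unfolding \<U>(2) by auto
        also have "\<dots> = \<Union>{U \<in> \<U>. U \<subseteq> K}"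
        proof
          show "\<Union>\<U> \<inter> K \<subseteq> \<Union>{U \<in> \<U>. U \<subseteq> K}"
          proof
            fix x assume "x \<in> \<Union>\<U> \<inter> K"
            then obtain U where "U \<in> \<U>" "x \<in> U" "x \<in> K" by auto
            with UK[OF this] show "x \<in> \<Union>{U \<in> \<U>. U \<subseteq> K}" by auto
          qed
        qed auto
        finally show ?thesis by simp
      qed
      fix U assume U: "U \<in> {U \<in> \<U>. U \<subseteq> K}"
      then have "K \<inter> U = U" by blast
      then show "openin (subtopology X K) U"
        using openin_subtopology_Int2[OF \<U>(3), of U K] U by simp
      show "homeomorphic_map (subtopology (subtopology X K) U) (subtopology Y V) p"
        using U \<U>(5) \<open>K \<inter> U = U\<close> by (simp add: subtopology_subtopology)
    qed (rule \<U>(4); simp)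
    with V(3) show ?thesis by blast
  qed
  moreover have "finite {x \<in> topspace (subtopology X K). p x = y}" if "y \<in> topspace Y" for y
    by (rule finite_subset[of _ "{x \<in> topspace X. p x = y}"]) (use p that in \<open>auto simp: finite_covering_map_def\<close>)
  ultimately show ?thesis
    unfolding finite_covering_map_def covering_map_evenly_covered K_def[symmetric]
    using surj continuous_map_from_subtopology[OF covering_map_continuous[OF cp]] by simp
qed

text \<open>Iterated fiber products live on ever larger product types, whereas the covering space in
  the theorem has a fixed one. A point is encoded by its image and its number in the finite fiber,
  and the topology is carried over.\<close>

lemma finite_covering_relabel:
  fixes X :: "'a topology" and Y :: "'b topology"
  assumes p: "finite_covering_map X Y p"
  obtains X' :: "('b \<times> nat) topology" and \<phi> where "homeomorphic_map X' X \<phi>"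
proof -
  let ?c = "\<lambda>x. (p x, to_nat_on {z \<in> topspace X. p z = p x} x)"
  have inj: "inj_on ?c (topspace X)"
  proof (rule inj_onI)
    fix x y assume xy: "x \<in> topspace X" "y \<in> topspace X" "?c x = ?c y"
    have "p x \<in> topspace Y" using covering_map_in[OF finite_covering_map_imp_covering_map[OF p] xy(1)] .
    then have "countable {z \<in> topspace X. p z = p x}"
      using p by (auto simp: finite_covering_map_def intro: countable_finite)
    from inj_on_to_nat_on[OF this] show "x = y" using xy by (auto dest: inj_onD)
  qed
  define A where "A = ?c ` topspace X"
  define g where "g = inv_into (topspace X) ?c"
  define X' where "X' = pullback_topology A g X"
  have gc: "g (?c x) = x" if "x \<in> topspace X" for x
    unfolding g_def by (rule inv_into_f_f[OF inj that])
  have top: "topspace X' = A"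
    unfolding X'_def topspace_pullback_topology A_def using gc by auto
  have "homeomorphic_maps X' X g ?c"
    unfolding homeomorphic_maps_def
  proof (intro conjI ballI)
    show "continuous_map X' X g"
      unfolding continuous_map_def top
    proof (intro conjI allI impI)
      show "g \<in> A \<rightarrow> topspace X" using gc by (auto simp: A_def)
      fix U assume "openin X U"
      moreover have "{x \<in> A. g x \<in> U} = g -` U \<inter> A" by auto
      ultimately show "openin X' {x \<in> A. g x \<in> U}" unfolding X'_def openin_pullback_topology by blast
    qed
    show "continuous_map X X' ?c"
      unfolding continuous_map_def top
    proof (intro conjI allI impI)
      show "?c \<in> topspace X \<rightarrow> A" by (auto simp: A_def)
      fix U assume "openin X' U"
      then obtain W where W: "openin X W" "U = g -` W \<inter> A" unfolding X'_def openin_pullback_topology by blast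
      have "{x \<in> topspace X. ?c x \<in> U} = W"
      proof (rule Set.set_eqI)
        fix x
        show "x \<in> {x \<in> topspace X. ?c x \<in> U} \<longleftrightarrow> x \<in> W"
        proof (cases "x \<in> topspace X")
          case True
          then have "?c x \<in> A" unfolding A_def by blast
          then show ?thesis using True gc[OF True] by (simp add: W(2))
        qed (use openin_subset[OF W(1)] in blast)
      qed
      then show "openin X {x \<in> topspace X. ?c x \<in> U}" using W(1) by simp
    qed
    show "?c (g y) = y" if "y \<in> topspace X'" for y using that gc unfolding top A_def by fastforce
  qed (rule gc)
  then show thesis using that homeomorphic_map_maps by blast
qed

lemma finite_covering_tower_proj:
  assumes "weak_solenoid_tower M p"
  shows "finite_covering_map (M i) (M 0) (tower_proj p i)"
proof (induction i)
  case 0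
  have "finite_covering_map (M 0) (M 0) id"
    by (rule homeomorphic_map_finite_covering) simp
  then show ?case by (simp only: tower_proj.simps)
next
  case (Suc i)
  have "finite_covering_map (M (Suc i)) (M i) (p i)" using assms by (simp add: weak_solenoid_tower_def)
  from finite_covering_compose[OF this Suc] show ?case by (simp only: tower_proj.simps)
qed


section \<open>Homotopies of loops\<close>

abbreviation unit_square :: "(real \<times> real) topology" where
  "unit_square \<equiv> top_of_set ({0..1} \<times> {0..1})"

lemma loop_homotopicI:
  assumes "continuous_map unit_square X H"
    and "\<And>t. t \<in> {0..1} \<Longrightarrow> H (0, t) = g t" "\<And>t. t \<in> {0..1} \<Longrightarrow> H (1, t) = h t"
    and "\<And>s. s \<in> {0..1} \<Longrightarrow> H (s, 0) = a \<and> H (s, 1) = a"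
  shows "loop_homotopic X a g h"
proof -
  have "homotopic_with (\<lambda>r. r 0 = a \<and> r 1 = a) (top_of_set {0..1}) X g h \<longleftrightarrow>
     (\<exists>H. continuous_map (prod_topology (top_of_set {0..1::real}) (top_of_set {0..1})) X H \<and>
        (\<forall>t \<in> topspace (top_of_set {0..1}). H (0, t) = g t) \<and>
        (\<forall>t \<in> topspace (top_of_set {0..1}). H (1, t) = h t) \<and>
        (\<forall>s \<in> {0..1}. H (s, 0) = a \<and> H (s, 1) = a))"
    by (rule homotopic_with) auto
  then show ?thesis unfolding loop_homotopic_def
    using assms by (auto simp: prod_topology_subtopology_eu intro!: exI[of _ H])
qed

lemma loop_homotopicE:
  assumes "loop_homotopic X a g h"
  obtains H where "continuous_map unit_square X H" "\<forall>t. H (0, t) = g t" "\<forall>t. H (1, t) = h t"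
    "\<forall>s \<in> {0..1}. H (s, 0) = a \<and> H (s, 1) = a"
  using assms unfolding loop_homotopic_def homotopic_with_def
  by (elim exE conjE) (rule that; simp add: prod_topology_subtopology_eu)

lemma loop_homotopic_sym: "loop_homotopic X a g h \<Longrightarrow> loop_homotopic X a h g"
  unfolding loop_homotopic_def by (rule homotopic_with_symD)

lemma loop_homotopic_trans:
  "loop_homotopic X a g h \<Longrightarrow> loop_homotopic X a h k \<Longrightarrow> loop_homotopic X a g k"
  unfolding loop_homotopic_def by (rule homotopic_with_trans)

lemma loop_homotopic_refl: "loop_homotopic X a g g \<longleftrightarrow> loop_at X a g"
  by (simp add: loop_homotopic_def loop_at_def pathin_def)

lemma loop_homotopic_imp_loop_at: "loop_homotopic X a g h \<Longrightarrow> loop_at X a g \<and> loop_at X a h"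
  using loop_homotopic_refl loop_homotopic_sym loop_homotopic_trans by metis

lemma loop_homotopic_cong:
  assumes "loop_at X a g" "\<And>t. t \<in> {0..1} \<Longrightarrow> g t = h t"
  shows "loop_homotopic X a g h"
  unfolding loop_homotopic_def using assms
  by (intro homotopic_with_equal) (auto simp: loop_at_def pathin_def)

text \<open>The straight-line homotopy from \<open>f\<close> to \<open>h\<close> stays in the convex
  unit interval. Associativity, unit and inverses for concatenation are all obtained from it by
  choosing the reparametrizations.\<close>

lemma loop_homotopic_reparam:
  assumes g: "pathin X g" and f: "continuous_on {0..1} f" "f ` {0..1} \<subseteq> {0..1::real}"
    and h: "continuous_on {0..1} h" "h ` {0..1} \<subseteq> {0..1::real}"
    and ends: "f 0 = h 0" "f 1 = h 1" "g (f 0) = a" "g (f 1) = a"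
  shows "loop_homotopic X a (\<lambda>t. g (f t)) (\<lambda>t. g (h t))"
proof -
  let ?k = "\<lambda>z. (1 - fst z) * f (snd z) + fst z * h (snd z)"
  have "continuous_on ({0..1} \<times> {0..1}) ?k"
    by (intro continuous_intros continuous_on_compose2[OF f(1)] continuous_on_compose2[OF h(1)]) auto
  moreover have "?k z \<in> {0..1}" if z: "z \<in> {0..1} \<times> {0..1}" for z
  proof -
    have "f (snd z) \<in> {0..1}" "h (snd z) \<in> {0..1}" "fst z \<in> {0..1}" using z f(2) h(2) by auto
    then have "?k z \<in> closed_segment (f (snd z)) (h (snd z))"
      by (auto simp: closed_segment_def)
    moreover have "closed_segment (f (snd z)) (h (snd z)) \<subseteq> {0..1}"
      using \<open>f (snd z) \<in> {0..1}\<close> \<open>h (snd z) \<in> {0..1}\<close> by (auto simp: closed_segment_eq_real_ivl split: if_splits)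
    ultimately show ?thesis by blast
  qed
  ultimately have "continuous_map unit_square (top_of_set {0..1}) ?k"
    by (simp add: continuous_map_in_subtopology image_subset_iff)
  from continuous_map_compose[OF this g[unfolded pathin_def]]
  have cont: "continuous_map unit_square X (\<lambda>z. g (?k z))" by (simp add: o_def)
  show ?thesis
  proof (rule loop_homotopicI[OF cont])
    fix s :: real
    have "(1 - s) * h 0 + s * h 0 = h 0" "(1 - s) * h 1 + s * h 1 = h 1"
      by (simp_all add: algebra_simps)
    then show "g ((1 - fst (s, 0)) * f (snd (s, 0)) + fst (s, 0) * h (snd (s, 0))) = a \<and>
        g ((1 - fst (s, 1)) * f (snd (s, 1)) + fst (s, 1) * h (snd (s, 1))) = a"
      using ends by simp
  qed auto
qed

lemma loop_homotopic_concat: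
  assumes g: "loop_homotopic X a g g'" and h: "loop_homotopic X a h h'"
  shows "loop_homotopic X a (path_concat g h) (path_concat g' h')"
proof -
  obtain H where H: "continuous_map unit_square X H" "\<forall>t. H (0, t) = g t" "\<forall>t. H (1, t) = g' t"
    "\<forall>s \<in> {0..1}. H (s, 0) = a \<and> H (s, 1) = a" using g by (rule loop_homotopicE)
  obtain K where K: "continuous_map unit_square X K" "\<forall>t. K (0, t) = h t" "\<forall>t. K (1, t) = h' t"
    "\<forall>s \<in> {0..1}. K (s, 0) = a \<and> K (s, 1) = a" using h by (rule loop_homotopicE)
  let ?f1 = "\<lambda>z::real \<times> real. (fst z, 2 * snd z)" and ?f2 = "\<lambda>z::real \<times> real. (fst z, 2 * snd z - 1)"
  let ?L = "\<lambda>z. if snd z \<le> 1/2 then (H \<circ> ?f1) z else (K \<circ> ?f2) z"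
  have cont: "continuous_map unit_square X ?L"
  proof (rule continuous_map_cases_le)
    have eq: "({0..1} \<times> {0..1}) \<inter> {z \<in> topspace unit_square. snd z \<le> 1/2} = {0..1} \<times> {0..1/2}"
       "({0..1} \<times> {0..1}) \<inter> {z \<in> topspace unit_square. 1/2 \<le> snd z} = {0..1} \<times> {1/2..1}" by auto
    have 1: "continuous_map (top_of_set ({0..1} \<times> {0..1/2})) unit_square ?f1"
      and 2: "continuous_map (top_of_set ({0..1} \<times> {1/2..1})) unit_square ?f2"
      by (auto simp: continuous_map_in_subtopology intro!: continuous_intros)
    show "continuous_map (subtopology unit_square {z \<in> topspace unit_square. snd z \<le> 1/2}) X (H \<circ> ?f1)"
      unfolding subtopology_subtopology eq by (rule continuous_map_compose[OF 1 H(1)])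
    show "continuous_map (subtopology unit_square {z \<in> topspace unit_square. 1/2 \<le> snd z}) X (K \<circ> ?f2)"
      unfolding subtopology_subtopology eq by (rule continuous_map_compose[OF 2 K(1)])
    fix z assume z: "z \<in> topspace unit_square" "snd z = 1/2"
    then have "?f1 z = (fst z, 1)" "?f2 z = (fst z, 0)" "fst z \<in> {0..1}" by auto
    then show "(H \<circ> ?f1) z = (K \<circ> ?f2) z" using H(4) K(4) by (simp only: o_apply)
  qed (auto intro!: continuous_intros)
  show ?thesis
    by (rule loop_homotopicI[OF cont]) (use H(2-4) K(2-4) in \<open>auto simp: path_concat_def\<close>)
qed

lemma loop_at_const: "a \<in> topspace X \<Longrightarrow> loop_at X a (\<lambda>t. a)"
  by (simp add: loop_at_def)

lemma loop_at_concat: "loop_at X a g \<Longrightarrow> loop_at X a h \<Longrightarrow> loop_at X a (path_concat g h)"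
  by (simp add: loop_at_def pathin_concat)

lemma loop_at_reverse: "loop_at X a g \<Longrightarrow> loop_at X a (\<lambda>t. g (1 - t))"
  by (simp add: loop_at_def pathin_reverse)

lemma loop_homotopic_assoc:
  assumes "loop_at X a g" "loop_at X a h" "loop_at X a k"
  shows "loop_homotopic X a (path_concat (path_concat g h) k) (path_concat g (path_concat h k))"
proof -
  let ?l = "path_concat g (path_concat h k)"
  \<comment> \<open>The piecewise linear map taking 0, 1/4, 1/2, 1 to 0, 1/2, 3/4, 1. Its slopes 2,
    1, 1/2 decrease, so it is the minimum of its three affine pieces.\<close>
  let ?f = "\<lambda>t::real. min (2 * t) (min (t + 1/4) ((1 + t) / 2))"
  have l: "loop_at X a ?l" using assms by (intro loop_at_concat)
  have hom: "loop_homotopic X a (\<lambda>t. ?l (?f t)) (\<lambda>t. ?l t)"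
  proof (rule loop_homotopic_reparam)
    show "?f ` {0..1} \<subseteq> {0..1}" by (auto simp: min_def)
  qed (use l in \<open>auto simp: loop_at_def intro!: continuous_intros\<close>)
  have "?l (?f t) = path_concat (path_concat g h) k t" if "t \<in> {0..1}" for t
  proof -
    consider "t \<le> 1/4" | "1/4 < t" "t \<le> 1/2" | "1/2 < t" by linarith
    then show ?thesis
    proof cases
      case 1
      then have "?f t = 2 * t" using that by (auto simp: min_def)
      then show ?thesis using 1 by (simp add: path_concat_def)
    next
      case 2
      then have "?f t = t + 1/4" using that by (auto simp: min_def)
      then show ?thesis using 2 by (simp add: path_concat_def algebra_simps)
    next
      case 3
      then have "?f t = (1 + t) / 2" using that by (auto simp: min_def)
      moreover have "?l u = path_concat h k (2 * u - 1)" if "1/2 < u" for u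
        using that by (simp add: path_concat_def[of g])
      moreover have "1/2 < (1 + t) / 2" "2 * ((1 + t) / 2) - 1 = t" using 3 by (simp_all add: field_simps)
      ultimately have "?l (?f t) = path_concat h k t" by metis
      also have "\<dots> = k (2 * t - 1)" using 3 by (simp add: path_concat_def)
      finally show ?thesis using 3 by (simp add: path_concat_def)
    qed
  qed
  from loop_homotopic_cong[OF conjunct1[OF loop_homotopic_imp_loop_at[OF hom]] this]
  have "loop_homotopic X a (\<lambda>t. ?l (?f t)) (path_concat (path_concat g h) k)" .
  from loop_homotopic_trans[OF loop_homotopic_sym[OF this] hom] show ?thesis .
qed

lemma loop_homotopic_const_concat:
  assumes g: "loop_at X a g"
  shows "loop_homotopic X a (path_concat (\<lambda>t. a) g) g"
proof -
  have hom: "loop_homotopic X a (\<lambda>t. g (max 0 (2 * t - 1))) (\<lambda>t. g t)"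
    by (rule loop_homotopic_reparam) (use g in \<open>auto simp: loop_at_def intro!: continuous_intros\<close>)
  have "loop_homotopic X a (\<lambda>t. g (max 0 (2 * t - 1))) (path_concat (\<lambda>t. a) g)"
  proof (rule loop_homotopic_cong)
    fix t :: real assume "t \<in> {0..1}"
    show "g (max 0 (2 * t - 1)) = path_concat (\<lambda>t. a) g t"
    proof (cases "t \<le> 1/2")
      case True
      then have "max 0 (2 * t - 1) = 0" by auto
      then show ?thesis using True g by (simp add: path_concat_def loop_at_def)
    qed (simp add: path_concat_def max_def)
  qed (use loop_homotopic_imp_loop_at[OF hom] in simp)
  from loop_homotopic_trans[OF loop_homotopic_sym[OF this] hom] show ?thesis .
qed

lemma loop_homotopic_reverse_concat:
  assumes g: "loop_at X a g"
  shows "loop_homotopic X a (path_concat (\<lambda>t. g (1 - t)) g) (\<lambda>t. a)"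
proof -
  \<comment> \<open>Runs from 1 down to 0 and back. It agrees with the constant map 1 at both ends,
    so the two reparametrizations of \<open>g\<close> are homotopic.\<close>
  let ?f = "\<lambda>t::real. max (1 - 2 * t) (2 * t - 1)"
  have hom: "loop_homotopic X a (\<lambda>t. g (?f t)) (\<lambda>t. g ((\<lambda>t. 1) t))"
    by (rule loop_homotopic_reparam) (use g in \<open>auto simp: loop_at_def intro!: continuous_intros\<close>)
  have "loop_homotopic X a (\<lambda>t. g (?f t)) (path_concat (\<lambda>t. g (1 - t)) g)"
  proof (rule loop_homotopic_cong)
    fix t :: real assume "t \<in> {0..1}"
    show "g (?f t) = path_concat (\<lambda>t. g (1 - t)) g t"
    proof (cases "t \<le> 1/2")
      case True
      then have "?f t = 1 - 2 * t" by auto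
      then show ?thesis using True by (simp add: path_concat_def)
    qed (simp add: path_concat_def max_def)
  qed (use loop_homotopic_imp_loop_at[OF hom] in simp)
  from loop_homotopic_trans[OF loop_homotopic_sym[OF this] hom]
  show ?thesis using g by (simp add: loop_at_def)
qed


section \<open>The fundamental group and the monodromy of a covering\<close>

lemma loop_class_self: "loop_at X a g \<Longrightarrow> g \<in> loop_class X a g"
  by (simp add: loop_class_def loop_homotopic_refl)

lemma loop_class_eq:
  assumes "loop_homotopic X a g h"
  shows "loop_class X a g = loop_class X a h"
  using loop_homotopic_trans[OF assms] loop_homotopic_trans[OF loop_homotopic_sym[OF assms]]
  unfolding loop_class_def by blast

lemma loop_class_eq_iff:
  assumes "loop_at X a h"
  shows "loop_class X a g = loop_class X a h \<longleftrightarrow> loop_homotopic X a g h"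
proof
  assume "loop_class X a g = loop_class X a h"
  then have "h \<in> loop_class X a g" using loop_class_self[OF assms] by simp
  then show "loop_homotopic X a g h" by (simp add: loop_class_def)
qed (rule loop_class_eq)

lemma carrier_fundamental_group: "carrier (fundamental_group X a) = loop_class X a ` Collect (loop_at X a)"
  by (simp add: fundamental_group_def)

lemma loop_class_in_carrier: "loop_at X a g \<Longrightarrow> loop_class X a g \<in> carrier (fundamental_group X a)"
  by (simp add: carrier_fundamental_group)

lemma fundamental_group_carrierE:
  assumes "A \<in> carrier (fundamental_group X a)"
  obtains g where "loop_at X a g" "A = loop_class X a g"
  using assms by (auto simp: carrier_fundamental_group)

lemma one_fundamental_group: "\<one>\<^bsub>fundamental_group X a\<^esub> = loop_class X a (\<lambda>t. a)"
  by (simp add: fundamental_group_def)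

text \<open>The product is a union over representatives; by homotopy invariance of concatenation all
  the classes in this union are the same.\<close>

lemma mult_fundamental_group:
  assumes "loop_at X a g" "loop_at X a h"
  shows "loop_class X a g \<otimes>\<^bsub>fundamental_group X a\<^esub> loop_class X a h = loop_class X a (path_concat g h)"
proof -
  have eq: "loop_class X a (path_concat g' h') = loop_class X a (path_concat g h)"
    if "g' \<in> loop_class X a g" "h' \<in> loop_class X a h" for g' h'
    by (rule loop_class_eq, rule loop_homotopic_concat; rule loop_homotopic_sym)
      (use that in \<open>simp_all add: loop_class_def\<close>)
  have "loop_class X a g \<noteq> {}" "loop_class X a h \<noteq> {}"
    using loop_class_self[OF assms(1)] loop_class_self[OF assms(2)] by force+
  then have "(\<Union>g \<in> loop_class X a g. \<Union>h \<in> loop_class X a h. loop_class X a (path_concat g h)) =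
      loop_class X a (path_concat g h)"
    by (simp add: eq cong: SUP_cong)
  then show ?thesis by (simp add: fundamental_group_def)
qed

lemma group_fundamental_group:
  assumes a: "a \<in> topspace X"
  shows "group (fundamental_group X a)" (is "group ?G")
proof (rule groupI)
  fix A B C assume "A \<in> carrier ?G" "B \<in> carrier ?G" "C \<in> carrier ?G"
  then obtain g h k where gh: "loop_at X a g" "A = loop_class X a g" "loop_at X a h" "B = loop_class X a h"
    "loop_at X a k" "C = loop_class X a k" by (auto elim!: fundamental_group_carrierE)
  show "(A \<otimes>\<^bsub>?G\<^esub> B) \<otimes>\<^bsub>?G\<^esub> C = A \<otimes>\<^bsub>?G\<^esub> (B \<otimes>\<^bsub>?G\<^esub> C)"
    using gh by (simp add: mult_fundamental_group loop_at_concat loop_class_eq loop_homotopic_assoc)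
next
  fix A B assume "A \<in> carrier ?G" "B \<in> carrier ?G"
  then show "A \<otimes>\<^bsub>?G\<^esub> B \<in> carrier ?G"
    by (auto elim!: fundamental_group_carrierE simp: mult_fundamental_group loop_at_concat loop_class_in_carrier)
next
  show "\<one>\<^bsub>?G\<^esub> \<in> carrier ?G" using a by (simp add: one_fundamental_group loop_class_in_carrier loop_at_const)
  fix A assume "A \<in> carrier ?G"
  then obtain g where g: "loop_at X a g" "A = loop_class X a g" by (rule fundamental_group_carrierE)
  then show "\<one>\<^bsub>?G\<^esub> \<otimes>\<^bsub>?G\<^esub> A = A"
    using a by (simp add: one_fundamental_group mult_fundamental_group loop_at_const loop_class_eq loop_homotopic_const_concat)
  have "loop_class X a (\<lambda>t. g (1 - t)) \<otimes>\<^bsub>?G\<^esub> A = \<one>\<^bsub>?G\<^esub>"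
    using g by (simp add: one_fundamental_group mult_fundamental_group loop_at_reverse loop_class_eq loop_homotopic_reverse_concat)
  then show "\<exists>B \<in> carrier ?G. B \<otimes>\<^bsub>?G\<^esub> A = \<one>\<^bsub>?G\<^esub>"
    by (rule bexI[OF _ loop_class_in_carrier[OF loop_at_reverse[OF g(1)]]])
qed

lemma inv_fundamental_group:
  assumes a: "a \<in> topspace X" and g: "loop_at X a g"
  shows "inv\<^bsub>fundamental_group X a\<^esub> loop_class X a g = loop_class X a (\<lambda>t. g (1 - t))"
proof -
  interpret group "fundamental_group X a" by (rule group_fundamental_group[OF a])
  have "loop_class X a (\<lambda>t. g (1 - t)) \<otimes>\<^bsub>fundamental_group X a\<^esub> loop_class X a g = \<one>\<^bsub>fundamental_group X a\<^esub>"
    using g by (simp add: one_fundamental_group mult_fundamental_group loop_at_reverse loop_class_eq loop_homotopic_reverse_concat)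
  then show ?thesis
    by (rule inv_equality[OF _ loop_class_in_carrier[OF g] loop_class_in_carrier[OF loop_at_reverse[OF g]]])
qed

locale pointed_covering =
  fixes Z :: "'z topology" and Y :: "'y topology" and q :: "'z \<Rightarrow> 'y" and b :: 'z and a :: 'y
  assumes cov: "finite_covering_map Z Y q"
    and Y_compact: "compact_space Y" and Y_Hausdorff: "Hausdorff_space Y"
    and Y_lpc: "locally_path_connected_space Y" and Z_path: "path_connected_space Z"
    and b: "b \<in> topspace Z" and qb: "q b = a"
begin

abbreviation "G \<equiv> fundamental_group Y a"
abbreviation "H \<equiv> fundamental_group_image Z b Y q"

lemma covq: "covering_map Z Y q"
  by (rule finite_covering_map_imp_covering_map[OF cov])

lemma a: "a \<in> topspace Y"
  using covering_map_in[OF covq b] qb by simp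

lemma group_G: "group G"
  by (rule group_fundamental_group[OF a])

lemma lift_homotopic: "loop_homotopic Y a g h \<Longrightarrow> lifts_to Z q g e e' \<longleftrightarrow> lifts_to Z q h e e'"
  using loop_homotopic_lifts_to[OF covq Y_compact Y_Hausdorff Y_lpc] loop_homotopic_sym by metis

text \<open>The image of the fundamental group is the stabilizer of \<open>b\<close> under
  monodromy. Homotopy invariance of lifting is what makes this independent of the
  representative.\<close>

lemma loop_class_in_image:
  assumes g: "loop_at Y a g"
  shows "loop_class Y a g \<in> H \<longleftrightarrow> lifts_to Z q g b b"
proof
  assume "loop_class Y a g \<in> H"
  then obtain d where d: "loop_at Z b d" "loop_class Y a g = loop_class Y a (q \<circ> d)"
    by (auto simp: fundamental_group_image_def qb)
  have "loop_at Y a (q \<circ> d)"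
    using d(1) pathin_compose[OF _ covering_map_continuous[OF covq]] qb by (auto simp: loop_at_def)
  then have "loop_homotopic Y a g (q \<circ> d)" using d(2) loop_class_eq_iff by metis
  moreover have "lifts_to Z q (q \<circ> d) b b" using d(1) by (auto simp: lifts_to_def loop_at_def)
  ultimately show "lifts_to Z q g b b" using lift_homotopic by simp
next
  assume "lifts_to Z q g b b"
  then obtain d where d: "pathin Z d" "d 0 = b" "d 1 = b" "\<forall>t \<in> {0..1}. q (d t) = g t"
    by (auto simp: lifts_to_def)
  then have "loop_class Y a g = loop_class Y (q b) (q \<circ> d)"
    unfolding qb by (intro loop_class_eq loop_homotopic_cong[OF g]) auto
  moreover have "loop_at Z b d" using d by (simp add: loop_at_def)
  ultimately show "loop_class Y a g \<in> H" unfolding fundamental_group_image_def by blast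
qed

lemma image_subset: "H \<subseteq> carrier G"
proof
  fix A assume "A \<in> H"
  then obtain d where d: "loop_at Z b d" "A = loop_class Y a (q \<circ> d)"
    by (auto simp: fundamental_group_image_def qb)
  have "loop_at Y a (q \<circ> d)"
    using d(1) pathin_compose[OF _ covering_map_continuous[OF covq]] qb by (auto simp: loop_at_def)
  then show "A \<in> carrier G" using d(2) loop_class_in_carrier by simp
qed

lemma subgroup_image: "subgroup H G"
proof (rule group.subgroupI[OF group_G image_subset])
  have "loop_class Y a (\<lambda>t. a) \<in> H"
    using loop_class_in_image[OF loop_at_const[OF a]] lifts_to_const[of b Z q a] b qb by simp
  then show "H \<noteq> {}" by blast
  fix A assume A: "A \<in> H"
  then obtain g where g: "loop_at Y a g" "A = loop_class Y a g"
    using image_subset fundamental_group_carrierE by (metis subsetD)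
  have gb: "lifts_to Z q g b b" using A g loop_class_in_image by simp
  then show "inv\<^bsub>G\<^esub> A \<in> H"
    using g loop_class_in_image[OF loop_at_reverse[OF g(1)]] lifts_to_reverse
    by (simp add: inv_fundamental_group[OF a])
  fix B assume B: "B \<in> H"
  then obtain h where h: "loop_at Y a h" "B = loop_class Y a h"
    using image_subset fundamental_group_carrierE by (metis subsetD)
  then have "lifts_to Z q h b b" using B loop_class_in_image by simp
  then show "A \<otimes>\<^bsub>G\<^esub> B \<in> H"
    using g h gb loop_class_in_image[OF loop_at_concat[OF g(1) h(1)]] lifts_to_concat
    by (metis mult_fundamental_group)
qed

lemma loop_lift_exists: "loop_at Y a g \<Longrightarrow> e \<in> topspace Z \<Longrightarrow> q e = a \<Longrightarrow> \<exists>e'. lifts_to Z q g e e'"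
  by (rule lifts_to_exists[OF covq]) (auto simp: loop_at_def)

text \<open>A right coset is determined by the end point of the lift from \<open>b\<close>: two
  loops with the same end point differ by one that lifts to a loop at \<open>b\<close>. The end
  points lie in the finite fiber.\<close>

lemma finite_index_image: "finite (rcosets\<^bsub>G\<^esub> H)"
proof -
  interpret group G by (rule group_G)
  define F where "F = {e \<in> topspace Z. q e = a}"
  define C where "C = (\<lambda>e. H #>\<^bsub>G\<^esub> loop_class Y a (SOME g. loop_at Y a g \<and> lifts_to Z q g b e))"
  have "rcosets\<^bsub>G\<^esub> H \<subseteq> C ` F"
  proof
    fix R assume "R \<in> rcosets\<^bsub>G\<^esub> H"
    then obtain A where A: "A \<in> carrier G" "R = H #>\<^bsub>G\<^esub> A" by (auto simp: RCOSETS_def)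
    from A(1) obtain g where g: "loop_at Y a g" "A = loop_class Y a g" by (rule fundamental_group_carrierE)
    obtain e where e: "lifts_to Z q g b e" using loop_lift_exists[OF g(1) b qb] by blast
    define g' where "g' = (SOME g. loop_at Y a g \<and> lifts_to Z q g b e)"
    have g': "loop_at Y a g' \<and> lifts_to Z q g' b e" unfolding g'_def by (rule someI[of _ g]) (use g e in simp)
    have "e \<in> F" using lifts_to_in_topspace[OF e] lifts_to_ends[OF e] g(1) by (auto simp: F_def loop_at_def)
    have "lifts_to Z q (path_concat g (\<lambda>t. g' (1 - t))) b b"
      using lifts_to_concat[OF e lifts_to_reverse] g' by blast
    then have "A \<otimes>\<^bsub>G\<^esub> inv\<^bsub>G\<^esub> loop_class Y a g' \<in> H"
      using g g' by (simp add: inv_fundamental_group[OF a] mult_fundamental_group loop_at_reverse loop_class_in_image loop_at_concat)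
    then have "A \<in> H #>\<^bsub>G\<^esub> loop_class Y a g'"
      by (intro subgroup.rcos_module_rev[OF subgroup_image is_group] A(1) loop_class_in_carrier) (use g' in simp_all)
    from repr_independence[OF this _ subgroup_image] have "R = H #>\<^bsub>G\<^esub> loop_class Y a g'"
      using A(2) loop_class_in_carrier[OF conjunct1[OF g']] by simp
    then show "R \<in> C ` F" using \<open>e \<in> F\<close> by (auto simp: C_def g'_def)
  qed
  moreover have "finite F" using cov a by (simp add: F_def finite_covering_map_def)
  ultimately show ?thesis using finite_subset by blast
qed

text \<open>Transitivity of the monodromy: project a path from \<open>b\<close> to
  \<open>e\<close>.\<close>

lemma fiber_reached:
  assumes e: "e \<in> topspace Z" "q e = a"
  obtains g where "loop_at Y a g" "lifts_to Z q g b e"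
proof -
  obtain d where d: "pathin Z d" "d 0 = b" "d 1 = e" using Z_path[unfolded path_connected_space_def, rule_format, OF b e(1)] by (elim exE conjE)
  have "loop_at Y a (q \<circ> d)"
    using d pathin_compose[OF _ covering_map_continuous[OF covq]] qb e by (auto simp: loop_at_def)
  moreover have "lifts_to Z q (q \<circ> d) b e" using d by (auto simp: lifts_to_def)
  ultimately show thesis by (rule that)
qed

text \<open>Lifting is a right action, hence conjugation by \<open>h\<close> moves the base point along the reversed loop.\<close>

lemma loop_class_in_conjugate:
  assumes g: "loop_at Y a g" and h: "loop_at Y a h" and e: "lifts_to Z q (\<lambda>t. h (1 - t)) b e"
  shows "inv\<^bsub>G\<^esub> loop_class Y a h \<otimes>\<^bsub>G\<^esub> loop_class Y a g \<otimes>\<^bsub>G\<^esub> loop_class Y a h \<in> H \<longleftrightarrow> lifts_to Z q g e e"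
proof -
  let ?l = "path_concat (path_concat (\<lambda>t. h (1 - t)) g) h"
  have "loop_at Y a ?l" using g h by (intro loop_at_concat loop_at_reverse)
  then have "inv\<^bsub>G\<^esub> loop_class Y a h \<otimes>\<^bsub>G\<^esub> loop_class Y a g \<otimes>\<^bsub>G\<^esub> loop_class Y a h \<in> H \<longleftrightarrow> lifts_to Z q ?l b b"
    using g h by (simp add: inv_fundamental_group[OF a] mult_fundamental_group loop_at_reverse loop_class_in_image loop_at_concat)
  also have "\<dots> \<longleftrightarrow> lifts_to Z q g e e"
  proof
    assume "lifts_to Z q g e e"
    moreover have "lifts_to Z q h e b" using lifts_to_reverse[OF e] by simp
    ultimately show "lifts_to Z q ?l b b" using e lifts_to_concat by metis
  next
    \<comment> \<open>Run along the composite piece by piece. Since it returns to \<open>b\<close>,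
      its last piece read backwards is a lift of the reversed \<open>h\<close> from
      \<open>b\<close>, which ends at \<open>e\<close>; so the middle piece has to end at
      \<open>e\<close>.\<close>
    assume l: "lifts_to Z q ?l b b"
    have eF: "e \<in> topspace Z" "q e = a"
      using lifts_to_in_topspace[OF e] lifts_to_ends[OF e] h by (auto simp: loop_at_def)
    obtain e1 where e1: "lifts_to Z q g e e1" using loop_lift_exists[OF g eF] by blast
    then have e1F: "e1 \<in> topspace Z" "q e1 = a"
      using lifts_to_in_topspace[OF e1] lifts_to_ends[OF e1] g by (auto simp: loop_at_def)
    obtain e2 where e2: "lifts_to Z q h e1 e2" using loop_lift_exists[OF h e1F] by blast
    have "lifts_to Z q ?l b e2" using e e1 e2 lifts_to_concat by metis
    then have "e2 = b" using lifts_to_unique[OF covq] l by metis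
    then have "lifts_to Z q (\<lambda>t. h (1 - t)) b e1" using lifts_to_reverse[OF e2] by simp
    then have "e1 = e" using lifts_to_unique[OF covq] e by metis
    with e1 show "lifts_to Z q g e e" by simp
  qed
  finally show ?thesis .
qed

end


section \<open>Small simply connected sets in manifolds\<close>

text \<open>The model space consists of the sequences that vanish from index \<open>n\<close> on, so
  a basic open set constrains only the first \<open>n\<close> coordinates there.\<close>

lemma Euclidean_space_box:
  assumes V: "openin (Euclidean_space n) V" and y: "y \<in> V"
  obtains r where "r > 0" "{x \<in> topspace (Euclidean_space n). \<forall>i<n. \<bar>x i - y i\<bar> < r} \<subseteq> V"
proof -
  obtain T where T: "openin (powertop_real UNIV) T" "V = T \<inter> {x. \<forall>i\<ge>n. x i = 0}"
    using V unfolding Euclidean_space_def openin_subtopology by blast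
  have "y \<in> T" using y T(2) by blast
  then obtain U where U: "\<And>i. open (U i)" "\<And>i. y i \<in> U i" "Pi\<^sub>E UNIV U \<subseteq> T"
    using T(1) unfolding openin_product_topology_alt by (force simp: PiE_iff)
  have "\<exists>r>0. \<forall>z. \<bar>z - y i\<bar> < r \<longrightarrow> z \<in> U i" for i
    using U(1)[of i] U(2)[of i] unfolding open_dist dist_real_def by blast
  then obtain r where r: "\<And>i. r i > 0" "\<And>i z. \<bar>z - y i\<bar> < r i \<Longrightarrow> z \<in> U i" by metis
  \<comment> \<open>Inserting 1 keeps the minimum defined in dimension 0.\<close>
  define R where "R = Min (insert 1 (r ` {..<n}))"
  have "R > 0" unfolding R_def using r(1) by (subst Min_gr_iff) auto
  moreover have "R \<le> r i" if "i < n" for i unfolding R_def using that by (intro Min_le) auto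
  moreover have "{x \<in> topspace (Euclidean_space n). \<forall>i<n. \<bar>x i - y i\<bar> < R} \<subseteq> V"
  proof
    fix x assume x: "x \<in> {x \<in> topspace (Euclidean_space n). \<forall>i<n. \<bar>x i - y i\<bar> < R}"
    have "x i \<in> U i" for i
    proof (cases "i < n")
      case True
      then have "\<bar>x i - y i\<bar> < r i" using x \<open>\<And>i. i < n \<Longrightarrow> R \<le> r i\<close>[OF True] by force
      then show ?thesis by (rule r(2))
    next
      case False
      then have "x i = 0" "y i = 0" using x y T(2) by (auto simp: topspace_Euclidean_space)
      then show ?thesis using U(2)[of i] by simp
    qed
    then have "x \<in> T" using U(3) by (auto simp: PiE_iff)
    then show "x \<in> V" using x by (simp add: T(2) topspace_Euclidean_space)
  qed
  ultimately show thesis using that by blast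
qed

lemma openin_Euclidean_box:
  "openin (Euclidean_space n) {x \<in> topspace (Euclidean_space n). \<forall>i<n. \<bar>x i - y i\<bar> < r}"
proof -
  have "openin (Euclidean_space n) {x \<in> topspace (Euclidean_space n). x i \<in> {y i - r<..<y i + r}}" for i
  proof (rule openin_continuous_map_preimage)
    show "continuous_map (Euclidean_space n) euclideanreal (\<lambda>x. x i)"
      unfolding Euclidean_space_def
      by (rule continuous_map_from_subtopology[OF continuous_map_product_projection]) simp
  qed simp
  moreover have "\<bar>x i - y i\<bar> < r \<longleftrightarrow> x i \<in> {y i - r<..<y i + r}" for x i by auto
  ultimately have *: "openin (Euclidean_space n) {x \<in> topspace (Euclidean_space n). \<bar>x i - y i\<bar> < r}" for i
    by simp
  have "{x \<in> topspace (Euclidean_space n). \<forall>i<n. \<bar>x i - y i\<bar> < r} =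
    topspace (Euclidean_space n) \<inter> (\<Inter>i\<in>{..<n}. {x \<in> topspace (Euclidean_space n). \<bar>x i - y i\<bar> < r})"
    by auto
  also have "openin (Euclidean_space n) \<dots>"
  proof (cases "n = 0")
    case False
    then show ?thesis using * by (intro openin_Int openin_Inter) auto
  qed simp
  finally show ?thesis .
qed

text \<open>The sets \<open>B\<close> are coordinate boxes seen through a chart; boxes are convex,
  so straight lines connect their points and contract their loops.\<close>

lemma manifold_simply_connected_basis:
  assumes Y: "locally_Euclidean_dim n Y" and W: "openin Y W" "y \<in> W"
  obtains B where "openin Y B" "y \<in> B" "B \<subseteq> W" "path_connectedin Y B"
    "\<And>a g. loop_at (subtopology Y B) a g \<Longrightarrow> loop_homotopic Y a g (\<lambda>t. a)"
proof -
  let ?E = "Euclidean_space n"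
  have "y \<in> topspace Y" using W openin_subset by blast
  then obtain U V where UV: "openin Y U" "y \<in> U" "openin ?E V"
    "subtopology Y U homeomorphic_space subtopology ?E V"
    using Y unfolding locally_Euclidean_dim_def by blast
  then obtain f h where fh: "homeomorphic_maps (subtopology Y U) (subtopology ?E V) f h"
    unfolding homeomorphic_space_def by blast
  have hh: "homeomorphic_map (subtopology ?E V) (subtopology Y U) h"
    and hf: "homeomorphic_map (subtopology Y U) (subtopology ?E V) f"
    using fh homeomorphic_maps_map by blast+
  have Usub: "U \<subseteq> topspace Y" and Vsub: "V \<subseteq> topspace ?E" using UV openin_subset by blast+
  have hfx: "h (f x) = x" if "x \<in> U" for x using fh that Usub by (auto simp: homeomorphic_maps_def)
  have fhx: "f (h x) = x" if "x \<in> V" for x using fh that Vsub by (auto simp: homeomorphic_maps_def)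
  have fV: "f x \<in> V" if "x \<in> U" for x
    using fh that Usub by (auto simp: homeomorphic_maps_def continuous_map_def)
  have "openin ?E (f ` (U \<inter> W))" by (rule homeomorphic_map_slice_openin[OF hf UV(1,3) W(1)])
  moreover have "f y \<in> f ` (U \<inter> W)" using UV(2) W(2) by blast
  ultimately obtain r where r: "r > 0" "{x \<in> topspace ?E. \<forall>i<n. \<bar>x i - f y i\<bar> < r} \<subseteq> f ` (U \<inter> W)"
    by (rule Euclidean_space_box)
  define D where "D = {x \<in> topspace ?E. \<forall>i<n. \<bar>x i - f y i\<bar> < r}"
  have DV: "D \<subseteq> V" using r(2) fV unfolding D_def by blast
  have Dopen: "openin ?E D" unfolding D_def by (rule openin_Euclidean_box)
  define B where "B = h ` D"
  have "openin Y (h ` (V \<inter> D))" by (rule homeomorphic_map_slice_openin[OF hh UV(3,1) Dopen])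
  then have B: "openin Y B" using DV by (simp add: B_def Int_absorb1)
  have fyD: "f y \<in> D" using fV[OF UV(2)] Vsub r(1) by (auto simp: D_def)
  have BW: "B \<subseteq> U \<inter> W"
  proof
    fix x assume "x \<in> B"
    then obtain d where d: "d \<in> D" "x = h d" by (auto simp: B_def)
    then obtain u where "u \<in> U \<inter> W" "d = f u" using r(2) unfolding D_def by blast
    then show "x \<in> U \<inter> W" using hfx d by auto
  qed
  have fBD: "f x \<in> D" if "x \<in> B" for x using that fhx DV by (auto simp: B_def)
  define k :: "real \<Rightarrow> (nat \<Rightarrow> real) \<Rightarrow> (nat \<Rightarrow> real) \<Rightarrow> nat \<Rightarrow> real"
    where "k = (\<lambda>s x z i. (1 - s) * x i + s * z i)"
  have kD: "k s x z \<in> D" if "x \<in> D" "z \<in> D" "s \<in> {0..1}" for s x z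
  proof -
    have "\<bar>k s x z i - f y i\<bar> < r" if i: "i < n" for i
    proof -
      have "\<bar>x i - f y i\<bar> < r" "\<bar>z i - f y i\<bar> < r" using \<open>x \<in> D\<close> \<open>z \<in> D\<close> i by (auto simp: D_def)
      moreover have "k s x z i - f y i = (1 - s) * (x i - f y i) + s * (z i - f y i)"
        by (simp add: k_def algebra_simps)
      moreover have "0 \<le> 1 - s" "0 \<le> s" "1 - s + s = 1" using \<open>s \<in> {0..1}\<close> by auto
      ultimately have "k s x z i - f y i < r" "- (k s x z i - f y i) < r"
        using convex_bound_lt[of "x i - f y i" r "z i - f y i" "1 - s" s]
          convex_bound_lt[of "- (x i - f y i)" r "- (z i - f y i)" "1 - s" s]
        by (auto simp: abs_less_iff algebra_simps)
      then show ?thesis by (simp add: abs_less_iff)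
    qed
    then show ?thesis using that by (auto simp: D_def topspace_Euclidean_space k_def)
  qed
  \<comment> \<open>Continuity of the straight-line map in all its arguments at once; it serves the
    connecting paths as well as the contraction of loops.\<close>
  have cont: "continuous_map T (subtopology Y B) (\<lambda>t. h (k (\<sigma> t) (u t) (v t)))"
    if "continuous_map T (top_of_set {0..1}) \<sigma>" "continuous_map T (subtopology ?E D) u"
      "continuous_map T (subtopology ?E D) v" for T :: "(real \<times> real) topology" and \<sigma> u v
  proof -
    have coord: "continuous_map T euclideanreal (\<lambda>t. w t i)" if "continuous_map T (subtopology ?E D) w" for w i
    proof -
      have "continuous_map T (powertop_real UNIV) w"
        using that by (simp add: Euclidean_space_def continuous_map_in_subtopology)
      then show ?thesis by (simp add: continuous_map_componentwise_UNIV)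
    qed
    have \<sigma>: "continuous_map T euclideanreal \<sigma>" using that(1) by (simp add: continuous_map_in_subtopology)
    have "continuous_map T (powertop_real UNIV) (\<lambda>t. k (\<sigma> t) (u t) (v t))"
      unfolding continuous_map_componentwise_UNIV k_def
      by (intro allI continuous_intros coord that \<sigma>)
    moreover have in_D: "k (\<sigma> t) (u t) (v t) \<in> D" if "t \<in> topspace T" for t
      using kD that \<open>continuous_map T (top_of_set {0..1}) \<sigma>\<close> \<open>continuous_map T (subtopology ?E D) u\<close>
        \<open>continuous_map T (subtopology ?E D) v\<close>
      by (auto simp: continuous_map_def Pi_iff)
    moreover have "k (\<sigma> t) (u t) (v t) \<in> V \<inter> {x. \<forall>i\<ge>n. x i = 0}" if "t \<in> topspace T" for t
      using in_D[OF that] DV Vsub unfolding topspace_Euclidean_space by blast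
    ultimately have "continuous_map T (subtopology ?E V) (\<lambda>t. k (\<sigma> t) (u t) (v t))"
      unfolding Euclidean_space_def continuous_map_in_subtopology image_subset_iff by blast
    from continuous_map_compose[OF this homeomorphic_imp_continuous_map[OF hh]]
    have "continuous_map T Y (\<lambda>t. h (k (\<sigma> t) (u t) (v t)))"
      by (simp add: o_def continuous_map_in_subtopology)
    moreover have "h (k (\<sigma> t) (u t) (v t)) \<in> B" if "t \<in> topspace T" for t
      using in_D[OF that] by (simp add: B_def)
    ultimately show ?thesis by (auto simp: continuous_map_in_subtopology)
  qed
  have fcont: "continuous_map (subtopology Y B) (subtopology ?E D) f"
  proof -
    have "continuous_map (subtopology Y U) ?E f"
      using homeomorphic_imp_continuous_map[OF hf] by (simp add: continuous_map_in_subtopology)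
    then have "continuous_map (subtopology Y B) ?E f"
      using BW continuous_map_from_subtopology_mono by blast
    then show ?thesis using fBD by (auto simp: continuous_map_in_subtopology)
  qed
  have k0: "k 0 x z = x" and k1: "k 1 x z = z" for x z by (auto simp: k_def)
  have Bsub: "B \<subseteq> topspace Y" using BW Usub by blast
  show thesis
  proof
    show "openin Y B" by (rule B)
    show "y \<in> B" using fyD hfx[OF UV(2)] by (force simp: B_def)
    show "B \<subseteq> W" using BW by blast
    show "path_connectedin Y B"
      unfolding path_connectedin_def path_connected_space_def
    proof (intro conjI Bsub ballI)
      fix x z assume "x \<in> topspace (subtopology Y B)" "z \<in> topspace (subtopology Y B)"
      then have xz: "x \<in> B" "z \<in> B" by auto
      have fx: "f x \<in> topspace ?E" "f z \<in> topspace ?E" using fBD[OF xz(1)] fBD[OF xz(2)] by (auto simp: D_def)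
      have c1: "continuous_map unit_square (subtopology Y B) (\<lambda>t. h (k (fst t) (f x) (f z)))"
        by (rule cont) (use fBD xz fx in \<open>auto simp: continuous_map_in_subtopology intro!: continuous_intros\<close>)
      \<comment> \<open>\<open>cont\<close> speaks of parameter spaces of pairs, so the path is the
        restriction of a map of the square to one edge.\<close>
      have c2: "continuous_map (top_of_set {0..1}) unit_square (\<lambda>t. (t, 0))"
        by (auto simp: continuous_map_in_subtopology intro!: continuous_intros)
      have "continuous_map (top_of_set {0..1}) (subtopology Y B) ((\<lambda>t. h (k (fst t) (f x) (f z))) \<circ> (\<lambda>t. (t, 0::real)))"
        by (rule continuous_map_compose[OF c2 c1])
      then have "pathin (subtopology Y B) (\<lambda>t. h (k t (f x) (f z)))" by (simp add: pathin_def o_def)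
      moreover have "h (f x) = x" "h (f z) = z" using xz BW hfx by auto
      ultimately show "\<exists>g. pathin (subtopology Y B) g \<and> g 0 = x \<and> g 1 = z"
        using k0 k1 by (intro exI[of _ "\<lambda>t. h (k t (f x) (f z))"]) simp
    qed
    fix a g assume "loop_at (subtopology Y B) a g"
    then have g: "pathin (subtopology Y B) g" "g 0 = a" "g 1 = a" by (auto simp: loop_at_def)
    have gB: "g t \<in> B" if "t \<in> {0..1}" for t using pathin_in_topspace[OF g(1) that] by simp
    have a: "a \<in> B" using gB[of 0] g(2) by simp
    have fa: "f a \<in> topspace ?E" using fBD[OF a] by (simp add: D_def)
    have "continuous_map unit_square (subtopology Y B) (\<lambda>z. h (k (fst z) ((f \<circ> g \<circ> snd) z) (f a)))"
    proof (rule cont)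
      show "continuous_map unit_square (top_of_set {0..1}) fst"
        by (auto simp: continuous_map_in_subtopology intro!: continuous_intros)
      have "continuous_map unit_square (top_of_set {0..1}) snd"
        by (auto simp: continuous_map_in_subtopology intro!: continuous_intros)
      from continuous_map_compose[OF this g(1)[unfolded pathin_def]]
      have "continuous_map unit_square (subtopology Y B) (g \<circ> snd)" .
      from continuous_map_compose[OF this fcont]
      show "continuous_map unit_square (subtopology ?E D) (f \<circ> g \<circ> snd)" by (simp add: o_assoc)
      show "continuous_map unit_square (subtopology ?E D) (\<lambda>z. f a)"
        using fa fBD[OF a] by (simp add: continuous_map_in_subtopology)
    qed
    then have c: "continuous_map unit_square Y (\<lambda>z. h (k (fst z) ((f \<circ> g \<circ> snd) z) (f a)))"
      by (simp add: continuous_map_in_subtopology)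
    have kaa: "k s (f a) (f a) = f a" for s by (auto simp: k_def algebra_simps)
    have hfB: "h (f x) = x" if "x \<in> B" for x using that BW hfx by blast
    show "loop_homotopic Y a g (\<lambda>t. a)"
      by (rule loop_homotopicI[OF c]) (use g gB hfB a in \<open>simp_all add: k0 k1 kaa\<close>)
  qed
qed

text \<open>A path over \<open>B\<close> between two points of one fiber projects to a loop in
  \<open>B\<close>. That loop lifts like the constant one, so the path returns to its start.\<close>

lemma null_homotopic_good_over:
  assumes cov: "covering_map X Y p" and Y: "compact_space Y" "Hausdorff_space Y" "locally_path_connected_space Y"
    and null: "\<And>a g. loop_at (subtopology Y B) a g \<Longrightarrow> loop_homotopic Y a g (\<lambda>t. a)"
  shows "good_over X p B"
  unfolding good_over_def
proof (intro allI impI)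
  fix e e' assume path: "path_component_of (subtopology X {z. p z \<in> B}) e e'" and eq: "p e = p e'"
  obtain d where d: "pathin (subtopology X {z. p z \<in> B}) d" "d 0 = e" "d 1 = e'"
    using path by (auto simp: path_component_of_def)
  then have dX: "pathin X d" "\<And>t. t \<in> {0..1} \<Longrightarrow> p (d t) \<in> B" by (auto simp: pathin_subtopology)
  have "loop_at (subtopology Y B) (p e) (\<lambda>t. p (d t))"
    using d eq dX pathin_continuous_image[OF dX(1) covering_map_continuous[OF cov]]
    by (auto simp: loop_at_def pathin_subtopology)
  then have hom: "loop_homotopic Y (p e) (\<lambda>t. p (d t)) (\<lambda>t. p e)" by (rule null)
  have "lifts_to X p (\<lambda>t. p (d t)) e e'" using dX d unfolding lifts_to_def by blast
  then have 1: "lifts_to X p (\<lambda>t. p e) e e'" by (rule loop_homotopic_lifts_to[OF cov Y hom])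
  have "e \<in> topspace X" using path_start_in_topspace[OF dX(1)] d(2) by simp
  then have "lifts_to X p (\<lambda>t. p e) e e" by (intro lifts_to_const) auto
  with 1 show "e = e'" using lifts_to_unique[OF cov] by metis
qed

lemma closed_manifold_locally_path_connected:
  assumes "closed_manifold Y"
  shows "locally_path_connected_space Y"
proof -
  obtain n where "locally_Euclidean_dim n Y" using assms by (auto simp: closed_manifold_def)
  then show ?thesis unfolding locally_path_connected_space
    using manifold_simply_connected_basis[of n Y] by metis
qed

text \<open>The set \<open>B\<close> is found in the manifold alone, before any covering is looked
  at; therefore one \<open>B\<close> is good for all coverings of the family simultaneously.\<close>

lemma closed_manifold_good_basis:
  assumes Y: "closed_manifold Y" and cov: "\<And>i. covering_map (T i) Y (r i)"
    and W: "openin Y W" "y \<in> W"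
  obtains B where "openin Y B" "y \<in> B" "B \<subseteq> W" "path_connectedin Y B" "\<And>i. good_over (T i) (r i) B"
proof -
  obtain n where n: "locally_Euclidean_dim n Y" using Y by (auto simp: closed_manifold_def)
  obtain B where B: "openin Y B" "y \<in> B" "B \<subseteq> W" "path_connectedin Y B"
    "\<And>a g. loop_at (subtopology Y B) a g \<Longrightarrow> loop_homotopic Y a g (\<lambda>t. a)"
    by (rule manifold_simply_connected_basis[OF n W]) blast
  have "good_over (T i) (r i) B" for i
    by (rule null_homotopic_good_over[OF cov])
      (use Y B(5) closed_manifold_locally_path_connected in \<open>auto simp: closed_manifold_def\<close>)
  with B(1-4) show thesis by (rule that)
qed


section \<open>Group chains with finite discriminant\<close>

context group
begin

lemma inv_mult_cancel: "g \<in> carrier G \<Longrightarrow> h \<in> carrier G \<Longrightarrow> inv g \<otimes> (g \<otimes> h) = h"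
  and mult_inv_cancel: "g \<in> carrier G \<Longrightarrow> h \<in> carrier G \<Longrightarrow> g \<otimes> (inv g \<otimes> h) = h"
  by (simp_all flip: m_assoc)

lemma conjugate_subgroup_iff:
  assumes H: "H \<subseteq> carrier G" and g: "g \<in> carrier G"
  shows "k \<in> conjugate_subgroup G g H \<longleftrightarrow> k \<in> carrier G \<and> inv g \<otimes> k \<otimes> g \<in> H"
proof
  assume "k \<in> conjugate_subgroup G g H"
  then obtain h where h: "h \<in> H" "k = g \<otimes> h \<otimes> inv g"
    by (auto simp: conjugate_subgroup_def l_coset_def r_coset_def)
  then have hc: "h \<in> carrier G" using H by blast
  have "inv g \<otimes> (g \<otimes> h \<otimes> inv g) \<otimes> g = h"
    using hc g by (simp add: m_assoc inv_mult_cancel)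
  then show "k \<in> carrier G \<and> inv g \<otimes> k \<otimes> g \<in> H" using h hc g by simp
next
  assume k: "k \<in> carrier G \<and> inv g \<otimes> k \<otimes> g \<in> H"
  have "k = g \<otimes> (inv g \<otimes> k \<otimes> g) \<otimes> inv g" using k g by (simp add: m_assoc mult_inv_cancel)
  then show "k \<in> conjugate_subgroup G g H"
    using k by (auto simp: conjugate_subgroup_def l_coset_def r_coset_def)
qed

lemma normal_core_iff:
  assumes "H \<subseteq> carrier G"
  shows "k \<in> normal_core G H \<longleftrightarrow> k \<in> carrier G \<and> (\<forall>g \<in> carrier G. inv g \<otimes> k \<otimes> g \<in> H)"
  unfolding normal_core_def using conjugate_subgroup_iff[OF assms] one_closed by blast

lemma normal_core_mono:
  assumes "H \<subseteq> K" "K \<subseteq> carrier G"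
  shows "normal_core G H \<subseteq> normal_core G K"
proof
  fix k assume "k \<in> normal_core G H"
  then show "k \<in> normal_core G K"
    using normal_core_iff[OF assms(2)] normal_core_iff[OF order_trans[OF assms]] assms(1) by blast
qed

lemma subgroup_normal_core:
  assumes H: "subgroup H G"
  shows "subgroup (normal_core G H) G"
proof -
  note Hc = subgroup.subset[OF H]
  note iff = normal_core_iff[OF Hc]
  show ?thesis
  proof (rule subgroupI)
    show "normal_core G H \<subseteq> carrier G" using iff by blast
    have "\<one> \<in> normal_core G H" unfolding iff using subgroup.one_closed[OF H] by simp
    then show "normal_core G H \<noteq> {}" by blast
  next
    fix a assume "a \<in> normal_core G H"
    then have a: "a \<in> carrier G" "\<And>g. g \<in> carrier G \<Longrightarrow> inv g \<otimes> a \<otimes> g \<in> H" by (auto simp: iff)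
    have "inv g \<otimes> inv a \<otimes> g \<in> H" if g: "g \<in> carrier G" for g
    proof -
      have "inv (inv g \<otimes> a \<otimes> g) = inv g \<otimes> inv a \<otimes> g" using g a(1) by (simp add: inv_mult_group m_assoc)
      then show ?thesis using subgroup.m_inv_closed[OF H a(2)[OF g]] by simp
    qed
    then show "inv a \<in> normal_core G H" using a(1) by (simp add: iff)
    fix b assume "b \<in> normal_core G H"
    then have b: "b \<in> carrier G" "\<And>g. g \<in> carrier G \<Longrightarrow> inv g \<otimes> b \<otimes> g \<in> H" by (auto simp: iff)
    have "inv g \<otimes> (a \<otimes> b) \<otimes> g \<in> H" if g: "g \<in> carrier G" for g
    proof -
      have "(inv g \<otimes> a \<otimes> g) \<otimes> (inv g \<otimes> b \<otimes> g) = inv g \<otimes> (a \<otimes> b) \<otimes> g"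
        using g a(1) b(1) by (simp add: m_assoc mult_inv_cancel)
      then show ?thesis using subgroup.m_closed[OF H a(2)[OF g] b(2)[OF g]] by simp
    qed
    then show "a \<otimes> b \<in> normal_core G H" using a(1) b(1) by (simp add: iff)
  qed
qed

text \<open>An invariant that separates the cosets of \<open>K\<close> and takes finitely many
  values bounds their number; one representative is chosen per value.\<close>

lemma rcosets_finite_by_invariant:
  assumes K: "subgroup K G" and fin: "finite F" and into: "\<And>g. g \<in> carrier G \<Longrightarrow> \<phi> g \<in> F"
    and inv: "\<And>g h. g \<in> carrier G \<Longrightarrow> h \<in> carrier G \<Longrightarrow> \<phi> g = \<phi> h \<Longrightarrow> g \<otimes> inv h \<in> K"
  shows "finite (rcosets K)"
proof -
  define C where "C = (\<lambda>e. K #> (SOME g. g \<in> carrier G \<and> \<phi> g = e))"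
  have "rcosets K \<subseteq> C ` F"
  proof
    fix R assume "R \<in> rcosets K"
    then obtain g where g: "g \<in> carrier G" "R = K #> g" by (auto simp: RCOSETS_def)
    define h where "h = (SOME h. h \<in> carrier G \<and> \<phi> h = \<phi> g)"
    have h: "h \<in> carrier G \<and> \<phi> h = \<phi> g" unfolding h_def by (rule someI[of _ g]) (simp add: g)
    have "g \<in> K #> h"
      by (rule subgroup.rcos_module_rev[OF K is_group]) (use g h inv in auto)
    from repr_independence[OF this _ K] have "R = C (\<phi> g)" using h g by (simp add: C_def h_def)
    then show "R \<in> C ` F" using into[OF g(1)] by blast
  qed
  then show ?thesis using fin finite_subset by blast
qed

text \<open>The core is the kernel of the right translation action on the cosets of
  \<open>H\<close>, and a finite set has only finitely many permutations. Translations are encoded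
  as extensional functions to make that count available.\<close>

lemma finite_rcosets_normal_core:
  assumes H: "subgroup H G" and fin: "finite (rcosets H)"
  shows "finite (rcosets (normal_core G H))"
proof (rule rcosets_finite_by_invariant[OF subgroup_normal_core[OF H]])
  note Hc = subgroup.subset[OF H]
  let ?F = "PiE (rcosets H) (\<lambda>_. rcosets H)"
  let ?\<phi> = "\<lambda>g. \<lambda>R \<in> rcosets H. R #> g"
  show "finite ?F" using fin by (intro finite_PiE) auto
  show "?\<phi> g \<in> ?F" if g: "g \<in> carrier G" for g
    using g by (auto simp: RCOSETS_def coset_mult_assoc[OF Hc])
  fix g h assume g: "g \<in> carrier G" and h: "h \<in> carrier G" and eq: "?\<phi> g = ?\<phi> h"
  have "inv x \<otimes> (g \<otimes> inv h) \<otimes> x \<in> H" if x: "x \<in> carrier G" for x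
  proof -
    have "H #> inv x \<in> rcosets H" using x by (auto simp: RCOSETS_def)
    then have "(H #> inv x) #> g = (H #> inv x) #> h" using fun_cong[OF eq, of "H #> inv x"] by simp
    then have "H #> (inv x \<otimes> g) = H #> (inv x \<otimes> h)" using x g h by (simp add: coset_mult_assoc[OF Hc])
    then have "inv x \<otimes> g \<in> H #> (inv x \<otimes> h)" using rcos_self[OF _ H, of "inv x \<otimes> g"] x g by simp
    then have "(inv x \<otimes> g) \<otimes> inv (inv x \<otimes> h) \<in> H"
      by (intro subgroup.rcos_module_imp[OF H is_group]) (use x h in auto)
    then show ?thesis using x g h by (simp add: inv_mult_group m_assoc)
  qed
  then show "g \<otimes> inv h \<in> normal_core G H" using g h by (simp add: normal_core_iff[OF Hc])
qed

text \<open>Evaluates the bonding maps of the discriminant group on a coset with a given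
  representative.\<close>

lemma subgroup_set_mult_coset:
  assumes N: "subgroup N G" and N': "subgroup N' G" and sub: "N' \<subseteq> N" and g: "g \<in> carrier G"
  shows "N <#> (N' #> g) = N #> g"
proof
  show "N <#> (N' #> g) \<subseteq> N #> g"
  proof
    fix z assume "z \<in> N <#> (N' #> g)"
    then obtain a b where ab: "a \<in> N" "b \<in> N'" "z = a \<otimes> (b \<otimes> g)" by (auto simp: set_mult_def r_coset_def)
    then have "z = (a \<otimes> b) \<otimes> g" "a \<otimes> b \<in> N"
      using g sub subgroup.mem_carrier[OF N] subgroup.m_closed[OF N] by (auto simp: m_assoc)
    then show "z \<in> N #> g" by (auto simp: r_coset_def)
  qed
  show "N #> g \<subseteq> N <#> (N' #> g)"
  proof
    fix z assume "z \<in> N #> g"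
    then obtain a where a: "a \<in> N" "z = a \<otimes> g" by (auto simp: r_coset_def)
    then show "z \<in> N <#> (N' #> g)"
      using rcos_self[OF g N'] by (auto simp: set_mult_def)
  qed
qed

lemma rcosets_eq_iff_mem:
  assumes N: "subgroup N G" and g: "g \<in> carrier G" and k: "k \<in> N #> g"
  shows "N #> g = N #> k"
  by (rule repr_independence[OF k g N])

text \<open>By compactness a failure at one level \<open>m\<close> for all \<open>i\<close> would yield a nontrivial element of the
  discriminant group that is trivial at level \<open>n\<close>.\<close>

lemma finite_discriminant_core:
  assumes sub: "\<And>i. subgroup (Gs i) G" and fin: "\<And>i. finite (rcosets (Gs i))"
    and dec: "\<And>i. Gs (Suc i) \<subseteq> Gs i"
    and disc: "finite (carrier (discriminant_group G Gs))"
  shows "\<exists>n. \<forall>m. \<exists>i. Gs i \<inter> normal_core G (Gs n) \<subseteq> normal_core G (Gs m)"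
proof -
  define C where "C = (\<lambda>i. normal_core G (Gs i))"
  note Gc = subgroup.subset[OF sub]
  have C: "subgroup (C i) G" for i unfolding C_def by (rule subgroup_normal_core[OF sub])
  have Cdec: "C (Suc i) \<subseteq> C i" for i unfolding C_def by (rule normal_core_mono[OF dec Gc])
  have Cle: "C j \<subseteq> C i" if "i \<le> j" for i j using lift_Suc_antimono_le[of C, OF Cdec that] .
  have Gle: "Gs j \<subseteq> Gs i" if "i \<le> j" for i j using lift_Suc_antimono_le[of Gs, OF dec that] .
  \<comment> \<open>The underlying set of the i-th quotient, the cosets of \<open>C i\<close> that
    lie in \<open>Gs i\<close>.\<close>
  define R where "R = (\<lambda>i. (\<lambda>g. C i #> g) ` Gs i)"
  have finR: "finite (R i)" for i
  proof (rule finite_subset)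
    show "R i \<subseteq> rcosets (C i)" using Gc by (auto simp: R_def RCOSETS_def)
    show "finite (rcosets (C i))" unfolding C_def by (rule finite_rcosets_normal_core[OF sub fin])
  qed
  define D where "D = {f. (\<forall>i. f i \<in> R i) \<and> (\<forall>i. C i <#> f (Suc i) = f i)}"
  have D: "carrier (discriminant_group G Gs) = D"
    by (auto simp: D_def R_def C_def discriminant_group_def inverse_limit_group_def carrier_FactGroup PiE_iff)
  have CC: "C i <#> C (Suc i) = C i" for i
    using subgroup_set_mult_coset[OF C C Cdec one_closed, of i] subgroup.subset[OF C] by simp
  have down: "f i = C i" if f: "f \<in> D" "f n = C n" "i \<le> n" for f i n
    using f(3,2)
  proof (induction n arbitrary: i)
    case (Suc n)
    have "C n <#> f (Suc n) = f n" using f(1) unfolding D_def by blast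
    then have "f n = C n" unfolding Suc.prems(2) CC by simp
    then show ?case using Suc by (cases "i = Suc n") auto
  qed simp
  define e where "e = (\<lambda>i. C i)"
  have "\<forall>f \<in> D - {e}. \<exists>i. f i \<noteq> C i" by (auto simp: e_def)
  then obtain l where l: "\<And>f. f \<in> D - {e} \<Longrightarrow> f (l f) \<noteq> C (l f)" by metis
  have finD: "finite (l ` (D - {e}))" using disc D by simp
  \<comment> \<open>A thread other than the identity \<open>e\<close> is nontrivial at its level
    \<open>l f\<close>. A thread trivial at level \<open>n\<close> is trivial at all lower levels,
    so a level beyond all the finitely many \<open>l f\<close> detects every thread but
    \<open>e\<close>.\<close>
  define n where "n = Max (insert 0 (l ` (D - {e})))"
  have triv: "f = e" if "f \<in> D" "f n = C n" for f
  proof (rule ccontr)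
    assume "f \<noteq> e"
    then have f: "f \<in> D - {e}" using that by simp
    have "l f \<le> n" unfolding n_def using f finD by (intro Max_ge) auto
    then show False using down[OF that] l[OF f] by simp
  qed
  have "\<exists>i. Gs i \<inter> C n \<subseteq> C m" for m
  proof (rule ccontr)
    assume "\<nexists>i. Gs i \<inter> C n \<subseteq> C m"
    then have "\<forall>i. \<exists>k. k \<in> Gs i \<and> k \<in> C n \<and> k \<notin> C m" by blast
    then obtain k where k: "\<And>i. k i \<in> Gs i" "\<And>i. k i \<in> C n" "\<And>i. k i \<notin> C m" by metis
    have kc: "k i \<in> carrier G" for i using k(1) Gc by blast
    \<comment> \<open>Pigeonhole: all but the first \<open>j\<close> members of the sequence
      \<open>k\<close> lie in \<open>Gs j\<close>, which consists of finitely many cosets of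
      \<open>C j\<close>.\<close>
    have split: "\<exists>B \<in> R j. infinite {i \<in> I. k i \<in> B}" if I: "infinite I" for j I
    proof (rule ccontr)
      assume no: "\<not> (\<exists>B \<in> R j. infinite {i \<in> I. k i \<in> B})"
      have "I \<subseteq> {..<j} \<union> (\<Union>B\<in>R j. {i \<in> I. k i \<in> B})"
      proof
        fix i assume i: "i \<in> I"
        show "i \<in> {..<j} \<union> (\<Union>B\<in>R j. {i \<in> I. k i \<in> B})"
        proof (cases "i < j")
          case False
          then have "k i \<in> Gs j" using k(1) Gle[of j i] by auto
          then have "C j #> k i \<in> R j" by (auto simp: R_def)
          moreover have "k i \<in> C j #> k i" by (rule rcos_self[OF kc C])
          ultimately show ?thesis using i by blast
        qed simp
      qed
      moreover have "finite ({..<j} \<union> (\<Union>B\<in>R j. {i \<in> I. k i \<in> B}))" using finR no by blast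
      ultimately show False using I finite_subset by blast
    qed
    \<comment> \<open>The Koenig argument: descend through cosets each of which contains
      \<open>k i\<close> for infinitely many \<open>i\<close>. Two consecutive cosets share a member
      of the sequence, which makes the choice compatible with the bonding maps.\<close>
    have "\<exists>f. \<forall>j. (f j \<in> R j \<and> infinite {i. k i \<in> f j}) \<and> C j <#> f (Suc j) = f j"
    proof (rule dependent_nat_choice)
      show "\<exists>B. B \<in> R 0 \<and> infinite {i. k i \<in> B}" using split[of UNIV 0] by auto
      fix B j assume B: "B \<in> R j \<and> infinite {i. k i \<in> B}"
      then obtain B' where B': "B' \<in> R (Suc j)" "infinite {i \<in> {i. k i \<in> B}. k i \<in> B'}"
        using split[of "{i. k i \<in> B}" "Suc j"] by blast
      from infinite_imp_nonempty[OF B'(2)] obtain i where i: "k i \<in> B" "k i \<in> B'" by auto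
      have "infinite {i. k i \<in> B'}" by (rule infinite_super[OF _ B'(2)]) auto
      obtain g where g: "g \<in> Gs j" "B = C j #> g" using B by (auto simp: R_def)
      obtain g' where g': "g' \<in> Gs (Suc j)" "B' = C (Suc j) #> g'" using B'(1) by (auto simp: R_def)
      have gc: "g \<in> carrier G" "g' \<in> carrier G" using g(1) g'(1) Gc by blast+
      have "B = C j #> k i" unfolding g(2) by (rule rcosets_eq_iff_mem[OF C gc(1) i(1)[unfolded g(2)]])
      moreover have "B' = C (Suc j) #> k i"
        unfolding g'(2) by (rule rcosets_eq_iff_mem[OF C gc(2) i(2)[unfolded g'(2)]])
      ultimately have "C j <#> B' = B" using subgroup_set_mult_coset[OF C C Cdec kc] by simp
      with B'(1) \<open>infinite {i. k i \<in> B'}\<close>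
      show "\<exists>y. (y \<in> R (Suc j) \<and> infinite {i. k i \<in> y}) \<and> C j <#> y = B" by blast
    qed
    then obtain f where f: "\<And>j. f j \<in> R j" "\<And>j. infinite {i. k i \<in> f j}" "\<And>j. C j <#> f (Suc j) = f j"
      by blast
    have fD: "f \<in> D" using f by (simp add: D_def)
    have fk: "\<exists>i. f j = C j #> k i" for j
    proof -
      obtain i where i: "k i \<in> f j" using infinite_imp_nonempty[OF f(2)] by blast
      obtain g where g: "g \<in> Gs j" "f j = C j #> g" using f(1)[of j] by (auto simp: R_def)
      then have "f j = C j #> k i" using rcosets_eq_iff_mem[OF C subsetD[OF Gc g(1)]] i by simp
      then show ?thesis by (rule exI)
    qed
    \<comment> \<open>All members of the sequence lie in \<open>C n\<close>, so the thread is
      trivial at level \<open>n\<close> and hence equals \<open>e\<close>; at level \<open>m\<close>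
      however its coset contains a member outside \<open>C m\<close>.\<close>
    obtain i where "f n = C n #> k i" using fk by blast
    then have "f n = C n" using coset_join2[OF kc C k(2)] by simp
    then have "f = e" using triv fD by blast
    obtain i where "f m = C m #> k i" using fk by blast
    then have "k i \<in> f m" using rcos_self[OF kc C] by simp
    then show False using \<open>f = e\<close> k(3) by (simp add: e_def)
  qed
  then show ?thesis unfolding C_def by blast
qed

end

text \<open>Chains that are cofinal in each other are equivalent. Only \<open>B\<close> is assumed
  to be strictly decreasing, so every strict inclusion of the interlaced chain is gained by going
  one step further in \<open>B\<close>.\<close>

lemma chain_equivalent_interlace:
  assumes A0: "A 0 = carrier G" and A: "\<And>i. subgroup (A i) G" "\<And>i. finite (rcosets\<^bsub>G\<^esub> (A i))" "\<And>i. A (Suc i) \<subseteq> A i"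
    and B: "group_chain G B" and BA: "\<And>m. \<exists>i. B i \<subseteq> A m" and AB: "\<And>m. \<exists>i. A i \<subseteq> B m"
  shows "chain_equivalent G A B"
proof -
  have Bs: "B (Suc i) \<subset> B i" "subgroup (B i) G" "finite (rcosets\<^bsub>G\<^esub> (B i))" for i
    using B by (auto simp: group_chain_def)
  have Ble: "B j \<subseteq> B i" if "i \<le> j" for i j
    by (rule lift_Suc_antimono_le[of B, OF _ that]) (use Bs in blast)
  have Ale: "A j \<subseteq> A i" if "i \<le> j" for i j
    by (rule lift_Suc_antimono_le[of A, OF A(3) that])
  have b_ex: "\<exists>b>b0. B b \<subset> A m" for m b0
  proof -
    obtain i where i: "B i \<subseteq> A m" using BA by blast
    have "B (Suc (max i b0)) \<subset> B (max i b0)" by (rule Bs)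
    also have "\<dots> \<subseteq> B i" by (rule Ble) simp
    finally show ?thesis using i by (intro exI[of _ "Suc (max i b0)"]) auto
  qed
  have a_ex: "\<exists>a>a0. A a \<subset> B m" for m a0
  proof -
    obtain i where i: "A i \<subseteq> B (Suc m)" using AB by blast
    have "A (max i (Suc a0)) \<subseteq> A i" by (rule Ale) simp
    then show ?thesis using i Bs(1)[of m] by (intro exI[of _ "max i (Suc a0)"]) auto
  qed
  \<comment> \<open>\<open>c k\<close> is the pair of indices used in \<open>A\<close> and
    \<open>B\<close> at stage \<open>k\<close>. Starting with index 0 in \<open>A\<close> makes the
    interlaced chain begin with the whole group.\<close>
  have "\<exists>c. \<forall>k. (B (snd (c k)) \<subset> A (fst (c k)) \<and> (k = 0 \<longrightarrow> fst (c k) = 0)) \<and>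
      (fst (c k) < fst (c (Suc k)) \<and> snd (c k) < snd (c (Suc k)) \<and> A (fst (c (Suc k))) \<subset> B (snd (c k)))"
  proof (rule dependent_nat_choice)
    show "\<exists>c. B (snd c) \<subset> A (fst c) \<and> ((0::nat) = 0 \<longrightarrow> fst c = 0)"
      using b_ex[of 0 0] by (metis fst_conv snd_conv)
    fix c :: "nat \<times> nat" and k :: nat
    obtain a where a: "fst c < a" "A a \<subset> B (snd c)" using a_ex by blast
    obtain b where b: "snd c < b" "B b \<subset> A a" using b_ex by blast
    show "\<exists>c'. (B (snd c') \<subset> A (fst c') \<and> (Suc k = 0 \<longrightarrow> fst c' = 0)) \<and>
        (fst c < fst c' \<and> snd c < snd c' \<and> A (fst c') \<subset> B (snd c))"
      using a b by (intro exI[of _ "(a, b)"]) simp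
  qed
  then obtain c where cc: "\<forall>k. (B (snd (c k)) \<subset> A (fst (c k)) \<and> (k = 0 \<longrightarrow> fst (c k) = 0)) \<and>
      (fst (c k) < fst (c (Suc k)) \<and> snd (c k) < snd (c (Suc k)) \<and> A (fst (c (Suc k))) \<subset> B (snd (c k)))"
    by (elim exE)
  then have c: "B (snd (c k)) \<subset> A (fst (c k))" "fst (c 0) = 0"
    "fst (c k) < fst (c (Suc k))" "snd (c k) < snd (c (Suc k))"
    "A (fst (c (Suc k))) \<subset> B (snd (c k))" for k by simp_all
  define K where "K = (\<lambda>i. if even i then A (fst (c (i div 2))) else B (snd (c (i div 2))))"
  have "group_chain G K"
    unfolding group_chain_def
  proof (intro conjI allI)
    show "K 0 = carrier G" by (simp add: K_def c(2) A0)
    show "subgroup (K i) G" "finite (rcosets\<^bsub>G\<^esub> (K i))" for i using A Bs by (auto simp: K_def)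
    show "K (Suc i) \<subset> K i" for i
    proof (cases "even i")
      case True
      then show ?thesis using c(1) by (simp add: K_def)
    next
      case False
      then have "Suc i div 2 = Suc (i div 2)" by presburger
      then show ?thesis using False c(5) by (simp add: K_def)
    qed
  qed
  moreover have "strict_mono (\<lambda>k. fst (c k))" "strict_mono (\<lambda>k. snd (c k))"
    using c(3,4) by (auto simp: strict_mono_Suc_iff)
  moreover have "\<forall>k. K (2 * k) = A (fst (c k)) \<and> K (2 * k + 1) = B (snd (c k))" by (simp add: K_def)
  ultimately show ?thesis unfolding chain_equivalent_def by blast
qed

context group
begin

text \<open>If for some \<open>n\<close> every \<open>Gs m\<close> contains all conjugates by
  \<open>Gs n\<close> of some \<open>Gs i\<close>, then passing to such conjugates does not change
  the chain up to cofinality. Every chain conjugate equivalent to the truncation at \<open>n\<close>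
  is then equivalent to it.\<close>

lemma not_weakly_normal_chainD:
  assumes sub: "\<And>i. subgroup (Gs i) G" and fin: "\<And>i. finite (rcosets (Gs i))"
    and dec: "\<And>i. Gs (Suc i) \<subseteq> Gs i" and nwn: "\<not> weakly_normal_chain G Gs"
  shows "\<exists>m. \<forall>i. \<exists>k \<in> Gs i. \<exists>g \<in> Gs n. inv g \<otimes> k \<otimes> g \<notin> Gs m"
proof (rule ccontr)
  assume "\<not> ?thesis"
  then have hyp: "\<exists>i. \<forall>k \<in> Gs i. \<forall>g \<in> Gs n. inv g \<otimes> k \<otimes> g \<in> Gs m" for m by blast
  have Gle: "Gs j \<subseteq> Gs i" if "i \<le> j" for i j using lift_Suc_antimono_le[of Gs, OF dec that] .
  note Gc = subgroup.subset[OF sub]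
  define G0 where "G0 = G\<lparr>carrier := Gs n\<rparr>"
  define Gt where "Gt = (\<lambda>i. Gs (n + i))"
  have "chain_equivalent G0 Gt Hs"
    if Hs: "group_chain G0 Hs" and conj: "chain_conjugate_equivalent G0 Gt Hs" for Hs
  proof -
    obtain g where g: "\<And>i. g i \<in> Gs n" "chain_equivalent G0 (\<lambda>i. conjugate_subgroup G0 (g i) (Gt i)) Hs"
      using conj unfolding chain_conjugate_equivalent_def by (auto simp: G0_def)
    then obtain Ks a b where K: "group_chain G0 Ks" "strict_mono a" "strict_mono b"
      "\<And>k. Ks (2 * k) = conjugate_subgroup G0 (g (a k)) (Gt (a k))" "\<And>k. Ks (2 * k + 1) = Hs (b k)"
      unfolding chain_equivalent_def by blast
    have conj_eq: "conjugate_subgroup G0 x H = conjugate_subgroup G x H" if "x \<in> Gs n" for x H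
      using m_inv_consistent[OF sub that] by (simp add: conjugate_subgroup_def G0_def)
    have gc: "g i \<in> carrier G" for i using g(1) Gc by blast
    have K2: "k \<in> Ks (2 * l) \<longleftrightarrow> k \<in> carrier G \<and> inv (g (a l)) \<otimes> k \<otimes> g (a l) \<in> Gs (n + a l)" for k l
      unfolding K(4) conj_eq[OF g(1)] Gt_def by (rule conjugate_subgroup_iff[OF Gc gc])
    have Kdec: "Ks (Suc i) \<subseteq> Ks i" for i using K(1) by (auto simp: group_chain_def)
    have Hdec: "Hs (Suc i) \<subseteq> Hs i" for i using Hs by (auto simp: group_chain_def)
    have BA: "\<exists>i. Hs i \<subseteq> Gt m" for m
    proof -
      obtain i where i: "\<forall>k \<in> Gs i. \<forall>x \<in> Gs n. inv x \<otimes> k \<otimes> x \<in> Gs (n + m)" using hyp by blast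
      have "i \<le> a i" by (rule strict_mono_imp_increasing[OF K(2)])
      have "Hs (b i) \<subseteq> Gt m"
      proof
        fix k assume "k \<in> Hs (b i)"
        then have "k \<in> Ks (2 * i)" using Kdec[of "2 * i"] K(5)[of i] by auto
        then have k: "k \<in> carrier G" "inv (g (a i)) \<otimes> k \<otimes> g (a i) \<in> Gs (n + a i)" by (auto simp: K2)
        moreover have "Gs (n + a i) \<subseteq> Gs i" using \<open>i \<le> a i\<close> by (intro Gle) simp
        moreover have "inv (g (a i)) \<in> Gs n" using subgroup.m_inv_closed[OF sub g(1)] .
        \<comment> \<open>The assumption is applied to the inverse of the conjugating element, which
          carries the conjugate of \<open>k\<close> back to \<open>k\<close>.\<close>
        ultimately have "inv (inv (g (a i))) \<otimes> (inv (g (a i)) \<otimes> k \<otimes> g (a i)) \<otimes> inv (g (a i)) \<in> Gs (n + m)"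
          using i by blast
        moreover have "inv (inv (g (a i))) \<otimes> (inv (g (a i)) \<otimes> k \<otimes> g (a i)) \<otimes> inv (g (a i)) = k"
          using k(1) gc by (simp add: m_assoc mult_inv_cancel)
        ultimately show "k \<in> Gt m" by (simp add: Gt_def)
      qed
      then show ?thesis by blast
    qed
    have AB: "\<exists>i. Gt i \<subseteq> Hs m" for m
    proof -
      \<comment> \<open>In the interlaced chain \<open>Hs (b m)\<close> stands at position 2m+1,
        just above the conjugate of index m+1.\<close>
      let ?l = "Suc m"
      obtain i where i: "\<forall>k \<in> Gs i. \<forall>x \<in> Gs n. inv x \<otimes> k \<otimes> x \<in> Gs (n + a ?l)" using hyp by blast
      have "Gt i \<subseteq> Ks (2 * ?l)"
      proof
        fix k assume "k \<in> Gt i"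
        then have "k \<in> Gs i" "k \<in> carrier G" using Gle[of i "n + i"] Gc by (auto simp: Gt_def)
        then show "k \<in> Ks (2 * ?l)" using i g(1) unfolding K2 by blast
      qed
      also have "\<dots> \<subseteq> Ks (2 * m + 1)" using Kdec[of "2 * m + 1"] by simp
      also have "\<dots> = Hs (b m)" by (rule K(5))
      also have "\<dots> \<subseteq> Hs m" using lift_Suc_antimono_le[of Hs, OF Hdec strict_mono_imp_increasing[OF K(3)]] .
      finally show ?thesis by blast
    qed
    show ?thesis
    proof (rule chain_equivalent_interlace[OF _ _ _ _ Hs BA AB])
      show "Gt 0 = carrier G0" by (simp add: Gt_def G0_def)
      show "subgroup (Gt i) G0" for i
        unfolding Gt_def G0_def by (rule subgroup_incl[OF sub sub Gle]) simp
      show "finite (rcosets\<^bsub>G0\<^esub> (Gt i))" for i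
      proof (rule finite_subset[OF _ fin[of "n + i"]])
        show "rcosets\<^bsub>G0\<^esub> (Gt i) \<subseteq> rcosets (Gs (n + i))"
          using Gc by (auto simp: RCOSETS_def G0_def Gt_def)
      qed
      show "Gt (Suc i) \<subseteq> Gt i" for i using dec by (simp add: Gt_def)
    qed
  qed
  then have "weakly_normal_chain G Gs"
    unfolding weakly_normal_chain_def Let_def G0_def Gt_def by blast
  with nwn show False by blast
qed

end


section \<open>A topological invariant of solenoids\<close>

text \<open>The correction \<open>s\<close> is needed because close paths need not be parallel; being short, it moves
  along the leaf only.\<close>

definition stable_return :: "'a topology \<Rightarrow> bool" where
  "stable_return X \<longleftrightarrow>
     (\<forall>N2. entourage X N2 \<longrightarrow> (\<exists>N1. entourage X N1 \<and> (\<forall>N. entourage X N \<longrightarrow> (\<exists>N3. entourage X N3 \<and>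
        (\<forall>c c'. pathin X c \<and> pathin X c' \<and> (\<forall>t \<in> {0..1}. (c t, c' t) \<in> N1) \<and> (c 0, c 1) \<in> N3 \<longrightarrow>
           (\<exists>s. pathin X s \<and> s 0 = c' 1 \<and> (\<forall>t \<in> {0..1}. (c' 1, s t) \<in> N2) \<and> (s 1, c' 0) \<in> N))))))"

text \<open>Entourages pull back along continuous maps: the given \<open>N2\<close> and
  \<open>N\<close> are taken to \<open>X\<close> by \<open>f\<close>, the resulting
  \<open>N1\<close> and \<open>N3\<close> to \<open>Y\<close> by \<open>g\<close>, and the
  correction found in \<open>X\<close> is mapped by \<open>f\<close>.\<close>

lemma stable_return_homeomorphic:
  assumes hom: "X homeomorphic_space Y" and X: "stable_return X"
  shows "stable_return Y"
proof -
  obtain f g where f: "continuous_map X Y f" and g: "continuous_map Y X g"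
    and gf: "\<And>x. x \<in> topspace X \<Longrightarrow> g (f x) = x" and fg: "\<And>y. y \<in> topspace Y \<Longrightarrow> f (g y) = y"
    using hom unfolding homeomorphic_space_def homeomorphic_maps_def by blast
  define F where "F = (\<lambda>N. {(x, y). x \<in> topspace X \<and> y \<in> topspace X \<and> (f x, f y) \<in> N})"
  define H where "H = (\<lambda>N. {(x, y). x \<in> topspace Y \<and> y \<in> topspace Y \<and> (g x, g y) \<in> N})"
  have F: "entourage X (F N)" if "entourage Y N" for N
    unfolding F_def by (rule entourage_vimage[OF f that])
  have H: "entourage Y (H N)" if "entourage X N" for N
    unfolding H_def by (rule entourage_vimage[OF g that])
  show ?thesis unfolding stable_return_def
  proof (intro allI impI)
    fix N2 assume N2: "entourage Y N2"
    from X[unfolded stable_return_def, rule_format, OF F[OF N2]]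
    obtain N1 where N1: "entourage X N1" "\<And>N. entourage X N \<Longrightarrow> \<exists>N3. entourage X N3 \<and>
        (\<forall>c c'. pathin X c \<and> pathin X c' \<and> (\<forall>t \<in> {0..1}. (c t, c' t) \<in> N1) \<and> (c 0, c 1) \<in> N3 \<longrightarrow>
           (\<exists>s. pathin X s \<and> s 0 = c' 1 \<and> (\<forall>t \<in> {0..1}. (c' 1, s t) \<in> F N2) \<and> (s 1, c' 0) \<in> N))"
      by auto
    show "\<exists>N1. entourage Y N1 \<and> (\<forall>N. entourage Y N \<longrightarrow> (\<exists>N3. entourage Y N3 \<and>
        (\<forall>c c'. pathin Y c \<and> pathin Y c' \<and> (\<forall>t \<in> {0..1}. (c t, c' t) \<in> N1) \<and> (c 0, c 1) \<in> N3 \<longrightarrow>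
           (\<exists>s. pathin Y s \<and> s 0 = c' 1 \<and> (\<forall>t \<in> {0..1}. (c' 1, s t) \<in> N2) \<and> (s 1, c' 0) \<in> N))))"
    proof (rule exI[of _ "H N1"], intro conjI H N1(1) allI impI)
      fix N assume N: "entourage Y N"
      from N1(2)[OF F[OF N]] obtain N3 where N3: "entourage X N3"
        "\<And>c c'. pathin X c \<and> pathin X c' \<and> (\<forall>t \<in> {0..1}. (c t, c' t) \<in> N1) \<and> (c 0, c 1) \<in> N3 \<Longrightarrow>
           \<exists>s. pathin X s \<and> s 0 = c' 1 \<and> (\<forall>t \<in> {0..1}. (c' 1, s t) \<in> F N2) \<and> (s 1, c' 0) \<in> F N"
        by auto
      show "\<exists>N3. entourage Y N3 \<and>
        (\<forall>c c'. pathin Y c \<and> pathin Y c' \<and> (\<forall>t \<in> {0..1}. (c t, c' t) \<in> H N1) \<and> (c 0, c 1) \<in> N3 \<longrightarrow>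
           (\<exists>s. pathin Y s \<and> s 0 = c' 1 \<and> (\<forall>t \<in> {0..1}. (c' 1, s t) \<in> N2) \<and> (s 1, c' 0) \<in> N))"
      proof (rule exI[of _ "H N3"], intro conjI H N3(1) allI impI)
        fix c c' assume c: "pathin Y c \<and> pathin Y c' \<and> (\<forall>t \<in> {0..1}. (c t, c' t) \<in> H N1) \<and> (c 0, c 1) \<in> H N3"
        have "pathin X (\<lambda>t. g (c t)) \<and> pathin X (\<lambda>t. g (c' t)) \<and>
            (\<forall>t \<in> {0..1}. (g (c t), g (c' t)) \<in> N1) \<and> (g (c 0), g (c 1)) \<in> N3"
          using c pathin_continuous_image[OF _ g] by (auto simp: H_def)
        from N3(2)[OF this] obtain s where s: "pathin X s" "s 0 = g (c' 1)"
          "\<forall>t \<in> {0..1}. (g (c' 1), s t) \<in> F N2" "(s 1, g (c' 0)) \<in> F N" by blast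
        have "c' 0 \<in> topspace Y" "c' 1 \<in> topspace Y"
          using c path_start_in_topspace path_finish_in_topspace by blast+
        then have "f (g (c' 0)) = c' 0" "f (g (c' 1)) = c' 1" using fg by auto
        then have "pathin Y (\<lambda>t. f (s t)) \<and> f (s 0) = c' 1 \<and> (\<forall>t \<in> {0..1}. (c' 1, f (s t)) \<in> N2) \<and> (f (s 1), c' 0) \<in> N"
          using s pathin_continuous_image[OF s(1) f] by (auto simp: F_def)
        then show "\<exists>s. pathin Y s \<and> s 0 = c' 1 \<and> (\<forall>t \<in> {0..1}. (c' 1, s t) \<in> N2) \<and> (s 1, c' 0) \<in> N"
          by (intro exI[of _ "\<lambda>t. f (s t)"])
      qed
    qed
  qed
qed

text \<open>Used for two towers: the solenoid over \<open>M 0\<close>, and the pulled-back tower,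
  regarded as a tower over \<open>N\<close> by the second projections. \<open>good_basis\<close>
  carries the uniformity over all levels; it comes from the charts of \<open>M 0\<close> and
  survives the passage to \<open>N\<close>.\<close>

locale covering_tower =
  fixes Y :: "'y topology" and T :: "nat \<Rightarrow> 't topology" and \<phi> :: "nat \<Rightarrow> 't \<Rightarrow> 't" and r :: "nat \<Rightarrow> 't \<Rightarrow> 'y"
  assumes Y_compact: "compact_space Y" and Y_Hausdorff: "Hausdorff_space Y"
    and cov: "\<And>i. finite_covering_map (T i) Y (r i)"
    and \<phi>: "\<And>i. continuous_map (T (Suc i)) (T i) (\<phi> i)"
    and r_\<phi>: "\<And>i e. e \<in> topspace (T (Suc i)) \<Longrightarrow> r i (\<phi> i e) = r (Suc i) e"
    and good_basis: "\<And>W y. openin Y W \<Longrightarrow> y \<in> W \<Longrightarrow>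
      \<exists>B. openin Y B \<and> y \<in> B \<and> B \<subseteq> W \<and> path_connectedin Y B \<and> (\<forall>i. good_over (T i) (r i) B)"
begin

abbreviation "S \<equiv> inverse_limit_space T \<phi>"

abbreviation "\<rho> u \<equiv> r 0 (u 0)"

lemma covr: "covering_map (T i) Y (r i)"
  by (rule finite_covering_map_imp_covering_map[OF cov])

lemma Y_lpc: "locally_path_connected_space Y"
  unfolding locally_path_connected_space using good_basis by blast

lemma T_lpc: "locally_path_connected_space (T i)"
  by (rule covering_locally_path_connected[OF covr Y_lpc])

lemma topspace_S: "topspace S = {u. (\<forall>i. u i \<in> topspace (T i)) \<and> (\<forall>i. \<phi> i (u (Suc i)) = u i)}"
  by (auto simp: inverse_limit_space_def PiE_iff)

lemma S_in_T: "u \<in> topspace S \<Longrightarrow> u i \<in> topspace (T i)"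
  by (simp add: topspace_S)

lemma S_coherent: "u \<in> topspace S \<Longrightarrow> \<phi> i (u (Suc i)) = u i"
  by (simp add: topspace_S)

lemma coord_continuous: "continuous_map S (T i) (\<lambda>u. u i)"
  unfolding inverse_limit_space_def
  by (rule continuous_map_from_subtopology[OF continuous_map_product_projection]) simp

lemma r_coord: "u \<in> topspace S \<Longrightarrow> r i (u i) = \<rho> u"
proof (induction i)
  case (Suc i)
  then show ?case using r_\<phi>[OF S_in_T[OF Suc.prems], of i] S_coherent[OF Suc.prems, of i] by simp
qed simp

lemma \<rho>_continuous: "continuous_map S Y \<rho>"
  using continuous_map_compose[OF coord_continuous covering_map_continuous[OF covr], of 0] by (simp add: o_def)

lemma S_compact: "compact_space S"
proof -
  let ?P = "product_topology T UNIV"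
  have comp: "compact_space ?P"
    using finite_covering_compact[OF cov Y_compact] by (simp add: compact_space_product_topology)
  have "closedin ?P {u \<in> topspace ?P. \<phi> i (u (Suc i)) = u i}" for i
  proof (rule closedin_continuous_maps_eq)
    show "Hausdorff_space (T i)" by (rule covering_Hausdorff[OF covr Y_Hausdorff])
    have proj: "continuous_map ?P (T j) (\<lambda>u. u j)" for j by (rule continuous_map_product_projection) simp
    show "continuous_map ?P (T i) (\<lambda>u. u i)" by (rule proj)
    show "continuous_map ?P (T i) (\<lambda>u. \<phi> i (u (Suc i)))"
      using continuous_map_compose[OF proj \<phi>] by (simp add: o_def)
  qed
  then have clos: "closedin ?P (\<Inter>i. {u \<in> topspace ?P. \<phi> i (u (Suc i)) = u i})" by (intro closedin_Inter) auto
  have eq: "(\<Inter>i. {u \<in> topspace ?P. \<phi> i (u (Suc i)) = u i}) = topspace ?P \<inter> {u. \<forall>i. \<phi> i (u (Suc i)) = u i}"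
    by auto
  have "compactin ?P (topspace ?P \<inter> {u. \<forall>i. \<phi> i (u (Suc i)) = u i})"
    by (rule closedin_compact_space[OF comp clos[unfolded eq]])
  from compact_space_subtopology[OF this] show ?thesis
    unfolding inverse_limit_space_def subtopology_restrict .
qed

lemma agree_below:
  assumes u: "u \<in> topspace S" and v: "v \<in> topspace S" and eq: "u n = v n" and "k \<le> n"
  shows "u k = v k"
  using \<open>k \<le> n\<close> eq
proof (induction n)
  case (Suc n)
  have "u n = v n" using S_coherent[OF u, of n] S_coherent[OF v, of n] Suc.prems(2) by simp
  then show ?case using Suc by (cases "k = Suc n") auto
qed simp

lemma lift_level:
  assumes "openin (T k) V" "k \<le> n"
  shows "\<exists>V'. openin (T n) V' \<and> (\<forall>u \<in> topspace S. u n \<in> V' \<longleftrightarrow> u k \<in> V)"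
  using \<open>k \<le> n\<close>
proof (induction n rule: dec_induct)
  case base
  then show ?case using assms(1) by blast
next
  case (step n)
  then obtain V' where V': "openin (T n) V'" "\<forall>u \<in> topspace S. u n \<in> V' \<longleftrightarrow> u k \<in> V" by blast
  have "openin (T (Suc n)) {e \<in> topspace (T (Suc n)). \<phi> n e \<in> V'}"
    by (rule openin_continuous_map_preimage[OF \<phi> V'(1)])
  moreover have "u (Suc n) \<in> {e \<in> topspace (T (Suc n)). \<phi> n e \<in> V'} \<longleftrightarrow> u k \<in> V" if u: "u \<in> topspace S" for u
    using S_in_T[OF u, of "Suc n"] S_coherent[OF u, of n] V'(2) u by simp
  ultimately show ?case by blast
qed

text \<open>A basic open set constrains finitely many coordinates, and each constraint can be pulled
  back along the bonding maps to the highest level involved.\<close>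

lemma level_basis:
  assumes W: "openin S W" and u: "u \<in> W"
  obtains n V where "openin (T n) V" "u n \<in> V" "\<And>v. v \<in> topspace S \<Longrightarrow> v n \<in> V \<Longrightarrow> v \<in> W"
proof -
  have uS: "u \<in> topspace S" using openin_subset[OF W] u by blast
  obtain W' where W': "openin (product_topology T UNIV) W'" "W = W' \<inter> {u. \<forall>i. \<phi> i (u (Suc i)) = u i}"
    using W unfolding inverse_limit_space_def openin_subtopology by blast
  have "u \<in> W'" using u W'(2) by blast
  with W'(1) have "\<exists>U. finite {i \<in> UNIV. U i \<noteq> topspace (T i)} \<and> (\<forall>i \<in> UNIV. openin (T i) (U i)) \<and> u \<in> Pi\<^sub>E UNIV U \<and> Pi\<^sub>E UNIV U \<subseteq> W'"
    unfolding openin_product_topology_alt by blast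
  then obtain U where U: "finite {i. U i \<noteq> topspace (T i)}" "\<And>i. openin (T i) (U i)" "\<And>i. u i \<in> U i"
    "Pi\<^sub>E UNIV U \<subseteq> W'" by (auto simp: PiE_iff)
  define F where "F = {i. U i \<noteq> topspace (T i)}"
  define n where "n = Max (insert 0 F)"
  have le: "i \<le> n" if "i \<in> F" for i unfolding n_def using U(1) that by (intro Max_ge) (auto simp: F_def)
  have "\<exists>V'. openin (T n) V' \<and> (\<forall>u \<in> topspace S. u n \<in> V' \<longleftrightarrow> u i \<in> U i)" if "i \<in> F" for i
    by (rule lift_level[OF U(2) le[OF that]])
  then have "\<forall>i \<in> F. \<exists>V'. openin (T n) V' \<and> (\<forall>u \<in> topspace S. u n \<in> V' \<longleftrightarrow> u i \<in> U i)" by blast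
  from bchoice[OF this] obtain V where "\<forall>i \<in> F. openin (T n) (V i) \<and> (\<forall>u \<in> topspace S. u n \<in> V i \<longleftrightarrow> u i \<in> U i)"
    by (elim exE)
  then have V: "\<And>i. i \<in> F \<Longrightarrow> openin (T n) (V i)" "\<And>i u. i \<in> F \<Longrightarrow> u \<in> topspace S \<Longrightarrow> u n \<in> V i \<longleftrightarrow> u i \<in> U i"
    by simp_all
  define O' where "O' = topspace (T n) \<inter> \<Inter>(V ` F)"
  show thesis
  proof
    show "openin (T n) O'"
    proof (cases "F = {}")
      case False
      then show ?thesis unfolding O'_def using U(1) V(1) by (intro openin_Int openin_Inter) (auto simp: F_def)
    qed (simp add: O'_def)
    show "u n \<in> O'" using V(2)[OF _ uS] U(3) S_in_T[OF uS] by (auto simp: O'_def)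
    fix v assume v: "v \<in> topspace S" "v n \<in> O'"
    have "v i \<in> U i" for i
    proof (cases "i \<in> F")
      case True
      then show ?thesis using V(2)[OF True v(1)] v(2) by (auto simp: O'_def)
    next
      case False
      then show ?thesis using S_in_T[OF v(1)] by (simp add: F_def)
    qed
    then have "v \<in> W'" using U(4) by (auto simp: PiE_iff)
    then show "v \<in> W" using v(1) by (simp add: W'(2) topspace_S)
  qed
qed

text \<open>Closeness in the limit follows from equality at one deep level: finitely many sets given
  by single levels cover the compact limit, and the deepest of these levels serves
  everywhere.\<close>

lemma level_entourage:
  assumes N: "entourage S N"
  obtains n where "\<And>u v. u \<in> topspace S \<Longrightarrow> v \<in> topspace S \<Longrightarrow> u n = v n \<Longrightarrow> (u, v) \<in> N"
proof -
  have "\<exists>n V. openin (T n) V \<and> u n \<in> V \<and> (\<forall>v v'. v \<in> topspace S \<and> v' \<in> topspace S \<and> v n \<in> V \<and> v' n \<in> V \<longrightarrow> (v, v') \<in> N)"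
    if u: "u \<in> topspace S" for u
  proof -
    obtain W where W: "openin S W" "u \<in> W" "W \<times> W \<subseteq> N" by (rule entourage_square[OF N u])
    obtain n V where "openin (T n) V" "u n \<in> V" "\<And>v. v \<in> topspace S \<Longrightarrow> v n \<in> V \<Longrightarrow> v \<in> W"
      by (rule level_basis[OF W(1,2)]) blast
    with W(3) show ?thesis by (intro exI[of _ n] exI[of _ V]) blast
  qed
  then have "\<forall>u \<in> topspace S. \<exists>n V. openin (T n) V \<and> u n \<in> V \<and>
      (\<forall>v v'. v \<in> topspace S \<and> v' \<in> topspace S \<and> v n \<in> V \<and> v' n \<in> V \<longrightarrow> (v, v') \<in> N)" by blast
  from bchoice[OF this] obtain n where "\<forall>u \<in> topspace S. \<exists>V. openin (T (n u)) V \<and> u (n u) \<in> V \<and>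
      (\<forall>v v'. v \<in> topspace S \<and> v' \<in> topspace S \<and> v (n u) \<in> V \<and> v' (n u) \<in> V \<longrightarrow> (v, v') \<in> N)" by (elim exE)
  from bchoice[OF this] obtain V where nV: "\<forall>u \<in> topspace S. openin (T (n u)) (V u) \<and> u (n u) \<in> V u \<and>
      (\<forall>v v'. v \<in> topspace S \<and> v' \<in> topspace S \<and> v (n u) \<in> V u \<and> v' (n u) \<in> V u \<longrightarrow> (v, v') \<in> N)" by (elim exE)
  define O' where "O' = (\<lambda>u. {v \<in> topspace S. v (n u) \<in> V u})"
  have "openin S (O' u)" if "u \<in> topspace S" for u
    unfolding O'_def using nV that by (intro openin_continuous_map_preimage[OF coord_continuous]) simp
  moreover have "u \<in> O' u" if "u \<in> topspace S" for u using nV that by (simp add: O'_def)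
  ultimately have "\<exists>\<F>. finite \<F> \<and> \<F> \<subseteq> O' ` topspace S \<and> topspace S \<subseteq> \<Union>\<F>"
    using S_compact unfolding compact_space_alt by (elim allE[of _ "O' ` topspace S"]) auto
  then obtain F where F: "finite F" "F \<subseteq> topspace S" "topspace S \<subseteq> (\<Union>u\<in>F. O' u)"
    by (metis finite_subset_image)
  define l where "l = Max (insert 0 (n ` F))"
  show thesis
  proof
    fix u v assume u: "u \<in> topspace S" and v: "v \<in> topspace S" and eq: "u l = v l"
    obtain w where w: "w \<in> F" "u (n w) \<in> V w" using F(3) u by (auto simp: O'_def)
    have "n w \<le> l" unfolding l_def using F(1) w(1) by (intro Max_ge) auto
    then have "u (n w) = v (n w)" by (rule agree_below[OF u v eq])
    moreover have "w \<in> topspace S" using w(1) F(2) by blast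
    ultimately show "(u, v) \<in> N" using nV w(2) u v by simp
  qed
qed

section \<open>Paths in the limit, their projections and their lifts\<close>

lemma pathin_coord: "pathin S d \<Longrightarrow> pathin (T i) (\<lambda>t. d t i)"
  by (rule pathin_continuous_image[OF _ coord_continuous])

lemma lifts_to_coord:
  assumes d: "pathin S d" and g: "\<And>t. t \<in> {0..1} \<Longrightarrow> \<rho> (d t) = g t"
  shows "lifts_to (T i) (r i) g (d 0 i) (d 1 i)"
  unfolding lifts_to_def
proof (intro exI[of _ "\<lambda>t. d t i"] conjI ballI)
  show "pathin (T i) (\<lambda>t. d t i)" by (rule pathin_coord[OF d])
  fix t :: real assume "t \<in> {0..1}"
  then show "r i (d t i) = g t" using r_coord[OF pathin_in_topspace[OF d], of t i] g by simp
qed auto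

text \<open>The path is lifted at every level; unique lifting makes these lifts compatible with the
  bonding maps.\<close>

lemma path_lift_limit:
  assumes g: "pathin Y g" and w: "w \<in> topspace S" "\<rho> w = g 0"
  obtains d where "pathin S d" "d 0 = w" "\<And>t. t \<in> {0..1} \<Longrightarrow> \<rho> (d t) = g t"
proof -
  have "\<exists>d. pathin (T i) d \<and> d 0 = w i \<and> (\<forall>t \<in> {0..1}. r i (d t) = g t)" for i
  proof -
    have "r i (w i) = g 0" using r_coord[OF w(1), of i] w(2) by simp
    then obtain d where "pathin (T i) d" "d 0 = w i" "\<And>t. t \<in> {0..1} \<Longrightarrow> r i (d t) = g t"
      by (rule path_lift_exists[OF covr g S_in_T[OF w(1)]]) blast
    then show ?thesis by blast
  qed
  then have "\<forall>i. \<exists>d. pathin (T i) d \<and> d 0 = w i \<and> (\<forall>t \<in> {0..1}. r i (d t) = g t)" by blast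
  from choice[OF this] obtain d where "\<forall>i. pathin (T i) (d i) \<and> d i 0 = w i \<and> (\<forall>t \<in> {0..1}. r i (d i t) = g t)"
    by (elim exE)
  then have d: "pathin (T i) (d i)" "d i 0 = w i" "\<And>t. t \<in> {0..1} \<Longrightarrow> r i (d i t) = g t" for i by auto
  have coh: "\<phi> i (d (Suc i) t) = d i t" if t: "t \<in> {0..1}" for i t
  proof (rule path_lift_unique[OF covr _ d(1) _ _ t])
    show "pathin (T i) (\<lambda>t. \<phi> i (d (Suc i) t))" by (rule pathin_continuous_image[OF d(1) \<phi>])
    show "r i (\<phi> i (d (Suc i) t)) = r i (d i t)" if "t \<in> {0..1}" for t
      using r_\<phi>[OF pathin_in_topspace[OF d(1) that]] d(3)[OF that] by simp
    show "\<phi> i (d (Suc i) 0) = d i 0" using d(2) S_coherent[OF w(1)] by simp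
  qed
  show thesis
  proof
    show "pathin S (\<lambda>t i. d i t)"
      unfolding inverse_limit_space_def pathin_subtopology
      using d(1) coh by (auto simp: pathin_def continuous_map_componentwise_UNIV)
    show "(\<lambda>i. d i 0) = w" using d(2) by auto
    show "\<rho> (\<lambda>i. d i t) = g t" if "t \<in> {0..1}" for t using d(3)[OF that] .
  qed
qed

text \<open>A path in the limit cannot move transversally while its projection stays small: at a
  fixed level it follows a local section. Compactness of the fibers makes the required size depend
  on the base point only, and compactness of the base makes it uniform.\<close>

lemma leafwise_small:
  assumes N: "entourage S N"
  obtains Q where "entourage Y Q"
    "\<And>s t. pathin S s \<Longrightarrow> \<forall>t \<in> {0..1}. (\<rho> (s 0), \<rho> (s t)) \<in> Q \<Longrightarrow> t \<in> {0..1} \<Longrightarrow> (s 0, s t) \<in> N"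
proof -
  define good where "good = (\<lambda>B. \<forall>s. pathin S s \<longrightarrow> (\<forall>t \<in> {0..1}. \<rho> (s t) \<in> B) \<longrightarrow> (\<forall>t \<in> {0..1}. (s 0, s t) \<in> N))"
  have chart: "\<exists>A B. openin S A \<and> w \<in> A \<and> openin Y B \<and> \<rho> w \<in> B \<and>
      (\<forall>s. pathin S s \<longrightarrow> s 0 \<in> A \<longrightarrow> (\<forall>t \<in> {0..1}. \<rho> (s t) \<in> B) \<longrightarrow> (\<forall>t \<in> {0..1}. (s 0, s t) \<in> N))"
    if w: "w \<in> topspace S" for w
  proof -
    obtain W where W: "openin S W" "w \<in> W" "W \<times> W \<subseteq> N" by (rule entourage_square[OF N w])
    obtain n V where V: "openin (T n) V" "w n \<in> V" "\<And>v. v \<in> topspace S \<Longrightarrow> v n \<in> V \<Longrightarrow> v \<in> W"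
      by (rule level_basis[OF W(1,2)]) blast
    obtain B \<sigma> where B: "openin Y B" "r n (w n) \<in> B" "continuous_map (subtopology Y B) (T n) \<sigma>"
      "\<sigma> (r n (w n)) = w n" "\<And>v. v \<in> B \<Longrightarrow> \<sigma> v \<in> V \<and> r n (\<sigma> v) = v"
      "\<And>V'. openin Y V' \<Longrightarrow> V' \<subseteq> B \<Longrightarrow> openin (T n) (\<sigma> ` V')"
      by (rule covering_local_section[OF covr V(1,2)]) blast
    \<comment> \<open>For a path that starts in \<open>A\<close> and stays over \<open>B\<close>,
      the coordinate at level \<open>n\<close> is the section \<open>\<sigma>\<close> applied to its
      projection, so the path remains in \<open>W\<close>.\<close>
    define A where "A = {v \<in> topspace S. v n \<in> \<sigma> ` B}"
    have "openin S A" unfolding A_def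
      by (rule openin_continuous_map_preimage[OF coord_continuous B(6)[OF B(1) order_refl]])
    moreover have "w \<in> A" using w B(2,4) by (force simp: A_def)
    moreover have "\<rho> w \<in> B" using B(2) r_coord[OF w, of n] by simp
    moreover have "(s 0, s t) \<in> N"
      if s: "pathin S s" "s 0 \<in> A" "\<forall>t \<in> {0..1}. \<rho> (s t) \<in> B" and t: "t \<in> {0..1}" for s t
    proof -
      have sn: "s u n = \<sigma> (\<rho> (s u))" if u: "u \<in> {0..1}" for u
      proof (rule path_lift_unique[OF covr pathin_coord[OF s(1)] _ _ _ u])
        have "pathin (subtopology Y B) (\<lambda>t. \<rho> (s t))"
          using pathin_continuous_image[OF s(1) \<rho>_continuous] s(3) by (simp add: pathin_subtopology)
        then show "pathin (T n) (\<lambda>t. \<sigma> (\<rho> (s t)))" by (rule pathin_continuous_image[OF _ B(3)])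
        show "r n (s t n) = r n (\<sigma> (\<rho> (s t)))" if t: "t \<in> {0..1}" for t
        proof -
          have "r n (s t n) = \<rho> (s t)" by (rule r_coord[OF pathin_in_topspace[OF s(1) t]])
          moreover have "\<rho> (s t) \<in> B" using s(3) t by blast
          ultimately show ?thesis using B(5) by simp
        qed
        obtain b where b: "b \<in> B" "s 0 n = \<sigma> b" using s(2) by (auto simp: A_def)
        have "r n (s 0 n) = \<rho> (s 0)" by (rule r_coord[OF path_start_in_topspace[OF s(1)]])
        then have "b = \<rho> (s 0)" using b B(5)[OF b(1)] by simp
        then show "s 0 n = \<sigma> (\<rho> (s 0))" using b(2) by simp
      qed
      have "s u \<in> W" if u: "u \<in> {0..1}" for u
      proof (rule V(3)[OF pathin_in_topspace[OF s(1) u]])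
        have "\<rho> (s u) \<in> B" using s(3) u by blast
        then show "s u n \<in> V" unfolding sn[OF u] using B(5) by blast
      qed
      from this[of 0] this[OF t] show ?thesis using W(3) by auto
    qed
    ultimately show ?thesis using B(1) by (intro exI[of _ A] exI[of _ B]) blast
  qed
  have "\<exists>B \<in> {B. good B}. openin Y B \<and> y \<in> B" if y: "y \<in> topspace Y" for y
  proof -
    define F where "F = {w \<in> topspace S. \<rho> w = y}"
    have "\<forall>w \<in> F. \<exists>A B. openin S A \<and> w \<in> A \<and> openin Y B \<and> \<rho> w \<in> B \<and>
      (\<forall>s. pathin S s \<longrightarrow> s 0 \<in> A \<longrightarrow> (\<forall>t \<in> {0..1}. \<rho> (s t) \<in> B) \<longrightarrow> (\<forall>t \<in> {0..1}. (s 0, s t) \<in> N))"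
      using chart unfolding F_def by blast
    from bchoice[OF this] obtain A where "\<forall>w \<in> F. \<exists>B. openin S (A w) \<and> w \<in> A w \<and> openin Y B \<and> \<rho> w \<in> B \<and>
      (\<forall>s. pathin S s \<longrightarrow> s 0 \<in> A w \<longrightarrow> (\<forall>t \<in> {0..1}. \<rho> (s t) \<in> B) \<longrightarrow> (\<forall>t \<in> {0..1}. (s 0, s t) \<in> N))"
      by (elim exE)
    from bchoice[OF this] obtain B where AB: "\<forall>w \<in> F. openin S (A w) \<and> w \<in> A w \<and> openin Y (B w) \<and> \<rho> w \<in> B w \<and>
      (\<forall>s. pathin S s \<longrightarrow> s 0 \<in> A w \<longrightarrow> (\<forall>t \<in> {0..1}. \<rho> (s t) \<in> B w) \<longrightarrow> (\<forall>t \<in> {0..1}. (s 0, s t) \<in> N))"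
      by (elim exE)
    have "closedin S {w \<in> topspace S. \<rho> w \<in> {y}}"
      using \<rho>_continuous Y_Hausdorff y by (intro closedin_continuous_map_preimage[OF \<rho>_continuous]) (simp add: closedin_Hausdorff_sing_eq)
    then have "compactin S F" unfolding F_def using closedin_compact_space[OF S_compact] by simp
    then have "\<exists>\<F>. finite \<F> \<and> \<F> \<subseteq> A ` F \<and> F \<subseteq> \<Union>\<F>"
      using AB unfolding compactin_def by (elim conjE allE[of _ "A ` F"]) auto
    then obtain F' where F': "finite F'" "F' \<subseteq> F" "F \<subseteq> (\<Union>w\<in>F'. A w)" by (metis finite_subset_image)
    define U where "U = (\<Union>w\<in>F'. A w)"
    have U: "openin S U" unfolding U_def using F'(2) AB by (intro openin_Union) auto
    have clos: "closed_map S Y \<rho>" by (rule continuous_imp_closed_map[OF \<rho>_continuous S_compact Y_Hausdorff])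
    have "closedin Y (\<rho> ` (topspace S - U))" using clos U by (auto simp: closed_map_def)
    \<comment> \<open>Finitely many chart sets \<open>A w\<close> cover the fiber over
      \<open>y\<close>. Since the projection is closed, removing the image of the complement of
      their union leaves a neighbourhood of \<open>y\<close> over which there is nothing
      else.\<close>
    define B' where "B' = (topspace Y - \<rho> ` (topspace S - U)) \<inter> \<Inter>(B ` F')"
    have "openin Y B'"
    proof (cases "F' = {}")
      case True then show ?thesis using openin_diff[OF openin_topspace \<open>closedin Y (\<rho> ` (topspace S - U))\<close>] by (simp add: B'_def)
    next
      case False
      then show ?thesis unfolding B'_def using \<open>closedin Y (\<rho> ` (topspace S - U))\<close> F' AB
        by (intro openin_Int openin_Inter openin_diff) auto
    qed
    moreover have "y \<in> B'"
    proof -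
      have "w \<in> U" if "w \<in> topspace S" "\<rho> w = y" for w using F'(3) that by (auto simp: F_def U_def)
      moreover have "y \<in> B w" if "w \<in> F'" for w
        using AB F'(2) that by (auto simp: F_def)
      ultimately show ?thesis using y by (auto simp: B'_def)
    qed
    moreover have "good B'"
      unfolding good_def
    proof (intro allI impI)
      fix s assume s: "pathin S s" "\<forall>t \<in> {0..1}. \<rho> (s t) \<in> B'"
      have "\<rho> (s 0) \<in> B'" using s(2) by simp
      then have "s 0 \<in> U" using path_start_in_topspace[OF s(1)] by (auto simp: B'_def)
      then obtain w where w: "w \<in> F'" "s 0 \<in> A w" by (auto simp: U_def)
      have "\<forall>t \<in> {0..1}. \<rho> (s t) \<in> B w" using s(2) w(1) by (auto simp: B'_def)
      then show "\<forall>t \<in> {0..1}. (s 0, s t) \<in> N" using AB F'(2) w s(1) by (meson subsetD)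
    qed
    ultimately show ?thesis by blast
  qed
  then obtain Q where Q: "entourage Y Q" "\<forall>y \<in> topspace Y. \<exists>B \<in> {B. good B}. y \<in> B \<and> openin Y B \<and> Q `` {y} \<subseteq> B"
    by (rule Lebesgue_entourage[OF Y_compact Y_Hausdorff]) blast
  show thesis
  proof (rule that[OF Q(1)])
    fix s t assume s: "pathin S s" "\<forall>t \<in> {0..1}. (\<rho> (s 0), \<rho> (s t)) \<in> Q" "t \<in> {0..1::real}"
    have "\<rho> (s 0) \<in> topspace Y"
      using path_start_in_topspace[OF pathin_continuous_image[OF s(1) \<rho>_continuous]] .
    with Q(2) obtain B where B: "good B" "Q `` {\<rho> (s 0)} \<subseteq> B" by blast
    have "\<forall>t \<in> {0..1}. \<rho> (s t) \<in> B" using s(2) B(2) by blast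
    then show "(s 0, s t) \<in> N" using B(1) s(1,3) unfolding good_def by blast
  qed
qed

text \<open>The data for \<open>near_transport\<close>, chosen independently of the level:
  \<open>R0\<close>-balls are good everywhere in the tower, \<open>R1\<close> is a square root of
  \<open>R0\<close>, and \<open>R\<close>-close points are joined by \<open>R1\<close>-short
  paths.\<close>

lemma good_entourages:
  obtains R0 R1 R where "entourage Y R0" "\<And>i y. y \<in> topspace Y \<Longrightarrow> good_over (T i) (r i) (R0 `` {y})"
    "entourage Y R1" "sym R1" "R1 O R1 \<subseteq> R0" "R1 \<subseteq> R0" "entourage Y R"
    "\<And>y y'. (y, y') \<in> R \<Longrightarrow> path_component_of (subtopology Y (R1 `` {y})) y y'"
proof -
  let ?P = "\<lambda>B. \<forall>i. good_over (T i) (r i) B"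
  have "\<exists>B \<in> {B. ?P B}. openin Y B \<and> y \<in> B" if "y \<in> topspace Y" for y
    using good_basis[OF openin_topspace that] by auto
  then obtain R0 where R0: "entourage Y R0"
    "\<forall>y \<in> topspace Y. \<exists>B \<in> {B. ?P B}. y \<in> B \<and> openin Y B \<and> R0 `` {y} \<subseteq> B"
    by (rule Lebesgue_entourage[OF Y_compact Y_Hausdorff]) blast
  have good: "good_over (T i) (r i) (R0 `` {y})" if y: "y \<in> topspace Y" for i y
  proof -
    obtain B where "\<forall>i. good_over (T i) (r i) B" "R0 `` {y} \<subseteq> B" using bspec[OF R0(2) y] by blast
    then show ?thesis using good_over_subset by blast
  qed
  obtain R1 where R1: "entourage Y R1" "sym R1" "R1 O R1 \<subseteq> R0" "R1 \<subseteq> R0"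
    by (rule entourage_symmetric_square_root[OF Y_compact Y_Hausdorff R0(1)])
  obtain R where R: "entourage Y R" "R \<subseteq> R1"
    "\<forall>y \<in> topspace Y. \<exists>W. path_connectedin Y W \<and> y \<in> W \<and> R `` {y} \<subseteq> W \<and> W \<times> W \<subseteq> R1"
    by (rule entourage_small_path_connected[OF Y_compact Y_Hausdorff Y_lpc R1(1)])
  have "path_component_of (subtopology Y (R1 `` {y})) y y'" if yy': "(y, y') \<in> R" for y y'
  proof -
    from yy' have "y \<in> topspace Y" using entourage_subset[OF R(1)] by auto
    with R(3) obtain W where W: "path_connectedin Y W" "y \<in> W" "R `` {y} \<subseteq> W" "W \<times> W \<subseteq> R1" by auto
    have "path_connectedin (subtopology Y (R1 `` {y})) W" "y' \<in> W"
      using W yy' by (auto simp: path_connectedin_subtopology)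
    then show ?thesis using W(2) path_component_of by metis
  qed
  with R0(1) good R1 R(1) show thesis by (rule that)
qed

text \<open>Points related by this entourage are joined by a path at level \<open>i\<close> with
  small projection. Closeness at level \<open>i\<close> can thus be converted into a short closing
  path.\<close>

lemma entourage_leafwise:
  assumes A: "entourage Y A"
  shows "entourage (T i) (\<Union>{U \<times> U |U. openin (T i) U \<and> path_connectedin (T i) U \<and> r i ` U \<times> r i ` U \<subseteq> A})"
proof (rule entourage_Union_squares)
  fix e assume e: "e \<in> topspace (T i)"
  obtain V where V: "openin Y V" "r i e \<in> V" "V \<times> V \<subseteq> A"
    by (rule entourage_square[OF A covering_map_in[OF covr e]])
  have op: "openin (T i) {e \<in> topspace (T i). r i e \<in> V}"
    by (rule openin_continuous_map_preimage[OF covering_map_continuous[OF covr] V(1)])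
  have "e \<in> {e \<in> topspace (T i). r i e \<in> V}" using e V(2) by simp
  then obtain U where U: "openin (T i) U" "path_connectedin (T i) U" "e \<in> U" "U \<subseteq> {e \<in> topspace (T i). r i e \<in> V}"
    using T_lpc[of i, unfolded locally_path_connected_space, rule_format, OF conjI[OF op]] by blast
  then have "r i ` U \<times> r i ` U \<subseteq> A" using V(3) by blast
  with U show "\<exists>U. openin (T i) U \<and> e \<in> U \<and> path_connectedin (T i) U \<and> r i ` U \<times> r i ` U \<subseteq> A" by blast
qed

text \<open>The first path becomes a genuine loop at level i by adding a short path. By regularity
  this loop also lifts to a loop at level m near the start of the second path, and
  \<open>near_transport\<close> compares it with the second path followed by a short
  correction.\<close>

theorem stable_return_limit:
  assumes regular: "\<And>m. \<exists>i. \<forall>g e e'. pathin Y g \<longrightarrow> g 0 = g 1 \<longrightarrow> lifts_to (T i) (r i) g e e \<longrightarrow>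
      e' \<in> topspace (T m) \<longrightarrow> r m e' = g 0 \<longrightarrow> lifts_to (T m) (r m) g e' e'"
  shows "stable_return S"
  unfolding stable_return_def
proof (intro allI impI)
  fix N2 assume N2: "entourage S N2"
  obtain Q where Q: "entourage Y Q"
    "\<And>s t. pathin S s \<Longrightarrow> \<forall>t \<in> {0..1}. (\<rho> (s 0), \<rho> (s t)) \<in> Q \<Longrightarrow> t \<in> {0..1} \<Longrightarrow> (s 0, s t) \<in> N2"
    by (rule leafwise_small[OF N2]) blast
  obtain R0 R1 R where R: "entourage Y R0" "\<And>i y. y \<in> topspace Y \<Longrightarrow> good_over (T i) (r i) (R0 `` {y})"
    "entourage Y R1" "sym R1" "R1 O R1 \<subseteq> R0" "R1 \<subseteq> R0" "entourage Y R"
    "\<And>y y'. (y, y') \<in> R \<Longrightarrow> path_component_of (subtopology Y (R1 `` {y})) y y'"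
    by (rule good_entourages) blast
  \<comment> \<open>Two paths in one of the small sets \<open>W\<close> are \<open>R\<close>-close,
    so they preserve nearness at every level, and \<open>Q\<close>-small, so their lifts stay within
    \<open>N2\<close>. The level \<open>m\<close> enters only later.\<close>
  obtain A where A: "entourage Y A" "A \<subseteq> R \<inter> Q"
    "\<forall>y \<in> topspace Y. \<exists>W. path_connectedin Y W \<and> y \<in> W \<and> A `` {y} \<subseteq> W \<and> W \<times> W \<subseteq> R \<inter> Q"
    by (rule entourage_small_path_connected[OF Y_compact Y_Hausdorff Y_lpc entourage_Int[OF R(7) Q(1)]])
  \<comment> \<open>A square root, because the end of \<open>c'\<close> is reached from the start of
    \<open>c\<close> in two steps over the base: to the end of \<open>c\<close>, then
    across.\<close>
  obtain A' where A': "entourage Y A'" "sym A'" "A' O A' \<subseteq> A" "A' \<subseteq> A"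
    by (rule entourage_symmetric_square_root[OF Y_compact Y_Hausdorff A(1)])
  define N1 where "N1 = {(u, v). u \<in> topspace S \<and> v \<in> topspace S \<and> (\<rho> u, \<rho> v) \<in> A'}"
  have N1: "entourage S N1" unfolding N1_def by (rule entourage_vimage[OF \<rho>_continuous A'(1)])
  show "\<exists>N1. entourage S N1 \<and> (\<forall>N. entourage S N \<longrightarrow> (\<exists>N3. entourage S N3 \<and>
      (\<forall>c c'. pathin S c \<and> pathin S c' \<and> (\<forall>t \<in> {0..1}. (c t, c' t) \<in> N1) \<and> (c 0, c 1) \<in> N3 \<longrightarrow>
         (\<exists>s. pathin S s \<and> s 0 = c' 1 \<and> (\<forall>t \<in> {0..1}. (c' 1, s t) \<in> N2) \<and> (s 1, c' 0) \<in> N))))"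
  proof (rule exI[of _ N1], intro conjI N1 allI impI)
    fix N assume N: "entourage S N"
    obtain m where m: "\<And>u v. u \<in> topspace S \<Longrightarrow> v \<in> topspace S \<Longrightarrow> u m = v m \<Longrightarrow> (u, v) \<in> N"
      by (rule level_entourage[OF N]) blast
    from regular[of m] obtain i where i: "\<And>g e e'. pathin Y g \<Longrightarrow> g 0 = g 1 \<Longrightarrow> lifts_to (T i) (r i) g e e \<Longrightarrow>
      e' \<in> topspace (T m) \<Longrightarrow> r m e' = g 0 \<Longrightarrow> lifts_to (T m) (r m) g e' e'" by blast
    let ?E = "\<Union>{U \<times> U |U. openin (T i) U \<and> path_connectedin (T i) U \<and> r i ` U \<times> r i ` U \<subseteq> A'}"
    define N3 where "N3 = {(u, v). u \<in> topspace S \<and> v \<in> topspace S \<and> (u i, v i) \<in> ?E}"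
    have N3: "entourage S N3"
      unfolding N3_def by (rule entourage_vimage[OF coord_continuous entourage_leafwise[OF A'(1)]])
    show "\<exists>N3. entourage S N3 \<and>
      (\<forall>c c'. pathin S c \<and> pathin S c' \<and> (\<forall>t \<in> {0..1}. (c t, c' t) \<in> N1) \<and> (c 0, c 1) \<in> N3 \<longrightarrow>
         (\<exists>s. pathin S s \<and> s 0 = c' 1 \<and> (\<forall>t \<in> {0..1}. (c' 1, s t) \<in> N2) \<and> (s 1, c' 0) \<in> N))"
    proof (rule exI[of _ N3], intro conjI N3 allI impI)
      fix c c' assume "pathin S c \<and> pathin S c' \<and> (\<forall>t \<in> {0..1}. (c t, c' t) \<in> N1) \<and> (c 0, c 1) \<in> N3"
      then have c: "pathin S c" "pathin S c'" and close: "\<And>t. t \<in> {0..1} \<Longrightarrow> (\<rho> (c t), \<rho> (c' t)) \<in> A'"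
        and ret: "(c 0 i, c 1 i) \<in> ?E" by (auto simp: N1_def N3_def)
      define \<gamma> where "\<gamma> = (\<lambda>t. \<rho> (c t))"
      define y where "y = \<rho> (c 0)"
      define y' where "y' = \<rho> (c' 0)"
      define z' where "z' = \<rho> (c' 1)"
      have \<gamma>: "pathin Y \<gamma>" unfolding \<gamma>_def by (rule pathin_continuous_image[OF c(1) \<rho>_continuous])
      have cS: "c 0 \<in> topspace S" "c 1 \<in> topspace S" "c' 0 \<in> topspace S" "c' 1 \<in> topspace S"
        using c path_start_in_topspace path_finish_in_topspace by auto
      have yY: "y \<in> topspace Y" using path_start_in_topspace[OF \<gamma>] by (simp add: y_def \<gamma>_def)
      from ret obtain U where U: "openin (T i) U" "path_connectedin (T i) U" "r i ` U \<times> r i ` U \<subseteq> A'"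
        "c 0 i \<in> U" "c 1 i \<in> U" by blast
      have "path_connectedin (subtopology (T i) U) U" using U(2) by (simp add: path_connectedin_subtopology)
      then have "path_component_of (subtopology (T i) U) (c 1 i) (c 0 i)"
        unfolding path_component_of using U(4,5) by (intro exI[of _ U]) simp
      \<comment> \<open>Closes up the first path at level \<open>i\<close>; its projection
        \<open>\<beta>\<close> is small, since \<open>U\<close> has small projection.\<close>
      then obtain b where b: "pathin (T i) b" "b 0 = c 1 i" "b 1 = c 0 i" "\<And>t. t \<in> {0..1} \<Longrightarrow> b t \<in> U"
        unfolding path_component_of_def pathin_subtopology by auto
      define \<beta> where "\<beta> = (\<lambda>t. r i (b t))"
      have \<beta>: "pathin Y \<beta>"
        unfolding \<beta>_def by (rule pathin_continuous_image[OF b(1) covering_map_continuous[OF covr]])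
      have \<beta>ends: "\<beta> 0 = \<gamma> 1" "\<beta> 1 = \<gamma> 0"
        using r_coord[OF cS(1), of i] r_coord[OF cS(2), of i] by (simp_all add: \<beta>_def b(2,3) \<gamma>_def)
      have \<beta>y: "(y, \<beta> t) \<in> A'" if t: "t \<in> {0..1}" for t
      proof -
        have "r i (c 0 i) = y" using r_coord[OF cS(1), of i] by (simp add: y_def)
        moreover have "(r i (c 0 i), r i (b t)) \<in> A'" using U(3,4) b(4)[OF t] by blast
        ultimately show ?thesis by (simp add: \<beta>_def)
      qed
      obtain W where W: "path_connectedin Y W" "y \<in> W" "A `` {y} \<subseteq> W" "W \<times> W \<subseteq> R \<inter> Q"
        using A(3) yY by auto
      have \<beta>W: "\<beta> t \<in> W" if "t \<in> {0..1}" for t using \<beta>y[OF that] A'(4) W(3) by auto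
      have y'W: "y' \<in> W" using close[of 0] A'(4) W(3) by (auto simp: y_def y'_def)
      have z'W: "z' \<in> W"
      proof -
        have "(y, \<gamma> 1) \<in> A'" using \<beta>y[of 0] \<beta>ends(1) by simp
        moreover have "(\<gamma> 1, z') \<in> A'" using close[of 1] by (simp add: \<gamma>_def z'_def)
        ultimately show ?thesis using A'(3) W(3) by blast
      qed
      have "path_connectedin (subtopology Y W) W" using W(1) by (simp add: path_connectedin_subtopology)
      then have "path_component_of (subtopology Y W) z' y'"
        unfolding path_component_of using y'W z'W by (intro exI[of _ W]) simp
      \<comment> \<open>The projection of the correction: a path inside \<open>W\<close> from the
        end of the second path to its start.\<close>
      then obtain \<sigma> where \<sigma>: "pathin Y \<sigma>" "\<sigma> 0 = z'" "\<sigma> 1 = y'" "\<And>t. t \<in> {0..1} \<Longrightarrow> \<sigma> t \<in> W"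
        unfolding path_component_of_def pathin_subtopology by auto
      have loop: "lifts_to (T i) (r i) (path_concat \<gamma> \<beta>) (c 0 i) (c 0 i)"
      proof (rule lifts_to_concat)
        show "lifts_to (T i) (r i) \<gamma> (c 0 i) (c 1 i)" by (rule lifts_to_coord[OF c(1)]) (simp add: \<gamma>_def)
        show "lifts_to (T i) (r i) \<beta> (c 1 i) (c 0 i)" using b unfolding lifts_to_def \<beta>_def by auto
      qed
      define e' where "e' = c' 0 m"
      have e': "e' \<in> topspace (T m)" "r m e' = y'"
        using S_in_T[OF cS(3)] r_coord[OF cS(3), of m] by (simp_all add: e'_def y'_def)
      have "(y, y') \<in> R" using W(2,4) y'W by auto
      from path_component_of_lift[OF covr path_component_of_sym[OF R(8)[OF this]] e']
      \<comment> \<open>The loop \<open>path_concat \<gamma> \<beta>\<close> is based at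
        \<open>y\<close>, whereas \<open>c'\<close> starts over \<open>y'\<close>. So the starting
        point at level \<open>m\<close> is first moved along the sheet to a point over
        \<open>y\<close>.\<close>
      obtain \<delta>0 where \<delta>0: "path_component_of (subtopology (T m) {z. r m z \<in> R1 `` {y}}) e' \<delta>0" "r m \<delta>0 = y" .
      then have near0: "near (T m) (r m) R1 \<delta>0 e'"
        using path_component_of_sym[OF \<delta>0(1)] by (simp add: near_def)
      have \<delta>0T: "\<delta>0 \<in> topspace (T m)" using path_component_in_topspace[OF \<delta>0(1)] by simp
      have "r m \<delta>0 = \<gamma> 0" using \<delta>0(2) by (simp add: y_def \<gamma>_def)
      then obtain \<delta> where \<delta>: "pathin (T m) \<delta>" "\<delta> 0 = \<delta>0" "\<And>t. t \<in> {0..1} \<Longrightarrow> r m (\<delta> t) = \<gamma> t"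
        by (rule path_lift_exists[OF covr \<gamma> \<delta>0T]) blast
      have near1: "near (T m) (r m) R1 (\<delta> 1) (c' 1 m)"
      proof (rule near_transport[OF covr R(2) R(3,5,8) \<delta>(1) pathin_coord[OF c(2)]])
        show "(r m (\<delta> t), r m (c' t m)) \<in> R" if t: "t \<in> {0..1}" for t
        proof -
          have "r m (\<delta> t) = \<rho> (c t)" using \<delta>(3)[OF t] by (simp add: \<gamma>_def)
          moreover have "r m (c' t m) = \<rho> (c' t)" by (rule r_coord[OF pathin_in_topspace[OF c(2) t]])
          ultimately show ?thesis using close[OF t] A'(4) A(2) by auto
        qed
        show "near (T m) (r m) R1 (\<delta> 0) (c' 0 m)" using near0 by (simp add: \<delta>(2) e'_def)
      qed
      \<comment> \<open>Regularity: the loop closes at \<open>c 0\<close> at level \<open>i\<close>,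
        hence at \<open>\<delta>0\<close> at level \<open>m\<close>. Its second half is then a lift
        of \<open>\<beta>\<close> that leads from the end of \<open>\<delta>\<close> back to
        \<open>\<delta>0\<close>.\<close>
      have "lifts_to (T m) (r m) (path_concat \<gamma> \<beta>) \<delta>0 \<delta>0"
      proof (rule i[OF _ _ loop \<delta>0T])
        show "pathin Y (path_concat \<gamma> \<beta>)" by (rule pathin_concat[OF \<gamma> \<beta>]) (simp add: \<beta>ends)
        show "path_concat \<gamma> \<beta> 0 = path_concat \<gamma> \<beta> 1" by (simp add: \<beta>ends)
        show "r m \<delta>0 = path_concat \<gamma> \<beta> 0" using \<open>r m \<delta>0 = \<gamma> 0\<close> by simp
      qed
      moreover obtain e2 where e2: "lifts_to (T m) (r m) \<beta> (\<delta> 1) e2"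
        using lifts_to_exists[OF covr \<beta> path_finish_in_topspace[OF \<delta>(1)]] \<delta>(3)[of 1] \<beta>ends(1) by auto
      moreover have "lifts_to (T m) (r m) (path_concat \<gamma> \<beta>) \<delta>0 e2"
        by (rule lifts_to_concat[OF _ e2]) (use \<delta> in \<open>auto simp: lifts_to_def\<close>)
      ultimately have "lifts_to (T m) (r m) \<beta> (\<delta> 1) \<delta>0" using lifts_to_unique[OF covr] by metis
      then obtain b' where b': "pathin (T m) b'" "b' 0 = \<delta> 1" "b' 1 = \<delta>0" "\<And>t. t \<in> {0..1} \<Longrightarrow> r m (b' t) = \<beta> t"
        unfolding lifts_to_def by blast
      have "\<rho> (c' 1) = \<sigma> 0" by (simp add: \<sigma>(2) z'_def)
      then obtain s where s: "pathin S s" "s 0 = c' 1" "\<And>t. t \<in> {0..1} \<Longrightarrow> \<rho> (s t) = \<sigma> t"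
        by (rule path_lift_limit[OF \<sigma>(1) cS(4)]) blast
      have sm: "r m (s t m) = \<sigma> t" if t: "t \<in> {0..1}" for t
        using r_coord[OF pathin_in_topspace[OF s(1) t], of m] s(3)[OF t] by simp
      have near2: "near (T m) (r m) R1 (b' 1) (s 1 m)"
      proof (rule near_transport[OF covr R(2) R(3,5,8) b'(1) pathin_coord[OF s(1)]])
        show "(r m (b' t), r m (s t m)) \<in> R" if t: "t \<in> {0..1}" for t
          using b'(4)[OF t] sm[OF t] \<beta>W[OF t] \<sigma>(4)[OF t] W(4) by auto
        show "near (T m) (r m) R1 (b' 0) (s 0 m)" using near1 by (simp add: b'(2) s(2))
      qed
      have "s 1 m = e'"
      proof -
        let ?C = "path_component_of (subtopology (T m) {z. r m z \<in> R1 `` {y}})"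
        have "?C \<delta>0 (s 1 m)" using near2 \<delta>0(2) by (simp add: near_def b'(3))
        then have "?C e' (s 1 m)" by (rule path_component_of_trans[OF \<delta>0(1)])
        moreover have "good_over (T m) (r m) (R1 `` {y})"
          by (rule good_over_subset[OF R(2)[OF yY]]) (use R(6) in auto)
        moreover have "r m e' = r m (s 1 m)" using e'(2) sm[of 1] \<sigma>(3) by simp
        ultimately show ?thesis unfolding good_over_def by metis
      qed
      then have "(s 1, c' 0) \<in> N"
        by (intro m path_finish_in_topspace[OF s(1)] cS) (simp add: e'_def)
      moreover have "(c' 1, s t) \<in> N2" if t: "t \<in> {0..1}" for t
      proof -
        have "\<forall>t \<in> {0..1}. (\<rho> (s 0), \<rho> (s t)) \<in> Q"
          using s(3) \<sigma>(4) W(4) by auto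
        from Q(2)[OF s(1) this t] show ?thesis by (simp add: s(2))
      qed
      ultimately show "\<exists>s. pathin S s \<and> s 0 = c' 1 \<and> (\<forall>t \<in> {0..1}. (c' 1, s t) \<in> N2) \<and> (s 1, c' 0) \<in> N"
        using s(1,2) by blast
    qed
  qed
qed

text \<open>The witnesses are two lifts of the same loop \<open>g\<close>, from \<open>x\<close> and
  from a point \<open>v\<close> that agrees with \<open>x\<close> up to level n. They are close for
  all time, and the first returns at level i. The second fails to return at level m, and no short
  correction can repair that.\<close>

theorem not_stable_return_limit:
  assumes x: "x \<in> topspace S"
    and irregular: "\<And>n. \<exists>m. \<forall>i. \<exists>g v. pathin Y g \<and> g 0 = \<rho> x \<and> g 1 = \<rho> x \<and> lifts_to (T i) (r i) g (x i) (x i) \<and>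
      v \<in> topspace S \<and> v n = x n \<and> \<not> lifts_to (T m) (r m) g (v m) (v m)"
  shows "\<not> stable_return S"
proof
  assume stable: "stable_return S"
  obtain R0 R1 where R: "entourage Y R0" "\<And>i y. y \<in> topspace Y \<Longrightarrow> good_over (T i) (r i) (R0 `` {y})"
    "entourage Y R1" "R1 O R1 \<subseteq> R0" "R1 \<subseteq> R0"
    by (rule good_entourages) blast
  have "entourage S {(u, v). u \<in> topspace S \<and> v \<in> topspace S \<and> (\<rho> u, \<rho> v) \<in> R1}"
    by (rule entourage_vimage[OF \<rho>_continuous R(3)])
  \<comment> \<open>The correction is only required to have a projection within \<open>R1\<close> of
    its start, so at every level it moves along a sheet over a good set.\<close>
  from stable[unfolded stable_return_def, rule_format, OF this]
  obtain N1 where N1: "entourage S N1" "\<And>N. entourage S N \<Longrightarrow> \<exists>N3. entourage S N3 \<and>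
      (\<forall>c c'. pathin S c \<and> pathin S c' \<and> (\<forall>t \<in> {0..1}. (c t, c' t) \<in> N1) \<and> (c 0, c 1) \<in> N3 \<longrightarrow>
         (\<exists>s. pathin S s \<and> s 0 = c' 1 \<and> (\<forall>t \<in> {0..1}. (c' 1, s t) \<in>
            {(u, v). u \<in> topspace S \<and> v \<in> topspace S \<and> (\<rho> u, \<rho> v) \<in> R1}) \<and> (s 1, c' 0) \<in> N))"
    by auto
  obtain n where n: "\<And>u v. u \<in> topspace S \<Longrightarrow> v \<in> topspace S \<Longrightarrow> u n = v n \<Longrightarrow> (u, v) \<in> N1"
    by (rule level_entourage[OF N1(1)]) blast
  obtain m where m: "\<And>i. \<exists>g v. pathin Y g \<and> g 0 = \<rho> x \<and> g 1 = \<rho> x \<and> lifts_to (T i) (r i) g (x i) (x i) \<and>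
      v \<in> topspace S \<and> v n = x n \<and> \<not> lifts_to (T m) (r m) g (v m) (v m)"
    using irregular[of n] by blast
  \<comment> \<open>The precision demanded of the second path is closeness along the sheets at level
    \<open>m\<close>, so that the remaining gap can be bridged by a path there.\<close>
  let ?E = "\<Union>{U \<times> U |U. openin (T m) U \<and> path_connectedin (T m) U \<and> r m ` U \<times> r m ` U \<subseteq> R1}"
  have "entourage S {(u, v). u \<in> topspace S \<and> v \<in> topspace S \<and> (u m, v m) \<in> ?E}"
    by (rule entourage_vimage[OF coord_continuous entourage_leafwise[OF R(3)]])
  from N1(2)[OF this] obtain N3 where N3: "entourage S N3"
    "\<And>c c'. pathin S c \<and> pathin S c' \<and> (\<forall>t \<in> {0..1}. (c t, c' t) \<in> N1) \<and> (c 0, c 1) \<in> N3 \<Longrightarrow>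
         \<exists>s. pathin S s \<and> s 0 = c' 1 \<and> (\<forall>t \<in> {0..1}. (c' 1, s t) \<in>
            {(u, v). u \<in> topspace S \<and> v \<in> topspace S \<and> (\<rho> u, \<rho> v) \<in> R1}) \<and>
            (s 1, c' 0) \<in> {(u, v). u \<in> topspace S \<and> v \<in> topspace S \<and> (u m, v m) \<in> ?E}"
    by auto
  obtain i where i: "\<And>u v. u \<in> topspace S \<Longrightarrow> v \<in> topspace S \<Longrightarrow> u i = v i \<Longrightarrow> (u, v) \<in> N3"
    by (rule level_entourage[OF N3(1)]) blast
  obtain g v where g: "pathin Y g" "g 0 = \<rho> x" "g 1 = \<rho> x" "lifts_to (T i) (r i) g (x i) (x i)"
    and v: "v \<in> topspace S" "v n = x n" "\<not> lifts_to (T m) (r m) g (v m) (v m)"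
    using m[of i] by blast
  have "\<rho> x = g 0" using g(2) by simp
  then obtain c where c: "pathin S c" "c 0 = x" "\<And>t. t \<in> {0..1} \<Longrightarrow> \<rho> (c t) = g t"
    by (rule path_lift_limit[OF g(1) x]) blast
  have "\<rho> v = g 0" using r_coord[OF v(1), of n] r_coord[OF x, of n] v(2) g(2) by simp
  then obtain c' where c': "pathin S c'" "c' 0 = v" "\<And>t. t \<in> {0..1} \<Longrightarrow> \<rho> (c' t) = g t"
    by (rule path_lift_limit[OF g(1) v(1)]) blast
  have "(c t, c' t) \<in> N1" if t: "t \<in> {0..1}" for t
  proof (rule n[OF pathin_in_topspace[OF c(1) t] pathin_in_topspace[OF c'(1) t]])
    show "c t n = c' t n"
    proof (rule path_lift_unique[OF covr pathin_coord[OF c(1)] pathin_coord[OF c'(1)] _ _ t])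
      show "r n (c t n) = r n (c' t n)" if t: "t \<in> {0..1}" for t
        using r_coord[OF pathin_in_topspace[OF c(1) t], of n] r_coord[OF pathin_in_topspace[OF c'(1) t], of n]
          c(3)[OF t] c'(3)[OF t] by simp
      show "c 0 n = c' 0 n" using c(2) c'(2) v(2) by simp
    qed
  qed
  moreover have "(c 0, c 1) \<in> N3"
  proof (rule i[OF path_start_in_topspace[OF c(1)] path_finish_in_topspace[OF c(1)]])
    have "lifts_to (T i) (r i) g (c 0 i) (c 1 i)" by (rule lifts_to_coord[OF c(1,3)])
    then show "c 0 i = c 1 i" using lifts_to_unique[OF covr _ g(4)] c(2) by metis
  qed
  ultimately obtain s where s: "pathin S s" "s 0 = c' 1" "\<And>t. t \<in> {0..1} \<Longrightarrow> (\<rho> (c' 1), \<rho> (s t)) \<in> R1"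
    "(s 1 m, c' 0 m) \<in> ?E"
    using N3(2)[of c c'] c(1) c'(1) by blast
  define a where "a = \<rho> (c' 1)"
  have c'1: "c' 1 \<in> topspace S" by (rule path_finish_in_topspace[OF c'(1)])
  have a: "a = \<rho> x" "a \<in> topspace Y"
    using c'(3)[of 1] g(3) path_finish_in_topspace[OF pathin_continuous_image[OF c'(1) \<rho>_continuous]]
    by (simp_all add: a_def)
  let ?C = "path_component_of (subtopology (T m) {z. r m z \<in> R0 `` {a}})"
  from s(4) obtain U where U: "openin (T m) U" "path_connectedin (T m) U" "r m ` U \<times> r m ` U \<subseteq> R1"
    "s 1 m \<in> U" "v m \<in> U" using c'(2) by blast
  have sT: "s t \<in> topspace S" if "t \<in> {0..1}" for t by (rule pathin_in_topspace[OF s(1) that])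
  have sR1: "(a, r m (s t m)) \<in> R1" if t: "t \<in> {0..1}" for t
    using s(3)[OF t] r_coord[OF sT[OF t], of m] by (simp add: a_def)
  have "?C (s 0 m) (s 1 m)"
    by (rule path_component_of_segment[OF pathin_coord[OF s(1)]])
      (use sR1 R(5) in \<open>auto simp: closed_segment_eq_real_ivl\<close>)
  moreover have "?C (s 1 m) (v m)"
  proof -
    have "U \<subseteq> {z. r m z \<in> R0 `` {a}}"
    proof
      fix z assume "z \<in> U"
      then have "(r m (s 1 m), r m z) \<in> R1" using U(3,4) by blast
      then show "z \<in> {z. r m z \<in> R0 `` {a}}" using sR1[of 1] R(4) by auto
    qed
    then have "path_connectedin (subtopology (T m) {z. r m z \<in> R0 `` {a}}) U"
      using U(2) by (simp add: path_connectedin_subtopology)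
    then show ?thesis unfolding path_component_of using U(4,5) by (intro exI[of _ U]) simp
  qed
  ultimately have "?C (c' 1 m) (v m)" unfolding s(2) by (rule path_component_of_trans)
  moreover have "r m (c' 1 m) = r m (v m)"
    using r_coord[OF c'1, of m] r_coord[OF v(1), of m] a \<open>\<rho> v = g 0\<close> g(2) by (simp add: a_def)
  ultimately have "c' 1 m = v m" using R(2)[OF a(2), of m] unfolding good_over_def by metis
  moreover have "lifts_to (T m) (r m) g (c' 0 m) (c' 1 m)" by (rule lifts_to_coord[OF c'(1,3)])
  ultimately show False using v(3) c'(2) by simp
qed

end


section \<open>The monodromy of a solenoid\<close>

text \<open>Change of base point: transport along \<open>\<alpha>\<close> carries the stabilizer of
  \<open>f\<close> to that of \<open>f1\<close>. The converse direction follows the lift piece by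
  piece and uses uniqueness.\<close>

lemma lifts_to_conj_loop:
  assumes cov: "covering_map Z Y q" and \<alpha>: "pathin Y \<alpha>" and l: "pathin Y l" "l 0 = \<alpha> 1" "l 1 = \<alpha> 1"
    and f: "lifts_to Z q \<alpha> f f1"
  shows "lifts_to Z q (path_concat (path_concat \<alpha> l) (\<lambda>t. \<alpha> (1 - t))) f f \<longleftrightarrow> lifts_to Z q l f1 f1"
    (is "lifts_to Z q ?c f f \<longleftrightarrow> _")
proof
  have rev: "lifts_to Z q (\<lambda>t. \<alpha> (1 - t)) f1 f" by (rule lifts_to_reverse[OF f])
  show "lifts_to Z q ?c f f" if "lifts_to Z q l f1 f1"
    by (rule lifts_to_concat[OF lifts_to_concat[OF f that] rev])
  assume c: "lifts_to Z q ?c f f"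
  have f1: "f1 \<in> topspace Z" "q f1 = l 0" using lifts_to_in_topspace[OF f] lifts_to_ends[OF f] l(2) by auto
  obtain f2 where f2: "lifts_to Z q l f1 f2" using lifts_to_exists[OF cov l(1) f1] by blast
  have "f2 \<in> topspace Z" "q f2 = \<alpha> (1 - 0)" using lifts_to_in_topspace[OF f2] lifts_to_ends[OF f2] l(3) by auto
  then obtain f3 where f3: "lifts_to Z q (\<lambda>t. \<alpha> (1 - t)) f2 f3"
    using lifts_to_exists[OF cov pathin_reverse[OF \<alpha>]] by blast
  have "f3 = f" by (rule lifts_to_unique[OF cov lifts_to_concat[OF lifts_to_concat[OF f f2] f3] c])
  then have "lifts_to Z q \<alpha> f f2" using lifts_to_reverse[OF f3] by simp
  then have "f2 = f1" by (rule lifts_to_unique[OF cov _ f])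
  with f2 show "lifts_to Z q l f1 f1" by simp
qed

lemma continuous_map_inverse_limit:
  "continuous_map X (inverse_limit_space T \<phi>) f \<longleftrightarrow>
     (\<forall>i. continuous_map X (T i) (\<lambda>x. f x i)) \<and> (\<forall>x \<in> topspace X. \<forall>i. \<phi> i (f x (Suc i)) = f x i)"
  unfolding inverse_limit_space_def continuous_map_in_subtopology continuous_map_componentwise_UNIV by auto

locale solenoid =
  fixes M :: "nat \<Rightarrow> 'a topology" and p :: "nat \<Rightarrow> 'a \<Rightarrow> 'a" and x0 :: 'a and x :: "nat \<Rightarrow> 'a"
  assumes tower: "weak_solenoid_tower M p"
    and base: "x0 \<in> topspace (M 0)"
    and basepoint: "x \<in> solenoid_fiber M p x0"
begin

abbreviation "q \<equiv> tower_proj p"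
abbreviation "G \<equiv> fundamental_group (M 0) x0"
abbreviation "Gs \<equiv> monodromy_chain M p x"

lemma manifold: "closed_manifold (M 0)"
  using tower by (simp add: weak_solenoid_tower_def)

lemma M0: "compact_space (M 0)" "Hausdorff_space (M 0)" "locally_path_connected_space (M 0)"
  using manifold closed_manifold_locally_path_connected by (auto simp: closed_manifold_def)

lemma covq: "finite_covering_map (M i) (M 0) (q i)"
  by (rule finite_covering_tower_proj[OF tower])

lemma cq: "covering_map (M i) (M 0) (q i)"
  by (rule finite_covering_map_imp_covering_map[OF covq])

lemma p_continuous: "continuous_map (M (Suc i)) (M i) (p i)"
  using tower by (simp add: weak_solenoid_tower_def finite_covering_map_def covering_map_def)

lemma M_lpc: "locally_path_connected_space (M i)"
  by (rule covering_locally_path_connected[OF cq M0(3)])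

lemma M_path: "path_connected_space (M i)"
  using tower M_lpc path_connected_eq_connected_space by (auto simp: weak_solenoid_tower_def)

sublocale limit: covering_tower "M 0" M p q
proof
  show "\<exists>B. openin (M 0) B \<and> y \<in> B \<and> B \<subseteq> W \<and> path_connectedin (M 0) B \<and> (\<forall>i. good_over (M i) (q i) B)"
    if "openin (M 0) W" "y \<in> W" for W y
    by (rule closed_manifold_good_basis[of "M 0" M q W y, OF manifold cq that]) blast
qed (use M0 covq p_continuous in auto)

lemma xS: "x \<in> topspace limit.S" and x_0: "x 0 = x0"
  using basepoint by (auto simp: solenoid_fiber_def)

lemma xM: "x i \<in> topspace (M i)"
  by (rule limit.S_in_T[OF xS])

lemma qx: "q i (x i) = x0"
  using limit.r_coord[OF xS, of i] x_0 by simp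

sublocale level: pointed_covering "M i" "M 0" "q i" "x i" x0 for i
  by unfold_locales (use covq M0 M_path xM qx in auto)

sublocale group G
  by (rule level.group_G)

lemma Gs_eq: "Gs i = fundamental_group_image (M i) (x i) (M 0) (q i)"
  by (simp add: monodromy_chain_def)

lemma Gs_subgroup: "subgroup (Gs i) G" and Gs_finite: "finite (rcosets\<^bsub>G\<^esub> (Gs i))"
  unfolding Gs_eq by (rule level.subgroup_image, rule level.finite_index_image)

lemma lifts_to_down:
  "lifts_to (M (Suc i)) (q (Suc i)) g e e' \<Longrightarrow> lifts_to (M i) (q i) g (p i e) (p i e')"
  unfolding lifts_to_def
  by (elim exE, rule_tac x = "\<lambda>t. p i (d t)" in exI) (auto intro: pathin_continuous_image[OF _ p_continuous])

lemma Gs_decreasing: "Gs (Suc i) \<subseteq> Gs i"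
proof
  fix A assume A: "A \<in> Gs (Suc i)"
  then have "A \<in> carrier G" using subgroup.subset[OF Gs_subgroup] by blast
  then obtain g where g: "loop_at (M 0) x0 g" "A = loop_class (M 0) x0 g" by (rule fundamental_group_carrierE)
  then have "lifts_to (M (Suc i)) (q (Suc i)) g (x (Suc i)) (x (Suc i))"
    using A level.loop_class_in_image[OF g(1), of "Suc i"] by (simp add: Gs_eq del: tower_proj.simps)
  from lifts_to_down[OF this] have "lifts_to (M i) (q i) g (x i) (x i)"
    using limit.S_coherent[OF xS] by simp
  then show "A \<in> Gs i" using g level.loop_class_in_image[OF g(1)] by (simp add: Gs_eq)
qed

text \<open>The conjugates of \<open>Gs m\<close> are the stabilizers of the other points of the
  fiber; all points occur because \<open>M m\<close> is path connected. The core is therefore the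
  kernel of the action on the fiber.\<close>

lemma in_normal_core:
  assumes g: "loop_at (M 0) x0 g"
  shows "loop_class (M 0) x0 g \<in> normal_core G (Gs m) \<longleftrightarrow>
    (\<forall>e \<in> topspace (M m). q m e = x0 \<longrightarrow> lifts_to (M m) (q m) g e e)"
proof -
  note iff = normal_core_iff[OF subgroup.subset[OF Gs_subgroup], of "loop_class (M 0) x0 g" m]
  show ?thesis
  proof
    assume "loop_class (M 0) x0 g \<in> normal_core G (Gs m)"
    then have c: "\<And>A. A \<in> carrier G \<Longrightarrow> inv\<^bsub>G\<^esub> A \<otimes>\<^bsub>G\<^esub> loop_class (M 0) x0 g \<otimes>\<^bsub>G\<^esub> A \<in> Gs m" using iff by blast
    show "\<forall>e \<in> topspace (M m). q m e = x0 \<longrightarrow> lifts_to (M m) (q m) g e e"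
    proof (intro ballI impI)
      fix e assume e: "e \<in> topspace (M m)" "q m e = x0"
      obtain h where h: "loop_at (M 0) x0 h" "lifts_to (M m) (q m) h (x m) e" by (rule level.fiber_reached[OF e])
      have "lifts_to (M m) (q m) (\<lambda>t. (\<lambda>t. h (1 - t)) (1 - t)) (x m) e" using h(2) by simp
      from level.loop_class_in_conjugate[OF g loop_at_reverse[OF h(1)] this]
      show "lifts_to (M m) (q m) g e e"
        using c[OF loop_class_in_carrier[OF loop_at_reverse[OF h(1)]]] by (simp add: Gs_eq)
    qed
  next
    assume all: "\<forall>e \<in> topspace (M m). q m e = x0 \<longrightarrow> lifts_to (M m) (q m) g e e"
    have "inv\<^bsub>G\<^esub> A \<otimes>\<^bsub>G\<^esub> loop_class (M 0) x0 g \<otimes>\<^bsub>G\<^esub> A \<in> Gs m" if A: "A \<in> carrier G" for A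
    proof -
      obtain h where h: "loop_at (M 0) x0 h" "A = loop_class (M 0) x0 h" using A by (rule fundamental_group_carrierE)
      obtain e where e: "lifts_to (M m) (q m) (\<lambda>t. h (1 - t)) (x m) e"
        using level.loop_lift_exists[OF loop_at_reverse[OF h(1)] xM qx] by blast
      have "q m e = x0" using lifts_to_ends[OF e] h(1) by (simp add: loop_at_def)
      then have "lifts_to (M m) (q m) g e e" using all lifts_to_in_topspace[OF e] by blast
      then show ?thesis using level.loop_class_in_conjugate[OF g h(1) e] h(2) by (simp add: Gs_eq)
    qed
    then show "loop_class (M 0) x0 g \<in> normal_core G (Gs m)" using iff loop_class_in_carrier[OF g] by blast
  qed
qed

text \<open>A conjugating element in \<open>Gs n\<close> moves \<open>x\<close> to a point
  \<open>v\<close> of the fiber that agrees with \<open>x\<close> at level n, and conjugation by it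
  becomes transport from \<open>x\<close> to \<open>v\<close>.\<close>

theorem not_stable_return_if_not_weakly_normal:
  assumes nwn: "\<not> weakly_normal_chain G Gs"
  shows "\<not> stable_return limit.S"
proof (rule limit.not_stable_return_limit[OF xS])
  fix n
  obtain m where m: "\<And>i. \<exists>k \<in> Gs i. \<exists>h \<in> Gs n. inv\<^bsub>G\<^esub> h \<otimes>\<^bsub>G\<^esub> k \<otimes>\<^bsub>G\<^esub> h \<notin> Gs m"
    using not_weakly_normal_chainD[OF Gs_subgroup Gs_finite Gs_decreasing nwn, of n] by blast
  show "\<exists>m. \<forall>i. \<exists>g v. pathin (M 0) g \<and> g 0 = q 0 (x 0) \<and> g 1 = q 0 (x 0) \<and> lifts_to (M i) (q i) g (x i) (x i) \<and>
      v \<in> topspace limit.S \<and> v n = x n \<and> \<not> lifts_to (M m) (q m) g (v m) (v m)"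
  proof (intro exI[of _ m] allI)
    fix i
    obtain K H where KH: "K \<in> Gs i" "H \<in> Gs n" "inv\<^bsub>G\<^esub> H \<otimes>\<^bsub>G\<^esub> K \<otimes>\<^bsub>G\<^esub> H \<notin> Gs m" using m by blast
    have "K \<in> carrier G" "H \<in> carrier G" using KH subgroup.subset[OF Gs_subgroup] by blast+
    then obtain g h where g: "loop_at (M 0) x0 g" "K = loop_class (M 0) x0 g"
      and h: "loop_at (M 0) x0 h" "H = loop_class (M 0) x0 h"
      by (elim fundamental_group_carrierE)
    have "q 0 (x 0) = (\<lambda>t. h (1 - t)) 0" using h(1) x_0 by (simp add: loop_at_def)
    \<comment> \<open>The end of the lift of the reversed \<open>h\<close> is the required
      \<open>v\<close>. It equals \<open>x\<close> at level \<open>n\<close> since \<open>H\<close>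
      lies in \<open>Gs n\<close>, and \<open>g\<close> is not closed there at level
      \<open>m\<close> since the conjugate of \<open>K\<close> is outside
      \<open>Gs m\<close>.\<close>
    then obtain d where d: "pathin limit.S d" "d 0 = x" "\<And>t. t \<in> {0..1} \<Longrightarrow> q 0 (d t 0) = (\<lambda>t. h (1 - t)) t"
      using limit.path_lift_limit[of "\<lambda>t. h (1 - t)" x] h(1) xS by (auto simp: loop_at_def pathin_reverse)
    have dl: "lifts_to (M j) (q j) (\<lambda>t. h (1 - t)) (x j) (d 1 j)" for j
      using limit.lifts_to_coord[OF d(1,3), of j] d(2) by simp
    have "lifts_to (M n) (q n) h (x n) (x n)"
      using KH(2) h level.loop_class_in_image[OF h(1)] by (simp add: Gs_eq)
    then have "lifts_to (M n) (q n) (\<lambda>t. h (1 - t)) (x n) (x n)" by (rule lifts_to_reverse)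
    then have "d 1 n = x n" by (rule lifts_to_unique[OF cq dl])
    moreover have "\<not> lifts_to (M m) (q m) g (d 1 m) (d 1 m)"
      using KH(3) level.loop_class_in_conjugate[OF g(1) h(1) dl] by (simp add: Gs_eq g(2) h(2))
    moreover have "lifts_to (M i) (q i) g (x i) (x i)"
      using KH(1) g level.loop_class_in_image[OF g(1)] by (simp add: Gs_eq)
    ultimately show "\<exists>g v. pathin (M 0) g \<and> g 0 = q 0 (x 0) \<and> g 1 = q 0 (x 0) \<and> lifts_to (M i) (q i) g (x i) (x i) \<and>
        v \<in> topspace limit.S \<and> v n = x n \<and> \<not> lifts_to (M m) (q m) g (v m) (v m)"
      using g(1) x_0 path_finish_in_topspace[OF d(1)]
      by (intro exI[of _ g] exI[of _ "d 1"]) (auto simp: loop_at_def)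
  qed
qed

text \<open>The points of the fiber are adjoined one at a time, passing to a component of a fiber product.\<close>

lemma trivializing_covering:
  assumes "finite A" "A \<subseteq> {e \<in> topspace (M n). q n e = x0}"
  shows "\<exists>(N :: ('a \<times> nat) topology) p0 b. finite_covering_map N (M 0) p0 \<and> connected_space N \<and>
    b \<in> topspace N \<and> p0 b = x0 \<and> (\<forall>g. lifts_to N p0 g b b \<longrightarrow> (\<forall>e \<in> A. lifts_to (M n) (q n) g e e))"
  using assms
proof (induction A rule: finite_induct)
  case empty
  \<comment> \<open>With no points to treat, a copy of \<open>M 0\<close> on the prescribed type is
    enough.\<close>
  obtain N :: "('a \<times> nat) topology" and f where f: "homeomorphic_map N (M 0) f"
    by (rule finite_covering_relabel[OF covq[of 0]])
  have "x0 \<in> f ` topspace N" using homeomorphic_imp_surjective_map[OF f] base by simp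
  then obtain b where "b \<in> topspace N" "f b = x0" by blast
  moreover have "connected_space N"
    using homeomorphic_connected_space[OF homeomorphic_map_imp_homeomorphic_space[OF f]] tower
    by (simp add: weak_solenoid_tower_def)
  ultimately show ?case using homeomorphic_map_finite_covering[OF f]
    by (intro exI[of _ N] exI[of _ f] exI[of _ b]) simp
next
  case (insert e A)
  then obtain N :: "('a \<times> nat) topology" and p0 b where N: "finite_covering_map N (M 0) p0" "connected_space N"
    "b \<in> topspace N" "p0 b = x0" "\<forall>g. lifts_to N p0 g b b \<longrightarrow> (\<forall>e \<in> A. lifts_to (M n) (q n) g e e)" by auto
  have e: "e \<in> topspace (M n)" "q n e = x0" using insert.prems by auto
  note cN = finite_covering_map_imp_covering_map[OF N(1)]
  \<comment> \<open>A lift that is closed at \<open>(e, b)\<close> projects to closed lifts at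
    \<open>e\<close> and at \<open>b\<close>; the latter gives the points already treated.\<close>
  let ?F = "fiber_product (M n) N (q n) p0"
  let ?X = "subtopology ?F (connected_component_of_set ?F (e, b))"
  have eb: "(e, b) \<in> topspace ?F" using e N(3,4) by (simp add: topspace_fiber_product)
  have "finite_covering_map ?F N snd" by (rule finite_covering_pullback[OF covq covering_map_continuous[OF cN]])
  then have "finite_covering_map ?X N snd"
    by (rule finite_covering_component[OF _ N(2) covering_locally_path_connected[OF cN M0(3)] eb])
  then have X: "finite_covering_map ?X (M 0) (p0 \<circ> snd)" by (rule finite_covering_compose[OF _ N(1)])
  obtain N' :: "('a \<times> nat) topology" and f where f: "homeomorphic_map N' ?X f"
    by (rule finite_covering_relabel[OF X])
  have N': "finite_covering_map N' (M 0) ((p0 \<circ> snd) \<circ> f)"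
    by (rule finite_covering_compose[OF homeomorphic_map_finite_covering[OF f] X])
  have "connected_space ?X"
    using connectedin_connected_component_of[of ?F "(e, b)"] by (simp add: connectedin_def)
  then have conn: "connected_space N'"
    using homeomorphic_connected_space[OF homeomorphic_map_imp_homeomorphic_space[OF f]] by simp
  have "(e, b) \<in> topspace ?X" using eb by (simp add: connected_component_of_refl)
  then have "(e, b) \<in> f ` topspace N'" using homeomorphic_imp_surjective_map[OF f] by simp
  then obtain b' where b': "b' \<in> topspace N'" "f b' = (e, b)" by (metis imageE)
  have "lifts_to (M n) (q n) g e' e'" if g: "lifts_to N' ((p0 \<circ> snd) \<circ> f) g b' b'" and e': "e' \<in> insert e A" for g e'
  proof -
    obtain d where d: "pathin N' d" "d 0 = b'" "d 1 = b'" "\<And>t. t \<in> {0..1} \<Longrightarrow> p0 (snd (f (d t))) = g t"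
      using g by (auto simp: lifts_to_def)
    have "pathin ?X (\<lambda>t. f (d t))" by (rule pathin_continuous_image[OF d(1) homeomorphic_imp_continuous_map[OF f]])
    then have fd: "pathin ?F (\<lambda>t. f (d t))" by (simp add: pathin_subtopology)
    have p1: "pathin (M n) (\<lambda>t. fst (f (d t)))" by (rule pathin_continuous_image[OF fd fiber_product_continuous_fst])
    have p2: "pathin N (\<lambda>t. snd (f (d t)))" by (rule pathin_continuous_image[OF fd fiber_product_continuous_snd])
    have "lifts_to N p0 g b b" unfolding lifts_to_def
      by (rule exI[of _ "\<lambda>t. snd (f (d t))"]) (use p2 d b' in simp)
    moreover have "q n (fst (f (d t))) = g t" if t: "t \<in> {0..1}" for t
      using pathin_in_topspace[OF fd t] d(4)[OF t] by (auto simp: topspace_fiber_product)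
    then have "lifts_to (M n) (q n) g e e" unfolding lifts_to_def
      by (intro exI[of _ "\<lambda>t. fst (f (d t))"]) (use p1 d b' in simp)
    ultimately show ?thesis using N(5) e' by blast
  qed
  moreover have "((p0 \<circ> snd) \<circ> f) b' = x0" using b'(2) N(4) by simp
  ultimately show ?case using N' conn b'(1) by blast
qed

end


section \<open>Pullback solenoids\<close>

locale pulled_back_solenoid = solenoid M p x0 x
  for M :: "nat \<Rightarrow> 'a topology" and p :: "nat \<Rightarrow> 'a \<Rightarrow> 'a" and x0 :: 'a and x :: "nat \<Rightarrow> 'a" +
  fixes N :: "'b topology" and p0 :: "'b \<Rightarrow> 'a" and b :: 'b
  assumes cov0: "finite_covering_map N (M 0) p0" and N_conn: "connected_space N"
    and bN: "b \<in> topspace N" and p0b: "p0 b = x0"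
begin

abbreviation "F i \<equiv> fiber_product (M i) N (q i) p0"
abbreviation "K i \<equiv> connected_component_of_set (F i) (x i, b)"
abbreviation "T \<equiv> pullback_tower M p x N p0 b"
abbreviation "\<phi> \<equiv> (\<lambda>i (y, z). (p i y, z)) :: nat \<Rightarrow> 'a \<times> 'b \<Rightarrow> 'a \<times> 'b"

lemma c0: "covering_map N (M 0) p0"
  by (rule finite_covering_map_imp_covering_map[OF cov0])

lemma N_lpc: "locally_path_connected_space N"
  by (rule covering_locally_path_connected[OF c0 M0(3)])

lemma N_path: "path_connected_space N"
  using N_conn N_lpc path_connected_eq_connected_space by blast

lemma T_eq: "T i = subtopology (F i) (K i)"
  by (simp add: pullback_tower_def Let_def)

lemma xbF: "(x i, b) \<in> topspace (F i)"
  using xM qx bN p0b by (simp add: topspace_fiber_product)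

lemma K_subset: "K i \<subseteq> topspace (F i)"
  by (rule connected_component_of_subset_topspace)

lemma topspace_T: "topspace (T i) = K i"
  using K_subset by (auto simp: T_eq)

lemma covF: "finite_covering_map (F i) N snd"
  by (rule finite_covering_pullback[OF covq covering_map_continuous[OF c0]])

lemma covT: "finite_covering_map (T i) N snd"
  unfolding T_eq by (rule finite_covering_component[OF covF N_conn N_lpc xbF])

lemma K_connected:
  assumes C: "connectedin (F i) C" and e: "e \<in> C" "e \<in> K i"
  shows "C \<subseteq> K i"
proof -
  have "C \<subseteq> connected_component_of_set (F i) e" by (rule connected_component_of_maximal[OF C e(1)])
  also have "\<dots> = K i" using e(2) connected_component_of_equiv[of "F i" "(x i, b)" e] by simp
  finally show ?thesis .
qed

lemma K_path:
  assumes d: "pathin (F i) d" and "s \<in> {0..1}" "t \<in> {0..1}" "d s \<in> K i"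
  shows "d t \<in> K i"
  using K_connected[OF connectedin_path_image[OF d], of "d s"] assms by blast

lemma pathin_F:
  assumes "pathin (M i) d" "pathin N k" "\<And>t. t \<in> {0..1} \<Longrightarrow> q i (d t) = p0 (k t)"
  shows "pathin (F i) (\<lambda>t. (d t, k t))"
  using assms unfolding fiber_product_def pathin_subtopology
  by (auto simp: pathin_def continuous_map_pairedI)

lemma \<phi>_F: "continuous_map (F (Suc i)) (F i) (\<phi> i)"
proof -
  have "continuous_map (F (Suc i)) (prod_topology (M i) N) (\<lambda>w. (p i (fst w), snd w))"
    using continuous_map_compose[OF fiber_product_continuous_fst p_continuous]
    by (intro continuous_map_pairedI fiber_product_continuous_snd) (simp add: o_def)
  then have "continuous_map (F (Suc i)) (F i) (\<lambda>w. (p i (fst w), snd w))"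
    unfolding fiber_product_def[of "M i"] by (auto simp: continuous_map_in_subtopology topspace_fiber_product)
  then show ?thesis by (simp add: case_prod_unfold)
qed

text \<open>The bonding map takes the base point to the base point and connected sets to connected
  sets.\<close>

lemma \<phi>_K: "w \<in> K (Suc i) \<Longrightarrow> \<phi> i w \<in> K i"
proof -
  assume w: "w \<in> K (Suc i)"
  have "connectedin (F i) (\<phi> i ` K (Suc i))"
    by (rule connectedin_continuous_map_image[OF \<phi>_F connectedin_connected_component_of])
  moreover have "(x (Suc i), b) \<in> K (Suc i)" using xbF[of "Suc i"] by (simp only: mem_Collect_eq connected_component_of_refl)
  then have "\<phi> i (x (Suc i), b) \<in> \<phi> i ` K (Suc i)" by (rule imageI)
  then have "(x i, b) \<in> \<phi> i ` K (Suc i)" using limit.S_coherent[OF xS] by simp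
  moreover have "(x i, b) \<in> K i" using xbF by (simp add: connected_component_of_refl)
  ultimately have "\<phi> i ` K (Suc i) \<subseteq> K i" by (rule K_connected)
  then show ?thesis using w by blast
qed

text \<open>A basic set of \<open>M 0\<close> that is good for all composed coverings
  \<open>p0 \<circ> snd\<close> is carried to \<open>N\<close> by a local section of
  \<open>p0\<close>; a path over its image is in particular a path over the set itself.\<close>

lemma T_good_basis:
  assumes W: "openin N W" "z \<in> W"
  shows "\<exists>B. openin N B \<and> z \<in> B \<and> B \<subseteq> W \<and> path_connectedin N B \<and> (\<forall>i. good_over (T i) snd B)"
proof -
  obtain V s where V: "openin (M 0) V" "p0 z \<in> V" "continuous_map (subtopology (M 0) V) N s"
    "s (p0 z) = z" "\<And>v. v \<in> V \<Longrightarrow> s v \<in> W \<and> p0 (s v) = v"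
    "\<And>V'. openin (M 0) V' \<Longrightarrow> V' \<subseteq> V \<Longrightarrow> openin N (s ` V')"
    by (rule covering_local_section[OF c0 W]) blast
  have "covering_map (T i) (M 0) (p0 \<circ> snd)" for i
    by (rule finite_covering_map_imp_covering_map[OF finite_covering_compose[OF covT cov0]])
  from closed_manifold_good_basis[of "M 0" T "\<lambda>i. p0 \<circ> snd", OF manifold this V(1,2)]
  obtain B where B: "openin (M 0) B" "p0 z \<in> B" "B \<subseteq> V" "path_connectedin (M 0) B"
    "\<And>i. good_over (T i) (p0 \<circ> snd) B" by blast
  have "path_connectedin (subtopology (M 0) V) B" using B(3,4) by (simp add: path_connectedin_subtopology)
  then have "path_connectedin N (s ` B)" by (rule path_connectedin_continuous_map_image[OF V(3)])
  moreover have "good_over (T i) snd (s ` B)" for i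
    unfolding good_over_def
  proof (intro allI impI)
    fix e e' assume e: "path_component_of (subtopology (T i) {z. snd z \<in> s ` B}) e e'" "snd e = snd e'"
    have "{z. snd z \<in> s ` B} \<subseteq> {z. (p0 \<circ> snd) z \<in> B}" using V(5) B(3) by auto
    from path_component_of_mono[OF e(1) this] have "path_component_of (subtopology (T i) {z. (p0 \<circ> snd) z \<in> B}) e e'" .
    moreover have "(p0 \<circ> snd) e = (p0 \<circ> snd) e'" using e(2) by simp
    ultimately show "e = e'" using B(5)[of i, unfolded good_over_def] by blast
  qed
  moreover have "openin N (s ` B)" by (rule V(6)[OF B(1,3)])
  moreover have "z \<in> s ` B" using B(2) V(4) by (metis imageI)
  moreover have "s ` B \<subseteq> W" using V(5) B(3) by blast
  ultimately show ?thesis by blast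
qed

sublocale pullback: covering_tower N T \<phi> "\<lambda>i. snd"
proof
  show "compact_space N" by (rule finite_covering_compact[OF cov0 M0(1)])
  show "Hausdorff_space N" by (rule covering_Hausdorff[OF c0 M0(2)])
  show "continuous_map (T (Suc i)) (T i) (\<phi> i)" for i
    unfolding T_eq continuous_map_in_subtopology
    using continuous_map_from_subtopology[OF \<phi>_F] \<phi>_K by auto
qed (use covT T_good_basis in auto)

lemma pullback_solenoid_eq: "pullback_solenoid M p x N p0 b = pullback.S"
  by (simp add: pullback_solenoid_def)

text \<open>A loop of \<open>N\<close> is conjugated to the base point; since it is closed in
  \<open>N\<close>, it acts trivially on the fiber at level n, so its class lies in the core. A
  second conjugation makes it closed at \<open>x i\<close>, and normality keeps it in the core. The
  inclusion \<open>regular\<close> then applies, and both conjugations are undone at level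
  m.\<close>

theorem stable_return_pullback:
  assumes regular: "\<And>m. \<exists>i. Gs i \<inter> normal_core G (Gs n) \<subseteq> normal_core G (Gs m)"
    and triv: "\<And>g e. lifts_to N p0 g b b \<Longrightarrow> e \<in> topspace (M n) \<Longrightarrow> q n e = x0 \<Longrightarrow> lifts_to (M n) (q n) g e e"
  shows "stable_return pullback.S"
proof (rule pullback.stable_return_limit)
  fix m
  obtain i where i: "Gs i \<inter> normal_core G (Gs n) \<subseteq> normal_core G (Gs m)" using regular by blast
  have "lifts_to (T m) snd g e' e'"
    if g: "pathin N g" "g 0 = g 1" "lifts_to (T i) snd g e e" and e': "e' \<in> topspace (T m)" "snd e' = g 0" for g e e'
  proof -
    define l where "l = (\<lambda>t. p0 (g t))"
    have l: "pathin (M 0) l" "l 0 = l 1"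
      using pathin_continuous_image[OF g(1) covering_map_continuous[OF c0]] g(2) by (simp_all add: l_def)
    obtain d where d: "pathin (T i) d" "d 0 = e" "d 1 = e" "\<And>t. t \<in> {0..1} \<Longrightarrow> snd (d t) = g t"
      using g(3) by (auto simp: lifts_to_def)
    have dF: "pathin (F i) d" using d(1) by (simp add: T_eq pathin_subtopology)
    have li: "lifts_to (M i) (q i) l (fst e) (fst e)"
      unfolding lifts_to_def
    proof (intro exI[of _ "\<lambda>t. fst (d t)"] conjI ballI)
      show "pathin (M i) (\<lambda>t. fst (d t))" by (rule pathin_continuous_image[OF dF fiber_product_continuous_fst])
      fix t :: real assume t: "t \<in> {0..1}"
      show "q i (fst (d t)) = l t"
        using pathin_in_topspace[OF dF t] d(4)[OF t] by (auto simp: topspace_fiber_product l_def)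
    qed (use d in auto)
    have gN: "g 0 \<in> topspace N" by (rule path_start_in_topspace[OF g(1)])
    obtain k where k: "pathin N k" "k 0 = b" "k 1 = g 0"
      using N_path[unfolded path_connected_space_def, rule_format, OF bN gN] by (elim exE conjE)
    define \<kappa> where "\<kappa> = (\<lambda>t. p0 (k t))"
    have \<kappa>: "pathin (M 0) \<kappa>" "\<kappa> 0 = x0" "\<kappa> 1 = l 0"
      using pathin_continuous_image[OF k(1) covering_map_continuous[OF c0]] k p0b by (simp_all add: \<kappa>_def l_def)
    have l\<kappa>: "l 0 = \<kappa> 1" "l 1 = \<kappa> 1" using \<kappa>(3) l(2) by simp_all
    \<comment> \<open>Conjugation along a path in \<open>N\<close> from \<open>b\<close>, so that
      the loop obtained is closed at \<open>b\<close> and \<open>triv\<close> applies.\<close>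
    define \<omega> where "\<omega> = path_concat (path_concat \<kappa> l) (\<lambda>t. \<kappa> (1 - t))"
    have \<omega>: "loop_at (M 0) x0 \<omega>"
      unfolding loop_at_def \<omega>_def using \<kappa> l l\<kappa> by (auto intro!: pathin_concat pathin_reverse)
    note conj\<kappa> = lifts_to_conj_loop[OF _ \<kappa>(1) l(1) l\<kappa>, folded \<omega>_def]
    have "lifts_to N p0 \<kappa> b (g 0)" unfolding lifts_to_def using k by (intro exI[of _ k]) (simp add: \<kappa>_def)
    moreover have "lifts_to N p0 l (g 0) (g 0)"
      unfolding lifts_to_def using g by (intro exI[of _ g]) (simp add: l_def)
    ultimately have "lifts_to N p0 \<omega> b b" using conj\<kappa>[OF c0] by blast
    then have \<omega>n: "lifts_to (M n) (q n) \<omega> f f" if "f \<in> topspace (M n)" "q n f = x0" for f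
      using triv that by blast
    have eM: "fst e \<in> topspace (M i)" "q i (fst e) = l 0"
      using lifts_to_in_topspace[OF li] lifts_to_ends[OF li] by auto
    obtain e0 where e0: "lifts_to (M i) (q i) (\<lambda>t. \<kappa> (1 - t)) (fst e) e0"
      using lifts_to_exists[OF cq pathin_reverse[OF \<kappa>(1)] eM(1)] eM(2) \<kappa>(3) by auto
    have "lifts_to (M i) (q i) \<kappa> e0 (fst e)" using lifts_to_reverse[OF e0] by simp
    then have \<omega>e0: "lifts_to (M i) (q i) \<omega> e0 e0" using conj\<kappa>[OF cq] li by blast
    have e0M: "e0 \<in> topspace (M i)" "q i e0 = x0" using lifts_to_in_topspace[OF e0] lifts_to_ends[OF e0] \<kappa>(2) by auto
    obtain \<eta> where \<eta>: "loop_at (M 0) x0 \<eta>" "lifts_to (M i) (q i) \<eta> (x i) e0" by (rule level.fiber_reached[OF e0M])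
    \<comment> \<open>Conjugation inside the fundamental group of \<open>M 0\<close>: the point
      \<open>e0\<close>, at which \<open>\<omega>\<close> closes, is arbitrary in its fiber, whereas
      \<open>Gs i\<close> is the stabilizer of \<open>x i\<close>.\<close>
    define \<theta> where "\<theta> = path_concat (path_concat \<eta> \<omega>) (\<lambda>t. \<eta> (1 - t))"
    have \<theta>: "loop_at (M 0) x0 \<theta>"
      unfolding \<theta>_def by (intro loop_at_concat loop_at_reverse \<eta>(1) \<omega>)
    have \<eta>p: "pathin (M 0) \<eta>" "pathin (M 0) \<omega>" "\<omega> 0 = \<eta> 1" "\<omega> 1 = \<eta> 1" "\<eta> 0 = x0" "\<eta> 1 = x0"
      using \<eta>(1) \<omega> by (auto simp: loop_at_def)
    note conj\<eta> = lifts_to_conj_loop[OF _ \<eta>p(1-4), folded \<theta>_def]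
    have "lifts_to (M i) (q i) \<theta> (x i) (x i)" using conj\<eta>[OF cq \<eta>(2)] \<omega>e0 by blast
    then have "loop_class (M 0) x0 \<theta> \<in> Gs i" using level.loop_class_in_image[OF \<theta>] by (simp add: Gs_eq)
    moreover have "loop_class (M 0) x0 \<theta> \<in> normal_core G (Gs n)"
      unfolding in_normal_core[OF \<theta>]
    proof (intro ballI impI)
      fix f assume f: "f \<in> topspace (M n)" "q n f = x0"
      obtain f1 where f1: "lifts_to (M n) (q n) \<eta> f f1" using level.loop_lift_exists[OF \<eta>(1) f] by blast
      have "f1 \<in> topspace (M n)" "q n f1 = x0" using lifts_to_in_topspace[OF f1] lifts_to_ends[OF f1] \<eta>p(6) by auto
      then show "lifts_to (M n) (q n) \<theta> f f" using conj\<eta>[OF cq f1] \<omega>n by blast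
    qed
    ultimately have "loop_class (M 0) x0 \<theta> \<in> normal_core G (Gs m)" using i by blast
    then have \<theta>m: "lifts_to (M m) (q m) \<theta> f f" if "f \<in> topspace (M m)" "q m f = x0" for f
      using in_normal_core[OF \<theta>] that by blast
    have \<omega>m: "lifts_to (M m) (q m) \<omega> f f" if f: "f \<in> topspace (M m)" "q m f = x0" for f
    proof -
      obtain f1 where f1: "lifts_to (M m) (q m) (\<lambda>t. \<eta> (1 - t)) f f1"
        using level.loop_lift_exists[OF loop_at_reverse[OF \<eta>(1)] f] by blast
      have "f1 \<in> topspace (M m)" "q m f1 = x0" using lifts_to_in_topspace[OF f1] lifts_to_ends[OF f1] \<eta>p(5) by auto
      moreover have "lifts_to (M m) (q m) \<eta> f1 f" using lifts_to_reverse[OF f1] by simp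
      ultimately show ?thesis using conj\<eta>[OF cq] \<theta>m by blast
    qed
    have e'K: "e' \<in> K m" using e'(1) by (simp only: topspace_T)
    then have "e' \<in> topspace (F m)" using K_subset by blast
    then have e'M: "fst e' \<in> topspace (M m)" "q m (fst e') = l 0"
      using e'(2) by (auto simp: topspace_fiber_product l_def)
    obtain f where f: "lifts_to (M m) (q m) (\<lambda>t. \<kappa> (1 - t)) (fst e') f"
      using lifts_to_exists[OF cq pathin_reverse[OF \<kappa>(1)] e'M(1)] e'M(2) \<kappa>(3) by auto
    have "f \<in> topspace (M m)" "q m f = x0" using lifts_to_in_topspace[OF f] lifts_to_ends[OF f] \<kappa>(2) by auto
    moreover have "lifts_to (M m) (q m) \<kappa> f (fst e')" using lifts_to_reverse[OF f] by simp
    ultimately have "lifts_to (M m) (q m) l (fst e') (fst e')" using conj\<kappa>[OF cq] \<omega>m by blast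
    then obtain d' where d': "pathin (M m) d'" "d' 0 = fst e'" "d' 1 = fst e'" "\<And>t. t \<in> {0..1} \<Longrightarrow> q m (d' t) = p0 (g t)"
      by (auto simp: lifts_to_def l_def)
    have c: "pathin (F m) (\<lambda>t. (d' t, g t))" by (rule pathin_F[OF d'(1) g(1) d'(4)])
    have ends: "(d' 0, g 0) = e'" "(d' 1, g 1) = e'" using d'(2,3) e'(2) g(2) by (simp_all add: prod_eq_iff)
    \<comment> \<open>The lift in the fiber product starts in the component and therefore stays in
      it.\<close>
    have "(d' t, g t) \<in> K m" if "t \<in> {0..1}" for t
      by (rule K_path[OF c _ that, of 0]) (use ends(1) e'K in auto)
    then have "pathin (T m) (\<lambda>t. (d' t, g t))" unfolding T_eq pathin_subtopology using c by blast
    then show ?thesis unfolding lifts_to_def using ends by (intro exI[of _ "\<lambda>t. (d' t, g t)"]) simp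
  qed
  then show "\<exists>i. \<forall>g e e'. pathin N g \<longrightarrow> g 0 = g 1 \<longrightarrow> lifts_to (T i) snd g e e \<longrightarrow>
      e' \<in> topspace (T m) \<longrightarrow> snd e' = g 0 \<longrightarrow> lifts_to (T m) snd g e' e'" by blast
qed

end


lemma decreasing_finite_sets_stabilize:
  fixes Z :: "nat \<Rightarrow> 'c set"
  assumes fin: "\<And>i. finite (Z i)" and dec: "\<And>i. Z (Suc i) \<subseteq> Z i"
  obtains i0 where "\<And>i. i0 \<le> i \<Longrightarrow> Z i = Z i0"
proof -
  obtain i0 where i0: "\<And>i. card (Z i0) \<le> card (Z i)"
    using ex_has_least_nat[of "\<lambda>_. True" 0 "\<lambda>i. card (Z i)"] by auto
  have "Z i = Z i0" if "i0 \<le> i" for i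
    by (rule card_subset_eq[OF fin lift_Suc_antimono_le[of Z, OF dec that]])
      (use i0[of i] card_mono[OF fin lift_Suc_antimono_le[of Z, OF dec that]] in simp)
  then show thesis by (rule that)
qed

context pulled_back_solenoid
begin

text \<open>The fibers over \<open>x i\<close> in the components decrease with \<open>i\<close>, so they stabilize, and moving along
  paths of \<open>M i\<close> carries this over to all other points.\<close>

lemma component_stabilizes:
  obtains i0 where "\<And>i u z. i0 \<le> i \<Longrightarrow> u \<in> topspace limit.S \<Longrightarrow> z \<in> topspace N \<Longrightarrow> p0 z = u 0 \<Longrightarrow>
    (u i0, z) \<in> K i0 \<Longrightarrow> (u i, z) \<in> K i"
proof -
  define Z where "Z = (\<lambda>i. {z \<in> topspace N. p0 z = x0 \<and> (x i, z) \<in> K i})"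
  have "finite {z \<in> topspace N. p0 z = x0}" using cov0 base by (simp add: finite_covering_map_def)
  then have fin: "finite (Z i)" for i by (rule rev_finite_subset) (auto simp: Z_def)
  have dec: "Z (Suc i) \<subseteq> Z i" for i
  proof
    fix z assume "z \<in> Z (Suc i)"
    then have z: "z \<in> topspace N" "p0 z = x0" "(x (Suc i), z) \<in> K (Suc i)" by (simp_all add: Z_def)
    from \<phi>_K[OF z(3)] have "(x i, z) \<in> K i" using limit.S_coherent[OF xS, of i] by simp
    with z(1,2) show "z \<in> Z i" by (simp add: Z_def)
  qed
  obtain i0 where i0: "\<And>i. i0 \<le> i \<Longrightarrow> Z i = Z i0"
    by (rule decreasing_finite_sets_stabilize[of Z, OF fin dec]) blast
  have "(u i, z) \<in> K i"
    if i: "i0 \<le> i" and u: "u \<in> topspace limit.S" and z: "z \<in> topspace N" "p0 z = u 0" "(u i0, z) \<in> K i0" for i u z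
  proof -
    have uM: "u i \<in> topspace (M i)" by (rule limit.S_in_T[OF u])
    \<comment> \<open>Chosen at level \<open>i\<close>, so that its lift to the solenoid ends at a
      point that agrees with \<open>x\<close> up to level \<open>i\<close>. Beyond that level it may
      differ, but the comparison of \<open>K i0\<close> with \<open>K i\<close> does not see
      this.\<close>
    obtain h where h: "pathin (M i) h" "h 0 = u i" "h 1 = x i"
      using M_path[of i, unfolded path_connected_space_def, rule_format, OF uM xM] by (elim exE conjE)
    define g where "g = (\<lambda>t. q i (h t))"
    have g: "pathin (M 0) g" unfolding g_def by (rule pathin_continuous_image[OF h(1) covering_map_continuous[OF cq]])
    have g0: "g 0 = u 0" using limit.r_coord[OF u, of i] by (simp add: g_def h(2))
    have g1: "g 1 = x0" using qx by (simp add: g_def h(3))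
    have "q 0 (u 0) = g 0" using g0 by simp
    then obtain d where d: "pathin limit.S d" "d 0 = u" "\<And>t. t \<in> {0..1} \<Longrightarrow> q 0 (d t 0) = g t"
      by (rule limit.path_lift_limit[OF g u]) blast
    have dg: "q j (d t j) = g t" if t: "t \<in> {0..1}" for t j
      using limit.r_coord[OF pathin_in_topspace[OF d(1) t], of j] d(3)[OF t] by simp
    have dh: "d t i = h t" if t: "t \<in> {0..1}" for t
      by (rule path_lift_unique[OF cq limit.pathin_coord[OF d(1)] h(1) _ _ t]) (use dg d(2) h(2) in \<open>simp_all add: g_def\<close>)
    have "d 1 i = x i" using dh[of 1] h(3) by simp
    then have d1: "d 1 i0 = x i0" by (rule limit.agree_below[OF path_finish_in_topspace[OF d(1)] xS _ i])
    have "p0 z = g 0" using z(2) g0 by simp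
    then obtain k where k: "pathin N k" "k 0 = z" "\<And>t. t \<in> {0..1} \<Longrightarrow> p0 (k t) = g t"
      by (rule path_lift_exists[OF c0 g z(1)]) blast
    have dk: "pathin (F j) (\<lambda>t. (d t j, k t))" for j
      by (rule pathin_F[OF limit.pathin_coord[OF d(1)] k(1)]) (simp add: dg k(3))
    have "(d 1 i0, k 1) \<in> K i0"
      using K_path[OF dk, where s = 0 and t = 1, of i0] z(3) d(2) k(2) by simp
    then have "k 1 \<in> Z i0" using d1 path_finish_in_topspace[OF k(1)] k(3)[of 1] g1 by (simp add: Z_def)
    then have "(x i, k 1) \<in> K i" using i0[OF i] by (auto simp: Z_def)
    then have "(d 1 i, k 1) \<in> K i" using \<open>d 1 i = x i\<close> by simp
    then have "(d 0 i, k 0) \<in> K i" using K_path[OF dk, where s = 1 and t = 0] by simp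
    then show ?thesis using d(2) k(2) by simp
  qed
  then show thesis by (rule that)
qed

section \<open>The projection of the pullback solenoid to the solenoid is a covering\<close>

lemma K_clopen: "openin (F i) (K i)" "closedin (F i) (K i)"
proof -
  have "locally_path_connected_space (F i)"
    by (rule covering_locally_path_connected[OF finite_covering_map_imp_covering_map[OF covF] N_lpc])
  then show "openin (F i) (K i)"
    by (intro openin_connected_component_of_locally_connected_space locally_path_connected_imp_locally_connected_space)
  show "closedin (F i) (K i)" by (rule closedin_connected_component_of)
qed

abbreviation "S' \<equiv> pullback.S"

lemma S'_coord:
  assumes w: "w \<in> topspace S'"
  shows "w i \<in> K i" "p i (fst (w (Suc i))) = fst (w i)" "snd (w i) = snd (w 0)"
proof -
  show "w i \<in> K i" using pullback.S_in_T[OF w, of i] by (simp only: topspace_T)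
  show "p i (fst (w (Suc i))) = fst (w i)"
    using arg_cong[OF pullback.S_coherent[OF w, of i], of fst] by (simp add: case_prod_unfold)
  show "snd (w i) = snd (w 0)" by (rule pullback.r_coord[OF w])
qed

lemma S'_in_F:
  assumes w: "w \<in> topspace S'"
  shows "fst (w i) \<in> topspace (M i)" "snd (w 0) \<in> topspace N" "p0 (snd (w 0)) = fst (w 0)"
proof -
  have F: "w i \<in> topspace (F i)" for i using S'_coord(1)[OF w] K_subset by blast
  show "fst (w i) \<in> topspace (M i)" using F[of i] by (auto simp: topspace_fiber_product)
  show "snd (w 0) \<in> topspace N" "p0 (snd (w 0)) = fst (w 0)" using F[of 0] by (auto simp: topspace_fiber_product)
qed

lemma proj_continuous: "continuous_map S' limit.S pullback_solenoid_proj"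
  unfolding continuous_map_inverse_limit pullback_solenoid_proj_def
proof (intro conjI allI ballI)
  fix i
  have "continuous_map S' (F i) (\<lambda>w. w i)"
    using pullback.coord_continuous[of i] unfolding T_eq by (simp add: continuous_map_in_subtopology)
  from continuous_map_compose[OF this fiber_product_continuous_fst]
  show "continuous_map S' (M i) (\<lambda>w. fst (w i))" by (simp add: o_def)
qed (rule S'_coord(2))

lemma proj_in_S: "w \<in> topspace S' \<Longrightarrow> pullback_solenoid_proj w \<in> topspace limit.S"
  using proj_continuous by (auto simp: continuous_map_def)

text \<open>Over an evenly covered set of the base, each slice \<open>U\<close> of \<open>N\<close>
  offers the section \<open>\<lambda>v i. (v i, s U (v 0))\<close>, but only some of these sections
  land in the chosen components. By stabilization this is decided at the single level
  \<open>i0\<close>, and there the condition is clopen.\<close>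

lemma covering_pullback_solenoid: "covering_map S' limit.S pullback_solenoid_proj"
proof -
  let ?pr = "pullback_solenoid_proj :: (nat \<Rightarrow> 'a \<times> 'b) \<Rightarrow> nat \<Rightarrow> 'a"
  obtain i0 where i0: "\<And>i u z. i0 \<le> i \<Longrightarrow> u \<in> topspace limit.S \<Longrightarrow> z \<in> topspace N \<Longrightarrow> p0 z = u 0 \<Longrightarrow>
    (u i0, z) \<in> K i0 \<Longrightarrow> (u i, z) \<in> K i" by (rule component_stabilizes) blast
  \<comment> \<open>Above \<open>i0\<close> this is stabilization; below, the bonding maps preserve
    the components.\<close>
  have in_K: "(u i, z) \<in> K i"
    if u: "u \<in> topspace limit.S" and z: "z \<in> topspace N" "p0 z = u 0" "(u i0, z) \<in> K i0" for u z i
  proof (cases "i0 \<le> i")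
    case True
    then show ?thesis by (rule i0[OF _ that])
  next
    case False
    then have "i \<le> i0" by simp
    then show ?thesis
    proof (induction rule: inc_induct)
      case base
      show ?case by (rule z(3))
    next
      case (step n)
      from \<phi>_K[OF step.IH] show ?case using limit.S_coherent[OF u, of n] by simp
    qed
  qed
  have in_S': "(\<lambda>i. (u i, z)) \<in> topspace S'"
    if u: "u \<in> topspace limit.S" and z: "z \<in> topspace N" "p0 z = u 0" "(u i0, z) \<in> K i0" for u z
    unfolding pullback.topspace_S topspace_T using in_K[OF that] limit.S_coherent[OF u] by simp
  have surj: "?pr ` topspace S' = topspace limit.S"
  proof
    show "topspace limit.S \<subseteq> ?pr ` topspace S'"
    proof
      fix u assume u: "u \<in> topspace limit.S"
      \<comment> \<open>The missing second coordinate over \<open>u\<close> is the end of the lift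
        to \<open>N\<close>, from \<open>b\<close>, of the projection of a path from
        \<open>x i0\<close> to \<open>u i0\<close>; the two lifts together never leave the
        component.\<close>
      obtain h where h: "pathin (M i0) h" "h 0 = x i0" "h 1 = u i0"
        using M_path[of i0, unfolded path_connected_space_def, rule_format, OF xM limit.S_in_T[OF u]] by (elim exE conjE)
      have g: "pathin (M 0) (\<lambda>t. q i0 (h t))"
        by (rule pathin_continuous_image[OF h(1) covering_map_continuous[OF cq]])
      have "p0 b = q i0 (h 0)" using p0b qx h(2) by simp
      then obtain k where k: "pathin N k" "k 0 = b" "\<And>t. t \<in> {0..1} \<Longrightarrow> p0 (k t) = q i0 (h t)"
        by (rule path_lift_exists[OF c0 g bN]) blast
      have hk: "pathin (F i0) (\<lambda>t. (h t, k t))" by (rule pathin_F[OF h(1) k(1)]) (simp add: k(3))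
      have "(h 0, k 0) \<in> K i0" unfolding h(2) k(2) mem_Collect_eq connected_component_of_refl by (rule xbF)
      then have "(h 1, k 1) \<in> K i0" using K_path[OF hk, where s = 0 and t = 1] by simp
      moreover have "p0 (k 1) = u 0" using k(3)[of 1] limit.r_coord[OF u, of i0] h(3) by simp
      ultimately have "(\<lambda>i. (u i, k 1)) \<in> topspace S'"
        using in_S'[OF u path_finish_in_topspace[OF k(1)]] h(3) by simp
      moreover have "?pr (\<lambda>i. (u i, k 1)) = u" by (simp add: pullback_solenoid_proj_def)
      ultimately show "u \<in> ?pr ` topspace S'" by (metis imageI)
    qed
  qed (use proj_in_S in auto)
  have "\<exists>V. u \<in> V \<and> evenly_covered S' limit.S ?pr V" if u: "u \<in> topspace limit.S" for u
  proof -
    have u0: "u 0 \<in> topspace (M 0)" by (rule limit.S_in_T[OF u])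
    obtain V0 where V0: "u 0 \<in> V0" "evenly_covered N (M 0) p0 V0" by (rule covering_map_nbhd[OF c0 u0])
    obtain \<U> where \<U>: "openin (M 0) V0" "\<Union>\<U> = {z \<in> topspace N. p0 z \<in> V0}" "\<And>U. U \<in> \<U> \<Longrightarrow> openin N U"
      "\<And>U U'. U \<in> \<U> \<Longrightarrow> U' \<in> \<U> \<Longrightarrow> U \<noteq> U' \<Longrightarrow> U \<inter> U' = {}"
      "\<And>U. U \<in> \<U> \<Longrightarrow> homeomorphic_map (subtopology N U) (subtopology (M 0) V0) p0"
      by (rule evenly_coveredE[OF V0(2)], rule that; simp)
    have fin\<U>: "finite \<U>"
      by (rule finite_slices[OF _ V0(1) \<U>]) (use cov0 u0 in \<open>auto simp: finite_covering_map_def\<close>)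
    have "\<forall>U \<in> \<U>. \<exists>s. homeomorphic_maps (subtopology N U) (subtopology (M 0) V0) p0 s"
      using \<U>(5) homeomorphic_map_maps by blast
    from bchoice[OF this] obtain s where s: "\<forall>U \<in> \<U>. homeomorphic_maps (subtopology N U) (subtopology (M 0) V0) p0 (s U)"
      by (elim exE)
    have sU: "s U v \<in> U" "s U v \<in> topspace N" "p0 (s U v) = v" if "U \<in> \<U>" "v \<in> V0" for U v
    proof -
      have v: "v \<in> topspace (subtopology (M 0) V0)" using that(2) openin_subset[OF \<U>(1)] by auto
      have hm: "homeomorphic_maps (subtopology N U) (subtopology (M 0) V0) p0 (s U)" using s that(1) by blast
      then have "s U v \<in> topspace (subtopology N U)" using v by (auto simp: homeomorphic_maps_def continuous_map_def)
      then show "s U v \<in> U" "s U v \<in> topspace N" by auto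
      show "p0 (s U v) = v" using hm v by (simp add: homeomorphic_maps_def)
    qed
    have sp: "s U (p0 z) = z" if "U \<in> \<U>" "z \<in> U" for U z
      using s that openin_subset[OF \<U>(3)[OF that(1)]] by (auto simp: homeomorphic_maps_def)
    have s_cont: "continuous_map (subtopology (M 0) V0) N (s U)" if "U \<in> \<U>" for U
      using s that by (auto simp: homeomorphic_maps_def continuous_map_in_subtopology)
    define V1 where "V1 = {v \<in> topspace limit.S. v 0 \<in> V0}"
    have V1: "openin limit.S V1"
      unfolding V1_def by (rule openin_continuous_map_preimage[OF limit.coord_continuous \<U>(1)])
    have cont0: "continuous_map (subtopology limit.S V1) (subtopology (M 0) V0) (\<lambda>v. v 0)"
      using limit.coord_continuous[of 0] by (auto simp: continuous_map_in_subtopology V1_def intro: continuous_map_from_subtopology)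
    have contN: "continuous_map (subtopology limit.S V1) N (\<lambda>v. s U (v 0))" if "U \<in> \<U>" for U
      using continuous_map_compose[OF cont0 s_cont[OF that]] by (simp add: o_def)
    have contF: "continuous_map (subtopology limit.S V1) (F i) (\<lambda>v. (v i, s U (v 0)))" if U: "U \<in> \<U>" for i U
    proof -
      have "continuous_map (subtopology limit.S V1) (prod_topology (M i) N) (\<lambda>v. (v i, s U (v 0)))"
        by (intro continuous_map_pairedI contN[OF U] continuous_map_from_subtopology[OF limit.coord_continuous])
      moreover have "q i (v i) = p0 (s U (v 0))" if v: "v \<in> V1" for v
        using limit.r_coord[of v i] sU(3)[OF U, of "v 0"] v by (simp add: V1_def)
      ultimately show ?thesis unfolding fiber_product_def by (auto simp: continuous_map_in_subtopology)
    qed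
    define D where "D = (\<lambda>U. {v \<in> V1. (v i0, s U (v 0)) \<in> K i0})"
    have V1top: "topspace (subtopology limit.S V1) = V1" using openin_subset[OF V1] by auto
    have D: "openin limit.S (D U)" "openin limit.S (V1 - D U)" if U: "U \<in> \<U>" for U
    proof -
      have "openin (subtopology limit.S V1) (D U)"
        using openin_continuous_map_preimage[OF contF[OF U] K_clopen(1)] by (simp only: D_def V1top)
      then show "openin limit.S (D U)" using V1 openin_trans_full by blast
      have "closedin (subtopology limit.S V1) (D U)"
        using closedin_continuous_map_preimage[OF contF[OF U] K_clopen(2)] by (simp only: D_def V1top)
      then have "openin (subtopology limit.S V1) (V1 - D U)" unfolding closedin_def V1top by blast
      then show "openin limit.S (V1 - D U)" using V1 openin_trans_full by blast
    qed
    \<comment> \<open>For each of the finitely many slices, \<open>V\<close> is kept entirely inside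
      or entirely outside the clopen set \<open>D U\<close>, according to \<open>u\<close>. So the
      sheets over \<open>V\<close> are indexed by the slices \<open>U\<close> with \<open>u\<close>
      in \<open>D U\<close>.\<close>
    define V where "V = V1 \<inter> (\<Inter>U\<in>\<U>. if u \<in> D U then D U else V1 - D U)"
    have "openin limit.S V"
    proof (cases "\<U> = {}")
      case True then show ?thesis using V1 by (simp add: V_def)
    next
      case False then show ?thesis unfolding V_def using fin\<U> V1 D
        by (intro openin_Int openin_Inter) auto
    qed
    have VV1: "V \<subseteq> V1" by (auto simp: V_def)
    have VD: "v \<in> D U \<longleftrightarrow> u \<in> D U" if "v \<in> V" "U \<in> \<U>" for v U
      using that by (auto simp: V_def split: if_splits)
    have uV: "u \<in> V" using u V0(1) by (auto simp: V_def V1_def)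
    define A where "A = (\<lambda>U. {w \<in> topspace S'. ?pr w \<in> V \<and> snd (w 0) \<in> U})"
    have "evenly_covered S' limit.S ?pr V"
    proof (rule evenly_coveredI[OF \<open>openin limit.S V\<close>, of "A ` {U \<in> \<U>. u \<in> D U}"])
      show "\<Union>(A ` {U \<in> \<U>. u \<in> D U}) = {w \<in> topspace S'. ?pr w \<in> V}"
      proof
        show "{w \<in> topspace S'. ?pr w \<in> V} \<subseteq> \<Union>(A ` {U \<in> \<U>. u \<in> D U})"
        proof
          fix w assume "w \<in> {w \<in> topspace S'. ?pr w \<in> V}"
          then have w: "w \<in> topspace S'" "?pr w \<in> V" by auto
          have p0w: "p0 (snd (w 0)) = ?pr w 0" using S'_in_F(3)[OF w(1)] by (simp add: pullback_solenoid_proj_def)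
          have "?pr w 0 \<in> V0" using w(2) VV1 by (auto simp: V1_def)
          then have "snd (w 0) \<in> \<Union>\<U>" unfolding \<U>(2) using S'_in_F(2)[OF w(1)] p0w by simp
          then obtain U where U: "U \<in> \<U>" "snd (w 0) \<in> U" by blast
          have "s U (?pr w 0) = snd (w 0)" using sp[OF U] p0w by simp
          moreover have "w i0 = (?pr w i0, snd (w 0))"
            using S'_coord(3)[OF w(1), of i0] by (simp add: pullback_solenoid_proj_def prod_eq_iff)
          ultimately have "?pr w \<in> D U" using S'_coord(1)[OF w(1), of i0] w(2) VV1 by (auto simp: D_def)
          then have "u \<in> D U" using VD[OF w(2) U(1)] by simp
          then show "w \<in> \<Union>(A ` {U \<in> \<U>. u \<in> D U})" using U w by (auto simp: A_def)
        qed
      qed (auto simp: A_def)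
    next
      fix W assume "W \<in> A ` {U \<in> \<U>. u \<in> D U}"
      then obtain U where U: "U \<in> \<U>" "u \<in> D U" "W = A U" by auto
      have snd_cont: "continuous_map S' N (\<lambda>w. snd (w 0))" by (rule pullback.\<rho>_continuous)
      have "W = {w \<in> topspace S'. ?pr w \<in> V} \<inter> {w \<in> topspace S'. snd (w 0) \<in> U}" by (auto simp: U(3) A_def)
      then show Wop: "openin S' W"
        using openin_continuous_map_preimage[OF proj_continuous \<open>openin limit.S V\<close>]
          openin_continuous_map_preimage[OF snd_cont \<U>(3)[OF U(1)]] by auto
      let ?sec = "\<lambda>v i. (v i, s U (v 0))"
      have Vv: "v \<in> topspace limit.S" "v 0 \<in> V0" "v \<in> D U" if "v \<in> V" for v
        using that VV1 VD[OF that U(1)] U(2) by (auto simp: V1_def)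
      have sec_in: "?sec v \<in> topspace S'" if v: "v \<in> V" for v
        by (rule in_S'[OF Vv(1)[OF v] sU(2,3)[OF U(1) Vv(2)[OF v]]]) (use Vv(3)[OF v] in \<open>simp add: D_def\<close>)
      have "homeomorphic_maps (subtopology S' W) (subtopology limit.S V) ?pr ?sec"
        unfolding homeomorphic_maps_def
      proof (intro conjI ballI)
        show "continuous_map (subtopology S' W) (subtopology limit.S V) ?pr"
          using proj_continuous by (auto simp: continuous_map_in_subtopology U(3) A_def intro: continuous_map_from_subtopology)
        have "continuous_map (subtopology limit.S V) S' ?sec"
          unfolding continuous_map_inverse_limit
        proof (intro conjI allI ballI)
          fix i
          have "continuous_map (subtopology limit.S V) (F i) (\<lambda>v. ?sec v i)"
            by (rule continuous_map_from_subtopology_mono[OF contF[OF U(1)] VV1])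
          moreover have "?sec v i \<in> K i" if "v \<in> V" for v using S'_coord(1)[OF sec_in[OF that], of i] by simp
          ultimately show "continuous_map (subtopology limit.S V) (T i) (\<lambda>v. ?sec v i)"
            unfolding T_eq by (auto simp: continuous_map_in_subtopology)
        next
          fix v i assume "v \<in> topspace (subtopology limit.S V)"
          then have "v \<in> topspace limit.S" by simp
          then show "\<phi> i (?sec v (Suc i)) = ?sec v i" using limit.S_coherent by simp
        qed
        moreover have "?sec v \<in> W" if "v \<in> V" for v
          using sec_in[OF that] sU(1)[OF U(1) Vv(2)[OF that]] that by (simp add: U(3) A_def pullback_solenoid_proj_def)
        ultimately show "continuous_map (subtopology limit.S V) (subtopology S' W) ?sec"
          by (auto simp: continuous_map_in_subtopology)
        show "?sec (?pr w) = w" if "w \<in> topspace (subtopology S' W)" for w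
        proof -
          have w: "w \<in> topspace S'" "snd (w 0) \<in> U" using that by (auto simp: U(3) A_def)
          have "s U (fst (w 0)) = snd (w 0)" using sp[OF U(1) w(2)] S'_in_F(3)[OF w(1)] by simp
          moreover have "(fst (w i), snd (w 0)) = w i" for i using S'_coord(3)[OF w(1), of i] by (simp only: prod_eq_iff fst_conv snd_conv)
          ultimately show ?thesis by (simp add: pullback_solenoid_proj_def)
        qed
      qed (simp add: pullback_solenoid_proj_def)
      then show "homeomorphic_map (subtopology S' W) (subtopology limit.S V) ?pr"
        using homeomorphic_map_maps by blast
      fix W' assume "W' \<in> A ` {U \<in> \<U>. u \<in> D U}" "W \<noteq> W'"
      then obtain U' where "U' \<in> \<U>" "W' = A U'" "U \<noteq> U'" using U(3) by blast
      then show "W \<inter> W' = {}" using \<U>(4)[OF U(1)] unfolding U(3) A_def by blast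
    qed
    with uV show ?thesis by blast
  qed
  then show ?thesis unfolding covering_map_evenly_covered using proj_continuous surj by blast
qed

end

theorem corollary1p15:
  fixes M :: "nat \<Rightarrow> 'a topology"
    and p :: "nat \<Rightarrow> 'a \<Rightarrow> 'a"
    and x0 :: 'a
    and x :: "nat \<Rightarrow> 'a"
  defines "G \<equiv> fundamental_group (M 0) x0"
    and "S \<equiv> inverse_limit_space M p"
    and "Gs \<equiv> monodromy_chain M p x"
  assumes tower: "weak_solenoid_tower M p"
    and base: "x0 \<in> topspace (M 0)"
    and basepoint: "x \<in> solenoid_fiber M p x0"
    and not_weakly_normal: "\<not> weakly_normal_chain G Gs"
    and discriminant_finite: "finite (carrier (discriminant_group G Gs))"
    and discriminant_nontrivial:
      "carrier (discriminant_group G Gs) \<noteq> {\<one>\<^bsub>discriminant_group G Gs\<^esub>}"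
  shows "\<exists>(M0' :: ('a \<times> nat) topology) p0 x0'.
           finite_covering_map M0' (M 0) p0 \<and> connected_space M0' \<and>
           x0' \<in> topspace M0' \<and> p0 x0' = x0 \<and>
           (let S' = pullback_solenoid M p x M0' p0 x0' in
              covering_map S' S pullback_solenoid_proj \<and>
              \<not> S' homeomorphic_space S)"
proof -
  interpret solenoid M p x0 x
    by unfold_locales (use tower base basepoint in auto)
  have "\<exists>n. \<forall>m. \<exists>i. Gs i \<inter> normal_core G (Gs n) \<subseteq> normal_core G (Gs m)"
    unfolding G_def Gs_def
    by (rule finite_discriminant_core[OF Gs_subgroup Gs_finite Gs_decreasing discriminant_finite[unfolded G_def Gs_def]])
  then obtain n where n: "\<And>m. \<exists>i. Gs i \<inter> normal_core G (Gs n) \<subseteq> normal_core G (Gs m)" by blast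
  have "finite {e \<in> topspace (M n). tower_proj p n e = x0}"
    using covq[of n] base by (simp add: finite_covering_map_def)
  \<comment> \<open>The whole fiber at level \<open>n\<close> is trivialized: a loop of
    \<open>M 0\<close> that lifts to a loop at the base point of \<open>N\<close> acts trivially on
    it, so its class lies in the core of \<open>Gs n\<close>.\<close>
  from trivializing_covering[OF this order_refl]
  obtain N :: "('a \<times> nat) topology" and p0 b where N: "finite_covering_map N (M 0) p0" "connected_space N"
    "b \<in> topspace N" "p0 b = x0"
    "\<And>g e. lifts_to N p0 g b b \<Longrightarrow> e \<in> topspace (M n) \<Longrightarrow> tower_proj p n e = x0 \<Longrightarrow>
      lifts_to (M n) (tower_proj p n) g e e" by blast
  interpret pulled_back_solenoid M p x0 x N p0 b
    by unfold_locales (use N in auto)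
  have "stable_return (pullback_solenoid M p x N p0 b)"
    unfolding pullback_solenoid_eq by (rule stable_return_pullback[OF n[unfolded G_def Gs_def] N(5)])
  moreover have "\<not> stable_return S"
    unfolding S_def by (rule not_stable_return_if_not_weakly_normal[OF not_weakly_normal[unfolded G_def Gs_def]])
  ultimately have "\<not> pullback_solenoid M p x N p0 b homeomorphic_space S"
    using stable_return_homeomorphic by blast
  moreover have "covering_map (pullback_solenoid M p x N p0 b) S pullback_solenoid_proj"
    unfolding S_def pullback_solenoid_eq by (rule covering_pullback_solenoid)
  ultimately show ?thesis using N(1-4) unfolding Let_def by blast
qed

end
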